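(* Let $(M,g,\nu^9)$ be a $\mathrm{Spin}(9)$-manifold. Then the canonical $8$-form $\Omega^8$ on $M$ (which is determined up to a non-zero constant factor) is given by $$\Omega^8=\sum_{\substack{i,j=0,\dots,8\\ i',j'=0,\dots,8}}\omega_{ij}\wedge\omega_{ij'}\wedge\omega_{i'j}\wedge\omega_{i'j'},$$ where the $\omega_{ij}$, $0\leqslant i<j\leqslant 8$, are the local $2$-forms associated with local bases $I_0,\dots,I_8$ of $\nu^9$, and where $\omega_{ij}=-\omega_{ji}$ if $i>j$ and $\omega_{ij}=0$ if $i=j$.
   Context: A $\mathrm{Spin}(9)$-structure on a connected, oriented $16$-dimensional Riemannian manifold $(M,g)$ is a reduction of its bundle of oriented orthonormal frames $\mathrm{SO}(M)$ to $\rho(\mathrm{Spin}(9))\subset\mathrm{SO}(16)$, where $\rho$ is the $16$-dimensional (real, irreducible) spin representation, on $\Delta_9=\mathbb{R}^{16}$. Equivalently, it is given by a nine-dimensional subbundle $\nu^9$ of $\mathrm{End}(TM)$ locally spanned by sections $I_0,\dots,I_8$ satisfying $$I_iI_j+I_jI_i=0\ (i\neq j),\quad I_i^2=\mathrm{I},\quad I_i^T=I_i,\quad \mathrm{tr}\,I_i=0,\qquad i,j=0,\dots,8.$$ Then $(M,g,\nu^9)$ is called a $\mathrm{Spin}(9)$-manifold. Given such a local basis $I_0,\dots,I_8$, the local $2$-forms $\omega_{ij}$, $0\leqslant i<j\leqslant 8$, are defined by $\omega_{ij}(X,Y)=g(X,I_iI_jY)$. Canonical $8$-form: the $\mathrm{Spin}(9)$-module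 $\Lambda^8(\Delta_9^* )$ contains one and only one, up to a non-zero factor, non-zero $\mathrm{Spin}(9)$-invariant element $\Omega^8_0$. Transporting $\Omega^8_0$ to the tangent spaces of $M$ by means of the frames belonging to the $\mathrm{Spin}(9)$-structure yields a global $8$-form $\Omega^8$ on $M$, the canonical $8$-form, which is therefore determined up to a non-zero constant factor. In particular, the theorem includes that the displayed expression is independent of the chosen local bases (hence globally defined), $\mathrm{Spin}(9)$-invariant at each point, and non-zero. *)

theory Defs
  imports "HOL-Analysis.Analysis" "HOL-Combinatorics.Permutations"
begin

section \<open>Smooth maps between Euclidean spaces\<close>

text \<open>\<open>Ck_on k S f\<close> is only meant for open \<open>S\<close>: \<open>f\<close> is of class \<open>C\<^sup>k\<close> on \<open>S\<close>.\<close>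

primrec Ck_on :: "nat \<Rightarrow> 'a::euclidean_space set \<Rightarrow> ('a \<Rightarrow> 'b::real_normed_vector) \<Rightarrow> bool" where
  "Ck_on 0 S f \<longleftrightarrow> continuous_on S f"
| "Ck_on (Suc k) S f \<longleftrightarrow>
     (\<forall>x\<in>S. f differentiable (at x)) \<and>
     (\<forall>v. Ck_on k S (\<lambda>x. frechet_derivative f (at x) v))"

definition smooth_on :: "'a::euclidean_space set \<Rightarrow> ('a \<Rightarrow> 'b::real_normed_vector) \<Rightarrow> bool" where
  "smooth_on S f \<longleftrightarrow> (\<forall>k. Ck_on k S f)"


section \<open>Oriented smooth manifolds\<close>

text \<open>A manifold is a topological space \<open>'m\<close> (the whole type) with an atlas. A chart is a pair of
  its domain and its coordinate map.\<close>

type_synonym ('m, 'n) chart = "'m set \<times> ('m \<Rightarrow> real ^ 'n)"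

abbreviation chart_inv :: "('m, 'n::finite) chart \<Rightarrow> real ^ 'n \<Rightarrow> 'm" where
  "chart_inv c \<equiv> inv_into (fst c) (snd c)"

definition transition :: "('m, 'n::finite) chart \<Rightarrow> ('m, 'n) chart \<Rightarrow> real ^ 'n \<Rightarrow> real ^ 'n" where
  "transition c c' x = snd c' (chart_inv c x)"

text \<open>The orientation of the manifold is the one for which all charts of the (not necessarily
  maximal) atlas are positive.\<close>

definition oriented_smooth_atlas :: "('m::topological_space, 'n::finite) chart set \<Rightarrow> bool" where
  "oriented_smooth_atlas A \<longleftrightarrow>
     (\<Union>c\<in>A. fst c) = UNIV \<and>
     (\<forall>c\<in>A. open (fst c) \<and> open (snd c ` fst c) \<and>
            homeomorphism (fst c) (snd c ` fst c) (snd c) (chart_inv c)) \<and>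
     (\<forall>c\<in>A. \<forall>c'\<in>A.
        smooth_on (snd c ` (fst c \<inter> fst c')) (transition c c') \<and>
        (\<forall>x \<in> snd c ` (fst c \<inter> fst c'). det (jacobian (transition c c') (at x)) > 0))"

text \<open>As no dependent types are available, the tangent space \<open>T\<^sub>pM\<close> is represented by \<open>real ^ 'n\<close>,
  a tangent vector being given by its components in the chosen chart \<open>chart_at A p\<close> around \<open>p\<close>.
  Endomorphisms of \<open>T\<^sub>pM\<close> are the corresponding matrices.
  Since the choice of \<open>chart_at A p\<close> need not depend continuously on \<open>p\<close>, smoothness of tensor
  fields has to be tested on their components in a fixed chart \<open>c\<close>: \<open>to_coords A c p\<close> maps tangent
  vectors at \<open>p\<close> to their components in \<open>c\<close>, and \<open>of_coords A c p\<close> is the inverse map.\<close>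

definition chart_at :: "('m, 'n::finite) chart set \<Rightarrow> 'm \<Rightarrow> ('m, 'n) chart" where
  "chart_at A p = (SOME c. c \<in> A \<and> p \<in> fst c)"

definition to_coords ::
  "('m, 'n::finite) chart set \<Rightarrow> ('m, 'n) chart \<Rightarrow> 'm \<Rightarrow> real ^ 'n ^ 'n" where
  "to_coords A c p = jacobian (transition (chart_at A p) c) (at (snd (chart_at A p) p))"

definition of_coords ::
  "('m, 'n::finite) chart set \<Rightarrow> ('m, 'n) chart \<Rightarrow> 'm \<Rightarrow> real ^ 'n ^ 'n" where
  "of_coords A c p = jacobian (transition c (chart_at A p)) (at (snd c p))"


section \<open>Tensor fields\<close>

text \<open>\<open>smooth_in_charts A U T\<close>: for every chart \<open>c\<close> of \<open>A\<close>, the quantity \<open>T c p\<close> (built from the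
  components of a tensor field in the chart \<open>c\<close>) depends smoothly on \<open>p \<in> U \<inter> fst c\<close>.\<close>

definition smooth_in_charts ::
  "('m, 'n::finite) chart set \<Rightarrow> 'm set \<Rightarrow> (('m, 'n) chart \<Rightarrow> 'm \<Rightarrow> 'b::real_normed_vector) \<Rightarrow> bool"
  where
  "smooth_in_charts A U T \<longleftrightarrow>
     (\<forall>c\<in>A. smooth_on (snd c ` (fst c \<inter> U)) (\<lambda>x. T c (chart_inv c x)))"

definition riemannian_metric ::
  "('m, 'n::finite) chart set \<Rightarrow> ('m \<Rightarrow> real ^ 'n \<Rightarrow> real ^ 'n \<Rightarrow> real) \<Rightarrow> bool" where
  "riemannian_metric A g \<longleftrightarrow>
     (\<forall>p. bilinear (g p) \<and> (\<forall>v w. g p v w = g p w v) \<and> (\<forall>v. v \<noteq> 0 \<longrightarrow> g p v v > 0)) \<and>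
     (\<forall>v w. smooth_in_charts A UNIV (\<lambda>c p. g p (of_coords A c p *v v) (of_coords A c p *v w)))"

definition smooth_endomorphism_field ::
  "('m, 'n::finite) chart set \<Rightarrow> 'm set \<Rightarrow> ('m \<Rightarrow> real ^ 'n ^ 'n) \<Rightarrow> bool" where
  "smooth_endomorphism_field A U J \<longleftrightarrow>
     smooth_in_charts A U (\<lambda>c p. to_coords A c p ** J p ** of_coords A c p)"

text \<open>A frame at \<open>p\<close> is a linear isomorphism from the standard space to \<open>T\<^sub>pM\<close>; its columns are the
  vectors of the frame.\<close>

definition oriented_orthonormal_frame ::
  "('m \<Rightarrow> real ^ 'n \<Rightarrow> real ^ 'n \<Rightarrow> real) \<Rightarrow> 'm \<Rightarrow> real ^ 'n ^ 'n::finite \<Rightarrow> bool" where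
  "oriented_orthonormal_frame g p u \<longleftrightarrow>
     (\<forall>v w. g p (u *v v) (u *v w) = v \<bullet> w) \<and> det u > 0"

definition smooth_frame_field ::
  "('m, 'n::finite) chart set \<Rightarrow> 'm set \<Rightarrow> ('m \<Rightarrow> real ^ 'n ^ 'n) \<Rightarrow> bool" where
  "smooth_frame_field A U s \<longleftrightarrow> smooth_in_charts A U (\<lambda>c p. to_coords A c p ** s p)"


section \<open>Exterior forms\<close>

text \<open>A \<open>k\<close>-form on \<open>'v\<close> is a function of sequences of vectors of which only the entries
  \<open>0, \<dots>, k - 1\<close> matter.\<close>

type_synonym 'v form = "(nat \<Rightarrow> 'v) \<Rightarrow> real"

definition alternating_form :: "nat \<Rightarrow> 'v::real_vector form \<Rightarrow> bool" where
  "alternating_form k \<alpha> \<longleftrightarrow>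
     (\<forall>v w. (\<forall>i<k. v i = w i) \<longrightarrow> \<alpha> v = \<alpha> w) \<and>
     (\<forall>v. \<forall>i<k. linear (\<lambda>x. \<alpha> (v(i := x)))) \<and>
     (\<forall>v. \<forall>i<k. \<forall>j<k. i \<noteq> j \<and> v i = v j \<longrightarrow> \<alpha> v = 0)"

definition wedge :: "nat \<Rightarrow> nat \<Rightarrow> 'v form \<Rightarrow> 'v form \<Rightarrow> 'v form" where
  "wedge k l \<alpha> \<beta> = (\<lambda>v. (\<Sum>\<sigma> | \<sigma> permutes {..<k + l}.
      of_int (sign \<sigma>) * \<alpha> (\<lambda>i. v (\<sigma> i)) * \<beta> (\<lambda>i. v (\<sigma> (k + i)))) / (fact k * fact l))"

definition differential_form ::
  "('m, 'n::finite) chart set \<Rightarrow> nat \<Rightarrow> ('m \<Rightarrow> (real ^ 'n) form) \<Rightarrow> bool" where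
  "differential_form A k \<Omega> \<longleftrightarrow>
     (\<forall>p. alternating_form k (\<Omega> p)) \<and>
     (\<forall>v. smooth_in_charts A UNIV (\<lambda>c p. \<Omega> p (\<lambda>i. of_coords A c p *v v i)))"


section \<open>The group Spin(9) and its spin representation\<close>

text \<open>\<open>\<Delta>\<^sub>9 = \<real>\<^sup>1\<^sup>6\<close> is realised as a fourfold tensor power of \<open>\<real>\<^sup>2\<close>, whose basis is indexed by \<open>bool\<close>
  (with \<open>False\<close> as first index).\<close>

type_synonym idx16 = "bool \<times> bool \<times> bool \<times> bool"
type_synonym R16 = "real ^ idx16"
type_synonym End16 = "real ^ idx16 ^ idx16"

definition kron :: "real ^ 'a ^ 'a \<Rightarrow> real ^ 'b ^ 'b \<Rightarrow> real ^ ('a \<times> 'b) ^ ('a::finite \<times> 'b::finite)"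
  (infixr "\<otimes>\<^sub>K" 72) where
  "A \<otimes>\<^sub>K B = (\<chi> i j. A $ fst i $ fst j * B $ snd i $ snd j)"

definition mat2 :: "real \<Rightarrow> real \<Rightarrow> real \<Rightarrow> real \<Rightarrow> real ^ bool ^ bool" where
  "mat2 a b c d = (\<chi> i j. if i then (if j then d else c) else (if j then b else a))"

definition clifford_system :: "(R16 \<Rightarrow> R16 \<Rightarrow> real) \<Rightarrow> (nat \<Rightarrow> End16) \<Rightarrow> bool" where
  "clifford_system h J \<longleftrightarrow>
     (\<forall>i\<le>8. \<forall>j\<le>8. i \<noteq> j \<longrightarrow> J i ** J j + J j ** J i = 0) \<and>
     (\<forall>i\<le>8. J i ** J i = mat 1) \<and>
     (\<forall>i\<le>8. \<forall>v w. h (J i *v v) w = h v (J i *v w)) \<and>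
     (\<forall>i\<le>8. trace (J i) = 0)"

text \<open>Nine symmetric, trace-free, pairwise anticommuting involutions of \<open>\<real>\<^sup>1\<^sup>6\<close> (see
  \<open>clifford_system_gen\<close> below): Clifford multiplication by the standard basis of \<open>\<real>\<^sup>9\<close> on \<open>\<Delta>\<^sub>9\<close>.
  The matrices \<open>\<sigma>\<^sub>1\<close>, \<open>\<sigma>\<^sub>3\<close> are Pauli matrices and \<open>\<epsilon>\<close> is the rotation by a right angle.\<close>

definition clifford_gen :: "nat \<Rightarrow> End16" where
  "clifford_gen i =
    (let \<sigma>\<^sub>1 = mat2 0 1 1 0; \<sigma>\<^sub>3 = mat2 1 0 0 (-1); \<epsilon> = mat2 0 (-1) 1 0; e = mat 1 in
      [\<sigma>\<^sub>1 \<otimes>\<^sub>K e \<otimes>\<^sub>K e \<otimes>\<^sub>K e,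
       \<epsilon> \<otimes>\<^sub>K \<epsilon> \<otimes>\<^sub>K \<sigma>\<^sub>1 \<otimes>\<^sub>K e,
       \<epsilon> \<otimes>\<^sub>K \<epsilon> \<otimes>\<^sub>K \<sigma>\<^sub>3 \<otimes>\<^sub>K e,
       \<epsilon> \<otimes>\<^sub>K e \<otimes>\<^sub>K \<epsilon> \<otimes>\<^sub>K \<sigma>\<^sub>1,
       \<epsilon> \<otimes>\<^sub>K e \<otimes>\<^sub>K \<epsilon> \<otimes>\<^sub>K \<sigma>\<^sub>3,
       \<epsilon> \<otimes>\<^sub>K \<sigma>\<^sub>1 \<otimes>\<^sub>K e \<otimes>\<^sub>K \<epsilon>,
       \<epsilon> \<otimes>\<^sub>K \<sigma>\<^sub>3 \<otimes>\<^sub>K e \<otimes>\<^sub>K \<epsilon>,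
       \<epsilon> \<otimes>\<^sub>K \<epsilon> \<otimes>\<^sub>K \<epsilon> \<otimes>\<^sub>K \<epsilon>,
       \<sigma>\<^sub>3 \<otimes>\<^sub>K e \<otimes>\<^sub>K e \<otimes>\<^sub>K e] ! i)"

lemma kron_mult: "(A \<otimes>\<^sub>K B) ** (C \<otimes>\<^sub>K D) = (A ** C) \<otimes>\<^sub>K (B ** D)"
  by (simp add: kron_def matrix_matrix_mult_def vec_eq_iff sum_product sum.cartesian_product
      UNIV_Times_UNIV[symmetric] case_prod_unfold mult_ac del: UNIV_Times_UNIV)

lemma kron_transpose: "transpose (A \<otimes>\<^sub>K B) = transpose A \<otimes>\<^sub>K transpose B"
  by (simp add: kron_def transpose_def)

lemma kron_trace: "trace (A \<otimes>\<^sub>K B) = trace A * trace B"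
  by (simp add: kron_def trace_def sum_product sum.cartesian_product
      UNIV_Times_UNIV[symmetric] case_prod_unfold del: UNIV_Times_UNIV)

lemma kron_mat_1: "mat 1 \<otimes>\<^sub>K mat 1 = mat 1"
  by (auto simp: kron_def mat_def vec_eq_iff prod_eq_iff)

lemma mat2_mult:
  "mat2 a b c d ** mat2 a' b' c' d' =
   mat2 (a * a' + b * c') (a * b' + b * d') (c * a' + d * c') (c * b' + d * d')"
  by (simp add: mat2_def matrix_matrix_mult_def vec_eq_iff UNIV_bool)

lemma mat2_transpose: "transpose (mat2 a b c d) = mat2 a c b d"
  by (simp add: mat2_def transpose_def vec_eq_iff)

lemma mat2_trace: "trace (mat2 a b c d) = a + d"
  by (simp add: mat2_def trace_def UNIV_bool)

lemma mat_1_mat2: "mat 1 = mat2 1 0 0 1"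
  by (simp add: mat2_def mat_def vec_eq_iff)

lemma clifford_system_gen: "clifford_system (\<bullet>) clifford_gen"
proof -
  have le8: "i \<le> 8 \<longleftrightarrow> i \<in> {0, 1, 2, 3, 4, 5, 6, 7, 8}" for i :: nat
    by auto
  have 1: "clifford_gen i ** clifford_gen i = mat 1 \<and>
      transpose (clifford_gen i) = clifford_gen i \<and> trace (clifford_gen i) = 0" if "i \<le> 8" for i
    using that unfolding le8
    apply (elim insertE emptyE)
    apply (simp_all add: clifford_gen_def Let_def kron_mult kron_transpose kron_trace mat2_mult
        mat2_transpose mat2_trace mat_1_mat2 kron_mat_1[symmetric])
    apply (simp_all add: kron_def mat2_def vec_eq_iff)
    done
  have 2: "clifford_gen i ** clifford_gen j = - (clifford_gen j ** clifford_gen i)"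
    if "i \<le> 8" "j \<le> 8" "i \<noteq> j" for i j
    using that unfolding le8
    apply (elim insertE emptyE)
    apply (simp_all add: clifford_gen_def Let_def kron_mult mat2_mult mat_1_mat2)
    apply (simp_all add: kron_def mat2_def vec_eq_iff)
    done
  have 3: "clifford_gen i ** clifford_gen j + clifford_gen j ** clifford_gen i = 0"
    if "i \<le> 8" "j \<le> 8" "i \<noteq> j" for i j
    by (subst 2[OF that]) simp
  have 4: "(clifford_gen i *v v) \<bullet> w = v \<bullet> (clifford_gen i *v w)" if "i \<le> 8" for i v w
    using 1[OF that] by (metis dot_lmul_matrix vector_transpose_matrix)
  show ?thesis
    unfolding clifford_system_def using 1 3 4 by blast
qed

definition clifford_mult :: "(nat \<Rightarrow> real) \<Rightarrow> End16" where
  "clifford_mult x = (\<Sum>i\<le>8. x i *\<^sub>R clifford_gen i)"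

text \<open>\<open>Spin(9)\<close> consists of the products \<open>x\<^sub>1 \<cdots> x\<^sub>2\<^sub>k\<close> in the Clifford algebra of an even number of
  unit vectors of \<open>\<real>\<^sup>9\<close>, and \<open>\<rho>\<close> maps such a product to the product of the corresponding Clifford
  multiplications. The following set is the image \<open>\<rho>(Spin(9)) \<subseteq> SO(16)\<close>.\<close>

inductive_set spin9 :: "End16 set" where
  one: "mat 1 \<in> spin9"
| mult: "h \<in> spin9 \<Longrightarrow> (\<Sum>i\<le>8. (x i)\<^sup>2) = 1 \<Longrightarrow> (\<Sum>i\<le>8. (y i)\<^sup>2) = 1 \<Longrightarrow>
    clifford_mult x ** clifford_mult y ** h \<in> spin9"

definition spin9_invariant :: "R16 form \<Rightarrow> bool" where
  "spin9_invariant \<alpha> \<longleftrightarrow> (\<forall>h\<in>spin9. \<forall>v. \<alpha> (\<lambda>i. h *v v i) = \<alpha> v)"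


section \<open>Spin(9)-manifolds\<close>

text \<open>A \<open>Spin(9)\<close>-structure: \<open>P p\<close> is the set of frames at \<open>p\<close> belonging to the reduction of the
  bundle of oriented orthonormal frames.\<close>

definition spin9_structure ::
  "('m::topological_space, idx16) chart set \<Rightarrow> ('m \<Rightarrow> R16 \<Rightarrow> R16 \<Rightarrow> real) \<Rightarrow> ('m \<Rightarrow> End16 set) \<Rightarrow> bool"
  where
  "spin9_structure A g P \<longleftrightarrow>
     (\<forall>p. \<forall>u \<in> P p. oriented_orthonormal_frame g p u \<and> P p = {u ** h |h. h \<in> spin9}) \<and>
     (\<forall>p. \<exists>U s. open U \<and> p \<in> U \<and> (\<forall>q\<in>U. s q \<in> P q) \<and> smooth_frame_field A U s)"

text \<open>The associated bundle \<open>\<nu>\<^sup>9 \<subseteq> End(TM)\<close>: the fibre over \<open>p\<close> is the image of the standard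
  nine-dimensional space of Clifford multiplications under any of the frames in \<open>P p\<close>.\<close>

definition spin9_bundle :: "('m \<Rightarrow> End16 set) \<Rightarrow> 'm \<Rightarrow> End16 set" where
  "spin9_bundle P p = {u ** clifford_mult x ** matrix_inv u |u x. u \<in> P p}"

definition local_basis ::
  "('m::topological_space, idx16) chart set \<Rightarrow> ('m \<Rightarrow> R16 \<Rightarrow> R16 \<Rightarrow> real) \<Rightarrow> ('m \<Rightarrow> End16 set) \<Rightarrow>
   'm set \<Rightarrow> (nat \<Rightarrow> 'm \<Rightarrow> End16) \<Rightarrow> bool" where
  "local_basis A g \<nu> U I \<longleftrightarrow>
     open U \<and>
     (\<forall>i\<le>8. smooth_endomorphism_field A U (I i)) \<and>
     (\<forall>p\<in>U. span ((\<lambda>i. I i p) ` {..8}) = \<nu> p \<and> clifford_system (g p) (\<lambda>i. I i p))"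

definition canonical_8form ::
  "('m, idx16) chart set \<Rightarrow> ('m \<Rightarrow> End16 set) \<Rightarrow> ('m \<Rightarrow> R16 form) \<Rightarrow> bool" where
  "canonical_8form A P \<Omega> \<longleftrightarrow>
     differential_form A 8 \<Omega> \<and>
     (\<exists>\<Omega>\<^sub>0. alternating_form 8 \<Omega>\<^sub>0 \<and> spin9_invariant \<Omega>\<^sub>0 \<and> \<Omega>\<^sub>0 \<noteq> (\<lambda>_. 0) \<and>
        (\<forall>p. \<forall>u \<in> P p. \<forall>v. \<Omega> p (\<lambda>i. u *v v i) = \<Omega>\<^sub>0 v))"

definition omega ::
  "('m \<Rightarrow> R16 \<Rightarrow> R16 \<Rightarrow> real) \<Rightarrow> (nat \<Rightarrow> 'm \<Rightarrow> End16) \<Rightarrow> 'm \<Rightarrow> nat \<Rightarrow> nat \<Rightarrow> R16 form" where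
  "omega g I p i j = (\<lambda>v.
     if i < j then g p (v 0) (I i p *v (I j p *v v 1))
     else if j < i then - g p (v 0) (I j p *v (I i p *v v 1))
     else 0)"

definition omega_sum ::
  "('m \<Rightarrow> R16 \<Rightarrow> R16 \<Rightarrow> real) \<Rightarrow> (nat \<Rightarrow> 'm \<Rightarrow> End16) \<Rightarrow> 'm \<Rightarrow> R16 form" where
  "omega_sum g I p = (\<lambda>v. \<Sum>i\<le>8. \<Sum>j\<le>8. \<Sum>i'\<le>8. \<Sum>j'\<le>8.
     wedge 6 2 (wedge 4 2 (wedge 2 2 (omega g I p i j) (omega g I p i j'))
       (omega g I p i' j)) (omega g I p i' j') v)"

end

theory Submission
  imports Defs
begin

text \<open>
  Write \<open>Q(v) = \<Sum> \<omega>\<^sub>i\<^sub>j(v\<^sub>0, v\<^sub>1) \<omega>\<^sub>i\<^sub>j\<^sub>'(v\<^sub>2, v\<^sub>3) \<omega>\<^sub>i\<^sub>'\<^sub>j(v\<^sub>4, v\<^sub>5) \<omega>\<^sub>i\<^sub>'\<^sub>j\<^sub>'(v\<^sub>6, v\<^sub>7)\<close>, so that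
  the \<open>8\<close>-form of the theorem is the alternation of \<open>Q\<close> up to a factor. Two orthonormal bases of the
  same nine-dimensional space of Clifford multiplications differ by an orthogonal matrix, and \<open>Q\<close> is
  a full contraction, hence independent of the basis; as conjugation by \<open>Spin(9)\<close> permutes these bases,
  \<open>Q\<close> is also invariant.

  The form does not vanish on the half-spin space \<open>\<Delta>\<^sup>+ \<subseteq> \<Delta>\<^sub>9\<close> of \<open>Spin(8)\<close>: for orthonormal
  \<open>v\<^sub>0, \<dots>, v\<^sub>7 \<in> \<Delta>\<^sup>+\<close> and \<open>R\<^sub>v : \<real>\<^sup>8 \<rightarrow> \<Delta>\<^sup>-\<close>, \<open>R\<^sub>v(i) = I\<^sub>i v\<close>, the value \<open>Q(v)\<close> is the trace of an alternating
  product of the \<open>R\<^sub>v\<close> and \<open>R\<^sub>v\<^sup>T\<close>, and these satisfy Clifford relations, so that \<open>Q\<close> is already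
  alternating in \<open>v\<close>.

  For the uniqueness it suffices that an invariant \<open>8\<close>-form \<open>\<alpha>\<close> with \<open>\<alpha>|\<Delta>\<^sup>+ = 0\<close> is zero. The indices of
  the standard bases of \<open>\<Delta>\<^sup>+\<close> and of \<open>\<Delta>\<^sup>-\<close> are identified with the affine space \<open>F\<^sub>2\<^sup>3\<close>. The diagonal
  matrices in \<open>Spin(9)\<close> kill the coefficient of \<open>X \<squnion> Y\<close> (\<open>X, Y \<subseteq> F\<^sub>2\<^sup>3\<close>, \<open>|X| + |Y| = 8\<close>) unless \<open>|X|\<close> is
  even and \<open>\<Sum>X = \<Sum>Y\<close>. Under the monomial matrices in \<open>Spin(9)\<close> the remaining coefficients fall, up to
  sign, into the orbits \<open>|X| \<in> {8, 0}\<close>, \<open>|X| \<in> {6, 2}\<close>, and, for \<open>|X| = 4\<close>, parallel planes,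
  non-parallel planes and pairs of tetrahedra. The derivation given by \<open>I\<^sub>0 I\<^sub>8\<close> yields linear relations
  which show successively that all of them vanish if the first one does.
\<close>

section \<open>Alternating forms and wedge products\<close>

lemma linear_cmult: "linear f \<Longrightarrow> linear (\<lambda>x. c * f x)" for c :: real
  using linear_compose_scale_right[of f c] by simp

lemma alternating_form_swap:
  assumes "alternating_form k \<alpha>" "a < k" "b < k" "a \<noteq> b"
  shows "\<alpha> (v \<circ> Transposition.transpose a b) = - \<alpha> v"
proof -
  let ?F = "\<lambda>x y. \<alpha> (v(a := x, b := y))"
  have lin: "linear (\<lambda>y. ?F x y)" for x
    using assms by (simp add: alternating_form_def)
  have lin': "linear (\<lambda>x. ?F x y)" for y
    using assms by (subst fun_upd_twist) (simp_all add: alternating_form_def)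
  have zero: "?F x x = 0" for x
    using assms unfolding alternating_form_def by (metis fun_upd_other fun_upd_same)
  \<comment> \<open>Polarisation: the repeated argument \<open>v a + v b\<close> is expanded in both
    slots.\<close>
  have "0 = ?F (v a + v b) (v a + v b)"
    using zero by simp
  also have "\<dots> = (?F (v a) (v a) + ?F (v b) (v a)) + (?F (v a) (v b) + ?F (v b) (v b))"
    by (simp only: linear_add[OF lin] linear_add[OF lin'])
  also have "\<dots> = ?F (v a) (v b) + ?F (v b) (v a)"
    by (simp only: zero add_0_left add_0_right add.commute)
  finally have "?F (v b) (v a) = - ?F (v a) (v b)"
    by simp
  moreover have "v \<circ> Transposition.transpose a b = v(a := v b, b := v a)"
    by (auto simp: Transposition.transpose_def)
  ultimately show ?thesis
    by simp
qed

section \<open>Antisymmetrisation and iterated wedge products\<close>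

definition alternation :: "nat \<Rightarrow> 'v form \<Rightarrow> 'v form" where
  "alternation n f v = (\<Sum>\<sigma> | \<sigma> permutes {..<n}. of_int (sign \<sigma>) * f (v \<circ> \<sigma>))"

lemma alternation_cmult: "alternation n (\<lambda>v. c * f v) v = c * alternation n f v"
  by (simp add: alternation_def sum_distrib_left mult_ac)

lemma alternation_sum: "alternation n (\<lambda>v. \<Sum>i\<in>I. f i v) v = (\<Sum>i\<in>I. alternation n (f i) v)"
proof -
  have "alternation n (\<lambda>v. \<Sum>i\<in>I. f i v) v =
      (\<Sum>\<sigma> | \<sigma> permutes {..<n}. \<Sum>i\<in>I. of_int (sign \<sigma>) * f i (v \<circ> \<sigma>))"
    by (simp add: alternation_def sum_distrib_left)
  then show ?thesis
    unfolding alternation_def by (subst sum.swap) simp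
qed

text \<open>A permutation of the first \<open>k\<close> slots is absorbed into the outer sum by
  right translation, and its sign then occurs twice. Hence all inner terms contribute equally, and
  an inner antisymmetrisation only costs the factor \<open>fact k\<close>.\<close>

lemma alternation_alternation_times:
  "alternation (k + l) (\<lambda>v. alternation k f v * g (\<lambda>i. v (k + i))) v =
   fact k * alternation (k + l) (\<lambda>v. f v * g (\<lambda>i. v (k + i))) v"
proof -
  let ?S = "{\<sigma>. \<sigma> permutes {..<k + l}}" and ?h = "\<lambda>v. f v * g (\<lambda>i. v (k + i))"
  have "alternation (k + l) (\<lambda>v. alternation k f v * g (\<lambda>i. v (k + i))) v =
      (\<Sum>\<sigma>\<in>?S. \<Sum>\<tau> | \<tau> permutes {..<k}. of_int (sign \<sigma> * sign \<tau>) *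
         (f (v \<circ> \<sigma> \<circ> \<tau>) * g (\<lambda>i. (v \<circ> \<sigma>) (k + i))))"
    by (simp add: alternation_def sum_distrib_left sum_distrib_right mult_ac comp_def)
  also have "\<dots> = (\<Sum>\<tau> | \<tau> permutes {..<k}. \<Sum>\<sigma>\<in>?S. of_int (sign \<sigma> * sign \<tau>) *
         (f (v \<circ> \<sigma> \<circ> \<tau>) * g (\<lambda>i. (v \<circ> \<sigma>) (k + i))))"
    by (rule sum.swap)
  also have "\<dots> = (\<Sum>\<tau> | \<tau> permutes {..<k}. alternation (k + l) ?h v)"
  proof (rule sum.cong)
    fix \<tau> assume "\<tau> \<in> {\<tau>. \<tau> permutes {..<k}}"
    then have \<tau>: "\<tau> permutes {..<k}" by simp
    then have \<tau>': "\<tau> permutes {..<k + l}"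
      by (rule permutes_subset) auto
    have fix_k: "\<tau> (k + i) = k + i" for i
      using \<tau> by (simp add: permutes_not_in)
    have "alternation (k + l) ?h v =
        (\<Sum>\<sigma>\<in>?S. of_int (sign (\<sigma> \<circ> \<tau>)) * ?h (v \<circ> (\<sigma> \<circ> \<tau>)))"
      unfolding alternation_def
      by (rule sum_permutations_compose_right[OF \<tau>'])
    also have "\<dots> = (\<Sum>\<sigma>\<in>?S. of_int (sign \<sigma> * sign \<tau>) *
         (f (v \<circ> \<sigma> \<circ> \<tau>) * g (\<lambda>i. (v \<circ> \<sigma>) (k + i))))"
    proof (rule sum.cong)
      fix \<sigma> assume "\<sigma> \<in> ?S"
      then have "permutation \<sigma>" "permutation \<tau>"
        using \<tau> by (auto simp: permutation_permutes)
      then show "of_int (sign (\<sigma> \<circ> \<tau>)) * ?h (v \<circ> (\<sigma> \<circ> \<tau>)) = of_int (sign \<sigma> * sign \<tau>) *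
         (f (v \<circ> \<sigma> \<circ> \<tau>) * g (\<lambda>i. (v \<circ> \<sigma>) (k + i)))"
        by (simp add: sign_compose comp_assoc fix_k)
    qed simp
    finally show "(\<Sum>\<sigma>\<in>?S. of_int (sign \<sigma> * sign \<tau>) *
         (f (v \<circ> \<sigma> \<circ> \<tau>) * g (\<lambda>i. (v \<circ> \<sigma>) (k + i)))) = alternation (k + l) ?h v" ..
  qed simp
  also have "\<dots> = fact k * alternation (k + l) ?h v"
    by (simp add: card_permutations)
  finally show ?thesis .
qed

lemma wedge_eq_alternation:
  "wedge k l \<alpha> \<beta> v = alternation (k + l) (\<lambda>v. \<alpha> v * \<beta> (\<lambda>i. v (k + i))) v / (fact k * fact l)"
  by (simp add: wedge_def alternation_def comp_def mult_ac)

text \<open>An alternation divided by a constant keeps this shape under wedging from the right, so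
  iterated wedge products collapse to a single alternation by rewriting.\<close>

lemma wedge_alternation:
  "wedge k l (\<lambda>v. alternation k f v / c) \<beta> =
   (\<lambda>v. alternation (k + l) (\<lambda>v. f v * \<beta> (\<lambda>i. v (k + i))) v / (c * fact l))"
proof
  fix v :: "nat \<Rightarrow> 'a"
  have "wedge k l (\<lambda>v. alternation k f v / c) \<beta> v = 
    alternation (k + l) (\<lambda>v. (1 / c) * (alternation k f v * \<beta> (\<lambda>i. v (k + i)))) v / (fact k * fact l)"
    by (simp add: wedge_eq_alternation mult_ac)
  then show "wedge k l (\<lambda>v. alternation k f v / c) \<beta> v = 
      alternation (k + l) (\<lambda>v. f v * \<beta> (\<lambda>i. v (k + i))) v / (c * fact l)"
    by (simp only: alternation_cmult alternation_alternation_times) simp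
qed

lemma wedge_2_2_2_2:
  "wedge 6 2 (wedge 4 2 (wedge 2 2 a b) c) d v =
   alternation 8 (\<lambda>v. a v * b (\<lambda>i. v (2 + i)) * c (\<lambda>i. v (4 + i)) * d (\<lambda>i. v (6 + i))) v / 16"
proof -
  have 1: "wedge 2 2 a b = (\<lambda>v. alternation 4 (\<lambda>v. a v * b (\<lambda>i. v (2 + i))) v / 4)"
    by (rule ext) (simp add: wedge_eq_alternation)
  have 2: "wedge 4 2 (wedge 2 2 a b) c =
      (\<lambda>v. alternation 6 (\<lambda>v. a v * b (\<lambda>i. v (2 + i)) * c (\<lambda>i. v (4 + i))) v / 8)"
    unfolding 1 wedge_alternation by simp
  show ?thesis
    unfolding 2 wedge_alternation by simp
qed

text \<open>For a repeated argument, left translation by the transposition of the two slots leaves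
  the arguments alone but flips every sign, so the alternation equals its own negative.\<close>

lemma alternating_form_alternation:
  assumes local: "\<And>v w. (\<And>i. i < n \<Longrightarrow> v i = w i) \<Longrightarrow> f v = f w"
    and linear: "\<And>v i. i < n \<Longrightarrow> linear (\<lambda>x. f (v(i := x)))"
  shows "alternating_form n (alternation n f)"
  unfolding alternating_form_def
proof (intro conjI allI impI)
  fix v w :: "nat \<Rightarrow> 'a" assume "\<forall>i<n. v i = w i"
  then have "f (v \<circ> \<sigma>) = f (w \<circ> \<sigma>)" if "\<sigma> permutes {..<n}" for \<sigma>
    using permutes_in_image[OF that] by (intro local) auto
  then show "alternation n f v = alternation n f w"
    by (simp add: alternation_def)
next
  fix v :: "nat \<Rightarrow> 'a" and i assume i: "i < n"
  have "linear (\<lambda>x. f (v(i := x) \<circ> \<sigma>))" if "\<sigma> permutes {..<n}" for \<sigma>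
  proof -
    have "v(i := x) \<circ> \<sigma> = (v \<circ> \<sigma>)(inv \<sigma> i := x)" for x
      using permutes_inverses[OF that] by (auto simp: fun_eq_iff)
    moreover have "inv \<sigma> i < n"
      using permutes_in_image[OF permutes_inv[OF that]] i by auto
    ultimately show ?thesis
      using linear by simp
  qed
  then show "linear (\<lambda>x. alternation n f (v(i := x)))"
    unfolding alternation_def
    by (intro linear_compose_sum ballI linear_cmult) simp
next
  fix v :: "nat \<Rightarrow> 'a" and i j
  assume i: "i < n" and j: "j < n" and ij: "i \<noteq> j \<and> v i = v j"
  let ?t = "Transposition.transpose i j"
  have t: "?t permutes {..<n}"
    using i j by (simp add: permutes_swap_id)
  have v: "v \<circ> ?t = v"
    using ij by (auto simp: Transposition.transpose_def fun_eq_iff)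
  have "alternation n f v =
      (\<Sum>\<sigma> | \<sigma> permutes {..<n}. of_int (sign (?t \<circ> \<sigma>)) * f (v \<circ> (?t \<circ> \<sigma>)))"
    unfolding alternation_def by (rule setum_permutations_compose_left[OF t])
  also have "\<dots> = (\<Sum>\<sigma> | \<sigma> permutes {..<n}. - (of_int (sign \<sigma>) * f (v \<circ> \<sigma>)))"
  proof (rule sum.cong)
    fix \<sigma> assume "\<sigma> \<in> {\<sigma>. \<sigma> permutes {..<n}}"
    then have "permutation \<sigma>" "permutation ?t"
      using t by (auto simp: permutation_permutes)
    then show "of_int (sign (?t \<circ> \<sigma>)) * f (v \<circ> (?t \<circ> \<sigma>)) = - (of_int (sign \<sigma>) * f (v \<circ> \<sigma>))"
      using ij v by (simp add: sign_compose sign_swap_id flip: comp_assoc)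
  qed simp
  also have "\<dots> = - alternation n f v"
    by (simp add: alternation_def sum_negf)
  finally show "alternation n f v = 0" by simp
qed

section \<open>Invariant forms under the Lie algebra\<close>

lemma alternating_form_cong:
  assumes "alternating_form k \<alpha>" "\<And>i. i < k \<Longrightarrow> v i = w i"
  shows "\<alpha> v = \<alpha> w"
  using assms by (auto simp: alternating_form_def)

lemma alternating_form_linear:
  assumes "alternating_form k \<alpha>" "i < k"
  shows "linear (\<lambda>x. \<alpha> (v(i := x)))"
  using assms by (auto simp: alternating_form_def)

lemma alternating_form_scaleR:
  assumes \<alpha>: "alternating_form k \<alpha>"
  shows "\<alpha> (\<lambda>i. c i *\<^sub>R v i) = (\<Prod>i<k. c i) * \<alpha> v"
proof -
  have "\<alpha> (\<lambda>i. if i < m then c i *\<^sub>R v i else v i) = (\<Prod>i<m. c i) * \<alpha> v" if "m \<le> k" for m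
    using that
  proof (induction m)
    case (Suc m)
    let ?u = "\<lambda>i. if i < m then c i *\<^sub>R v i else v i"
    have "\<alpha> (\<lambda>i. if i < Suc m then c i *\<^sub>R v i else v i) = \<alpha> (?u(m := c m *\<^sub>R v m))"
      by (rule arg_cong[of _ _ \<alpha>]) auto
    also have "\<dots> = c m * \<alpha> (?u(m := v m))"
      using Suc.prems linear_scale[OF alternating_form_linear[OF \<alpha>, of m ?u]] by simp
    also have "?u(m := v m) = ?u"
      by auto
    finally show ?case
      using Suc by simp
  qed simp
  from this[of k] show ?thesis
    using alternating_form_cong[OF \<alpha>, of "\<lambda>i. c i *\<^sub>R v i" "\<lambda>i. if i < k then c i *\<^sub>R v i else v i"]
    by simp
qed

text \<open>The Leibniz rule for a multilinear map. The slots are made to depend on \<open>t\<close>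
  one after the other, each step adding one summand of the product rule.\<close>

lemma alternating_form_deriv:
  assumes \<alpha>: "alternating_form k \<alpha>"
  shows "((\<lambda>t. \<alpha> (\<lambda>i. v i + t *\<^sub>R w i)) has_real_derivative (\<Sum>i<k. \<alpha> (v(i := w i)))) (at 0)"
proof -
  have "((\<lambda>t. \<alpha> (\<lambda>i. if i < m then v i + t *\<^sub>R w i else v i)) has_real_derivative
      (\<Sum>i<m. \<alpha> (v(i := w i)))) (at 0)" if "m \<le> k" for m
    using that
  proof (induction m arbitrary: v)
    case (Suc m)
    let ?u = "\<lambda>v t i. if i < m then v i + t *\<^sub>R w i else v i"
    have eq: "\<alpha> (\<lambda>i. if i < Suc m then v i + t *\<^sub>R w i else v i) =
        \<alpha> (?u v t) + t * \<alpha> (?u (v(m := w m)) t)" for t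
    proof -
      have "(\<lambda>i. if i < Suc m then v i + t *\<^sub>R w i else v i) = (?u v t)(m := v m + t *\<^sub>R w m)"
        by auto
      moreover have "(?u v t)(m := v m) = ?u v t" "(?u v t)(m := w m) = ?u (v(m := w m)) t"
        by auto
      ultimately show ?thesis
        using linear_add[OF alternating_form_linear[OF \<alpha>, of m "?u v t"], of "v m" "t *\<^sub>R w m"]
          linear_scale[OF alternating_form_linear[OF \<alpha>, of m "?u v t"], of t "w m"] Suc.prems
        by simp
    qed
    have "((\<lambda>t. \<alpha> (?u v t) + t * \<alpha> (?u (v(m := w m)) t)) has_real_derivative
        (\<Sum>i<m. \<alpha> (v(i := w i))) + (1 * \<alpha> (?u (v(m := w m)) 0)
          + (\<Sum>i<m. \<alpha> ((v(m := w m))(i := w i))) * 0)) (at 0)"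
      using Suc.prems by (intro DERIV_add DERIV_mult DERIV_ident Suc.IH) auto
    moreover have "?u (v(m := w m)) 0 = v(m := w m)"
      by auto
    ultimately show ?case
      unfolding eq by (simp add: add.commute fun_upd_def)
  qed simp
  from this[of k] show ?thesis
    using alternating_form_cong[OF \<alpha>, of "\<lambda>i. v i + t *\<^sub>R w i" "\<lambda>i. if i < k then v i + t *\<^sub>R w i else v i" for t]
    by simp
qed

lemma alternating_form_eq_0_on_basis:
  assumes \<alpha>: "alternating_form k \<alpha>"
    and basis: "\<And>v. (\<And>i. i < k \<Longrightarrow> v i \<in> B) \<Longrightarrow> \<alpha> v = 0" and B: "span B = UNIV"
  shows "\<alpha> v = 0"
proof -
  \<comment> \<open>The slots below \<open>m\<close> are already arbitrary, the others still run
    through \<open>B\<close>.\<close>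
  have "\<forall>v. (\<forall>i<k. m \<le> i \<longrightarrow> v i \<in> B) \<longrightarrow> \<alpha> v = 0" if "m \<le> k" for m
    using that
  proof (induction m)
    case (Suc m)
    show ?case
    proof (intro allI impI)
      fix v assume v: "\<forall>i<k. Suc m \<le> i \<longrightarrow> v i \<in> B"
      have "linear (\<lambda>x. \<alpha> (v(m := x)))"
        using alternating_form_linear[OF \<alpha>] Suc.prems by simp
      moreover have "\<alpha> (v(m := x)) = 0" if "x \<in> B" for x
        using Suc v that by auto
      ultimately have "\<alpha> (v(m := v m)) = 0"
        using linear_eq_0_on_span[of "\<lambda>x. \<alpha> (v(m := x))" B] B by blast
      then show "\<alpha> v = 0" by simp
    qed
  qed (use basis in auto)
  from this[of k] show ?thesis by simp
qed

section \<open>The infinitesimal action of Spin(9)\<close>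

lemma spin9_mult: "h \<in> spin9 \<Longrightarrow> h' \<in> spin9 \<Longrightarrow> h ** h' \<in> spin9"
proof (induction rule: spin9.induct)
  case (mult h x y)
  then show ?case
    using spin9.mult[of "h ** h'" x y] by (simp add: matrix_mul_assoc)
qed simp

lemma spin9_mult2:
  assumes "(\<Sum>i\<le>8. (x i)\<^sup>2) = 1" "(\<Sum>i\<le>8. (y i)\<^sup>2) = 1"
  shows "clifford_mult x ** clifford_mult y \<in> spin9"
  using spin9.mult[OF spin9.one assms] by simp

lemma clifford_mult_vec: "clifford_mult x *v v = (\<Sum>i\<le>8. x i *\<^sub>R (clifford_gen i *v v))"
proof -
  have lin: "linear (\<lambda>A :: End16. A *v v)"
    by (intro linearI) (simp_all add: matrix_vector_mult_add_rdistrib scaleR_matrix_vector_assoc)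
  then show ?thesis
    by (simp add: clifford_mult_def linear_sum[OF lin] scaleR_matrix_vector_assoc)
qed

lemma clifford_gen_square: "i \<le> 8 \<Longrightarrow> clifford_gen i ** clifford_gen i = mat 1"
  using clifford_system_gen by (auto simp: clifford_system_def)

lemma clifford_gen_square': "i \<le> 8 \<Longrightarrow> clifford_gen i *v (clifford_gen i *v v) = v"
  by (simp add: matrix_vector_mul_assoc clifford_gen_square)

text \<open>Invariance is differentiated along the products of the unit vectors e_i and (e_i + t
  e_j) / \<open>r t\<close>, where \<open>r t\<close> is the norm of e_i + t e_j. This curve passes
  through the identity at \<open>t = 0\<close> and acts as (1 + t I_i I_j) /
  \<open>r t\<close>.\<close>

lemma spin9_derivation:
  assumes \<alpha>: "alternating_form k \<alpha>" "spin9_invariant \<alpha>" and ij: "i \<le> 8" "j \<le> 8" "i \<noteq> j"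
  shows "(\<Sum>n<k. \<alpha> (v(n := clifford_gen i *v (clifford_gen j *v v n)))) = 0"
proof -
  define J where "J = (\<lambda>x. clifford_gen i *v (clifford_gen j *v x))"
  define r where "r t = sqrt (1 + t\<^sup>2)" for t :: real
  have r: "r t > 0" "(r t)\<^sup>2 = 1 + t\<^sup>2" for t
    by (simp_all add: r_def add_pos_nonneg)
  define x :: "nat \<Rightarrow> real" where "x n = (if n = i then 1 else 0)" for n
  define y where "y t n = ((if n = i then 1 else 0) + (if n = j then t else 0)) / r t" for t n
  have "(\<Sum>n\<le>8. (x n)\<^sup>2) = (\<Sum>n\<le>8. if n = i then 1 else 0)"
    by (rule sum.cong) (auto simp: x_def)
  then have x1: "(\<Sum>n\<le>8. (x n)\<^sup>2) = 1"
    using ij by simp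
  have y1: "(\<Sum>n\<le>8. (y t n)\<^sup>2) = 1" for t
  proof -
    have "(\<Sum>n\<le>8. (y t n)\<^sup>2) = (\<Sum>n\<le>8. (if n = i then 1 / (r t)\<^sup>2 else 0) + (if n = j then t\<^sup>2 / (r t)\<^sup>2 else 0))"
      using ij by (intro sum.cong) (auto simp: y_def power_divide)
    also have "\<dots> = 1 / (r t)\<^sup>2 + t\<^sup>2 / (r t)\<^sup>2"
      using ij by (simp add: sum.distrib)
    also have "\<dots> = (1 + t\<^sup>2) / (r t)\<^sup>2"
      by (simp add: add_divide_distrib)
    finally show ?thesis
      using r[of t] by (metis divide_self_if power_not_zero less_irrefl)
  qed
  have act: "clifford_mult x *v (clifford_mult (y t) *v u) = (1 / r t) *\<^sub>R (u + t *\<^sub>R J u)" for t u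
  proof -
    have "clifford_mult (y t) *v u =
        (\<Sum>n\<le>8. (if n = i then (1 / r t) *\<^sub>R (clifford_gen i *v u) else 0) +
          (if n = j then (t / r t) *\<^sub>R (clifford_gen j *v u) else 0))"
      unfolding clifford_mult_vec using ij by (intro sum.cong) (auto simp: y_def)
    also have "\<dots> = (1 / r t) *\<^sub>R (clifford_gen i *v u) + (t / r t) *\<^sub>R (clifford_gen j *v u)"
      using ij by (simp add: sum.distrib)
    finally have 1: "clifford_mult (y t) *v u = \<dots>" .
    have "clifford_mult x *v w = (\<Sum>n\<le>8. if n = i then clifford_gen i *v w else 0)" for w
      unfolding clifford_mult_vec by (intro sum.cong) (auto simp: x_def)
    then have "clifford_mult x *v w = clifford_gen i *v w" for w
      using ij by simp
    then show ?thesis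
      using ij by (simp add: 1 J_def matrix_vector_right_distrib matrix_vector_mult_scaleR
          clifford_gen_square' scaleR_add_right)
  qed
  have "\<alpha> (\<lambda>n. v n + t *\<^sub>R J (v n)) = (r t) ^ k * \<alpha> v" for t
  proof -
    have "\<alpha> v = \<alpha> (\<lambda>n. (clifford_mult x ** clifford_mult (y t)) *v v n)"
      using \<alpha>(2) spin9_mult2[OF x1 y1] by (simp add: spin9_invariant_def)
    also have "\<dots> = \<alpha> (\<lambda>n. (1 / r t) *\<^sub>R (v n + t *\<^sub>R J (v n)))"
      by (simp only: matrix_vector_mul_assoc[symmetric] act)
    also have "\<dots> = (1 / r t) ^ k * \<alpha> (\<lambda>n. v n + t *\<^sub>R J (v n))"
      by (subst alternating_form_scaleR[OF \<alpha>(1)]) simp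
    finally show ?thesis
      using r(1)[of t] by (simp add: power_divide)
  qed
  \<comment> \<open>\<open>r\<close> has a critical point at 0, so the normalisation contributes
    nothing to first order.\<close>
  moreover have "((\<lambda>t. (r t) ^ k * \<alpha> v) has_real_derivative 0) (at 0)"
    unfolding r_def by (auto intro!: derivative_eq_intros)
  ultimately have "((\<lambda>t. \<alpha> (\<lambda>n. v n + t *\<^sub>R J (v n))) has_real_derivative 0) (at 0)"
    by simp
  from DERIV_unique[OF alternating_form_deriv[OF \<alpha>(1), of v "\<lambda>n. J (v n)"] this]
  show ?thesis by (simp add: J_def)
qed

section \<open>Signed permutation matrices in Spin(9)\<close>

text \<open>\<open>signed_basis m\<close> for \<open>1 \<le> m \<le> 16\<close> is the \<open>m\<close>-th vector of the standard basis, and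
  \<open>signed_basis (- m)\<close> is its negative. A list \<open>w\<close> of length \<open>16\<close> encodes the signed permutation matrix
  that maps \<open>signed_basis m\<close> to \<open>signed_basis (w ! (m - 1))\<close>; note the shift by one. The indices
  \<open>1, \<dots>, 8\<close> belong to \<open>\<Delta>\<^sup>+\<close>, the indices \<open>9, \<dots>, 16\<close> to \<open>\<Delta>\<^sup>-\<close>.\<close>

definition signed_basis :: "int \<Rightarrow> R16" where
  "signed_basis m = of_int (sgn m) *\<^sub>R
     axis (odd ((\<bar>m\<bar> - 1) div 8), odd ((\<bar>m\<bar> - 1) div 4), odd ((\<bar>m\<bar> - 1) div 2), odd (\<bar>m\<bar> - 1)) 1"

definition act :: "int list \<Rightarrow> int \<Rightarrow> int" where
  "act w m = sgn m * w ! (nat \<bar>m\<bar> - 1)"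

text \<open>The signed permutations of the nine generators, in the order of
  \<open>clifford_gen\<close>. Orbit computations can thus be evaluated on integer lists.\<close>

definition gens :: "int list list" where
  "gens =
    [[9, 10, 11, 12, 13, 14, 15, 16, 1, 2, 3, 4, 5, 6, 7, 8],
     [15, 16, 13, 14, -11, -12, -9, -10, -7, -8, -5, -6, 3, 4, 1, 2],
     [13, 14, -15, -16, -9, -10, 11, 12, -5, -6, 7, 8, 1, 2, -3, -4],
     [12, 11, -10, -9, 16, 15, -14, -13, -4, -3, 2, 1, -8, -7, 6, 5],
     [11, -12, -9, 10, 15, -16, -13, 14, -3, 4, 1, -2, -7, 8, 5, -6],
     [14, -13, 16, -15, 10, -9, 12, -11, -6, 5, -8, 7, -2, 1, -4, 3],
     [10, -9, 12, -11, -14, 13, -16, 15, -2, 1, -4, 3, 6, -5, 8, -7],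
     [16, -15, -14, 13, -12, 11, 10, -9, -8, 7, 6, -5, 4, -3, -2, 1],
     [1, 2, 3, 4, 5, 6, 7, 8, -9, -10, -11, -12, -13, -14, -15, -16]]"

lemma signed_basis_minus [simp]: "signed_basis (- m) = - signed_basis m"
  by (simp add: signed_basis_def)

lemma signed_basis_sgn: "signed_basis m = of_int (sgn m) *\<^sub>R signed_basis \<bar>m\<bar>"
  by (simp add: signed_basis_def sgn_if)

lemma atLeastAtMost_1_16: "m \<in> {1..16} \<longleftrightarrow> m \<in> {1,2,3,4,5,6,7,8,9,10,11,12,13,14,15,16}" for m :: int
  by simp presburger

lemma signed_basis_pos:
  "m > 0 \<Longrightarrow> signed_basis m =
     axis (odd ((m - 1) div 8), odd ((m - 1) div 4), odd ((m - 1) div 2), odd (m - 1)) 1"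
  by (simp add: signed_basis_def)

lemma clifford_gen_signed_basis:
  assumes "i \<le> 8" "m \<in> {1..16}"
  shows "clifford_gen i *v signed_basis m = signed_basis (act (gens ! i) m)"
proof -
  have i: "i \<in> {0,1,2,3,4,5,6,7,8}"
    using assms by auto
  have "(clifford_gen i *v signed_basis m) $ (a, b, c, d) = signed_basis (act (gens ! i) m) $ (a, b, c, d)"
    for a b c d
  proof -
    have "(clifford_gen i *v signed_basis m) $ (a, b, c, d) = clifford_gen i $ (a, b, c, d) $
        (odd ((m - 1) div 8), odd ((m - 1) div 4), odd ((m - 1) div 2), odd (m - 1))"
      using assms(2) by (simp add: signed_basis_pos matrix_vector_mult_basis column_def)
    also have "\<dots> = signed_basis (act (gens ! i) m) $ (a, b, c, d)"
      using i assms(2) unfolding atLeastAtMost_1_16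
      by (elim insertE emptyE; simp add: clifford_gen_def Let_def kron_def mat2_def mat_def act_def
          gens_def signed_basis_def axis_def)
    finally show ?thesis .
  qed
  then show ?thesis
    by (simp add: vec_eq_iff)
qed

lemma act_minus [simp]: "act w (- m) = - act w m"
  by (simp add: act_def sgn_minus)

text \<open>The bound on the entries keeps images inside the signed index range, so that encodings
  can be composed.\<close>

definition monomial :: "End16 \<Rightarrow> int list \<Rightarrow> bool" where
  "monomial h w \<longleftrightarrow> length w = 16 \<and> (\<forall>x\<in>set w. \<bar>x\<bar> \<in> {1..16}) \<and>
     (\<forall>m\<in>{1..16}. h *v signed_basis m = signed_basis (act w m))"

lemma monomial_act:
  assumes "monomial h w" "\<bar>m\<bar> \<in> {1..16}"
  shows "\<bar>act w m\<bar> \<in> {1..16}" "h *v signed_basis m = signed_basis (act w m)"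
proof -
  have "w ! (nat \<bar>m\<bar> - 1) \<in> set w"
    using assms by (intro nth_mem) (auto simp: monomial_def)
  moreover have "m \<noteq> 0"
    using assms(2) by auto
  ultimately show "\<bar>act w m\<bar> \<in> {1..16}"
    using assms(1) by (auto simp: act_def monomial_def abs_mult)
  show "h *v signed_basis m = signed_basis (act w m)"
  proof (cases "m > 0")
    case False
    then have "- m \<in> {1..16}"
      using assms(2) \<open>m \<noteq> 0\<close> by auto
    then have "h *v signed_basis (- m) = signed_basis (act w (- m))"
      using assms(1) unfolding monomial_def by blast
    moreover have "h *v (- signed_basis m) = - (h *v signed_basis m)"
      by (rule linear_neg) simp
    ultimately show ?thesis
      by simp
  qed (use assms in \<open>auto simp: monomial_def\<close>)
qed

lemma monomial_mult:
  assumes h: "monomial h w" and h': "monomial h' w'"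
  shows "monomial (h ** h') (map (act w) w')"
proof -
  have "act (map (act w) w') m = act w (act w' m)" if "m \<in> {1..16}" for m
    using that h' by (auto simp: act_def monomial_def nth_map)
  moreover have "\<forall>x\<in>set w'. \<bar>act w x\<bar> \<in> {1..16}"
    using h' monomial_act(1)[OF h] by (auto simp: monomial_def)
  ultimately show ?thesis
    using h' monomial_act[OF h] monomial_act[OF h']
    by (auto simp: monomial_def simp flip: matrix_vector_mul_assoc)
qed

lemma monomial_clifford_gen:
  assumes "i \<le> 8"
  shows "monomial (clifford_gen i) (gens ! i)"
proof -
  have "\<forall>i\<in>{0,1,2,3,4,5,6,7,8}. length (gens ! i) = 16 \<and> (\<forall>x\<in>set (gens ! i). \<bar>x\<bar> \<in> {1..16})"
    by (simp add: gens_def)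
  moreover have "i \<in> {0,1,2,3,4,5,6,7,8}"
    using assms by auto
  ultimately show ?thesis
    using clifford_gen_signed_basis[OF assms] by (auto simp: monomial_def simp del: insert_iff)
qed

definition symm :: "int list \<Rightarrow> bool" where
  "symm w \<longleftrightarrow> (\<exists>h\<in>spin9. monomial h w)"

lemma symm_comp: "symm w \<Longrightarrow> symm w' \<Longrightarrow> symm (map (act w) w')"
  unfolding symm_def using monomial_mult spin9_mult by blast

lemma clifford_mult_indicator:
  "i \<le> 8 \<Longrightarrow> clifford_mult (\<lambda>n. if n = i then 1 else 0) = clifford_gen i"
  by (simp add: clifford_mult_def if_distrib[of "\<lambda>c. c *\<^sub>R _"] cong: if_cong)

lemma symm_gens:
  assumes "i \<le> 8" "j \<le> 8"
  shows "symm (map (act (gens ! i)) (gens ! j))"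
proof -
  have 1: "(\<Sum>n\<le>8. (if n = k then 1 else 0 :: real)\<^sup>2) = 1" if "k \<le> 8" for k :: nat
    using that by (simp add: if_distrib[of "\<lambda>c. c\<^sup>2"] cong: if_cong)
  have "clifford_gen i ** clifford_gen j \<in> spin9"
    using spin9_mult2[OF 1[OF assms(1)] 1[OF assms(2)]] assms by (simp add: clifford_mult_indicator)
  then show ?thesis
    unfolding symm_def using monomial_mult[OF monomial_clifford_gen monomial_clifford_gen] assms by blast
qed

text \<open>The product of the unit vectors \<open>(e\<^sub>i - e\<^sub>j) / \<surd>2\<close> and \<open>(e\<^sub>k - e\<^sub>l) / \<surd>2\<close> acts as half a
  sum of four signed permutations; it is itself a signed permutation if these cancel or agree in
  pairs.\<close>

lemma symm_transpositions:
  assumes ijkl: "i \<le> 8" "j \<le> 8" "i \<noteq> j" "k \<le> 8" "l \<le> 8" "k \<noteq> l"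
    and w: "length w = 16" "\<forall>x\<in>set w. \<bar>x\<bar> \<in> {1..16}"
      "\<forall>m\<in>set [1..16]. let g = (\<lambda>p q. act (gens ! p) (act (gens ! q) m)) in
         g i k = g j l \<and> g i l = - g j k \<and> act w m = g i k \<or>
         g i l = g j k \<and> g i k = - g j l \<and> act w m = - g i l"
  shows "symm w"
proof -
  define x where "x a b n = ((if n = a then 1 else 0) - (if n = b then 1 else 0)) / sqrt 2"
    for a b n :: nat
  have norm: "(\<Sum>n\<le>8. (x a b n)\<^sup>2) = 1" if "a \<le> 8" "b \<le> 8" "a \<noteq> b" for a b
  proof -
    have "(\<Sum>n\<le>8. (x a b n)\<^sup>2) = (\<Sum>n\<le>8. (if n = a then 1 / 2 else 0) + (if n = b then 1 / 2 else 0))"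
      using that by (intro sum.cong) (auto simp: x_def power_divide)
    then show ?thesis
      using that by (simp add: sum.distrib)
  qed
  have act: "clifford_mult (x a b) *v v = (1 / sqrt 2) *\<^sub>R (clifford_gen a *v v - clifford_gen b *v v)"
    if "a \<le> 8" "b \<le> 8" "a \<noteq> b" for a b v
  proof -
    have "clifford_mult (x a b) *v v =
        (\<Sum>n\<le>8. (if n = a then (1 / sqrt 2) *\<^sub>R (clifford_gen a *v v) else 0) -
          (if n = b then (1 / sqrt 2) *\<^sub>R (clifford_gen b *v v) else 0))"
      unfolding clifford_mult_vec using that by (intro sum.cong) (auto simp: x_def)
    then show ?thesis
      using that by (simp add: sum_subtractf scaleR_diff_right)
  qed
  let ?h = "clifford_mult (x i j) ** clifford_mult (x k l)"
  have "?h *v signed_basis m = signed_basis (act w m)" if m: "m \<in> {1..16}" for m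
  proof -
    define g where "g p q = act (gens ! p) (act (gens ! q) m)" for p q
    have m': "\<bar>m\<bar> \<in> {1..16}"
      using m by auto
    have gen: "clifford_gen p *v (clifford_gen q *v signed_basis m) = signed_basis (g p q)"
      if "p \<le> 8" "q \<le> 8" for p q
      using monomial_act[OF monomial_clifford_gen[OF that(2)] m']
        monomial_act(2)[OF monomial_clifford_gen[OF that(1)]] by (simp add: g_def)
    have sqrt2: "(1 / sqrt 2) * (1 / sqrt 2) = (1 / 2 :: real)"
      by simp
    have "?h *v signed_basis m = (1 / 2) *\<^sub>R
        (signed_basis (g i k) - signed_basis (g i l) - (signed_basis (g j k) - signed_basis (g j l)))"
      unfolding matrix_vector_mul_assoc[symmetric] act[OF ijkl(1-3)] act[OF ijkl(4-6)]
      by (simp only: gen ijkl sqrt2 matrix_vector_mult_scaleR matrix_vector_mult_diff_distrib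
          scaleR_scaleR scaleR_diff_right[symmetric])
    also have "\<dots> = signed_basis (act w m)"
    proof -
      consider "g i k = g j l" "g i l = - g j k" "act w m = g i k"
        | "g i l = g j k" "g i k = - g j l" "act w m = - g i l"
        using w(3) m unfolding g_def Let_def set_upto by blast
      then show ?thesis
        by cases (simp_all flip: scaleR_2)
    qed
    finally show ?thesis .
  qed
  then have "monomial ?h w"
    using w by (simp add: monomial_def)
  moreover have "?h \<in> spin9"
    using norm ijkl by (intro spin9_mult2) auto
  ultimately show ?thesis
    by (auto simp: symm_def)
qed

text \<open>With \<open>I\<^sub>i\<close> the \<open>i\<close>-th generator, \<open>transl2\<close> is \<open>I\<^sub>0 I\<^sub>2\<close> (etc.) and \<open>refl0214\<close> is
  \<open>(I\<^sub>0 - I\<^sub>2)(I\<^sub>1 - I\<^sub>4)/2\<close> (etc.). Up to signs, \<open>shift1\<close>, \<open>shift2\<close>, \<open>shift4\<close> fix \<open>1, \<dots>, 8\<close> and translate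
  \<open>9, \<dots>, 16 \<in> F\<^sub>2\<^sup>3\<close>. The diagonal matrices \<open>diag1\<close>, \<open>diag2\<close>,
  \<open>diag3\<close> are products of four generators, and \<open>diag0 = \<plusminus> I\<^sub>0 \<cdots> I\<^sub>7\<close>.\<close>

definition transl2 :: "int list" where
  "transl2 = [5, 6, -7, -8, -1, -2, 3, 4, -13, -14, 15, 16, 9, 10, -11, -12]"

definition transl4 :: "int list" where
  "transl4 = [3, -4, -1, 2, 7, -8, -5, 6, -11, 12, 9, -10, -15, 16, 13, -14]"

definition transl6 :: "int list" where
  "transl6 = [2, -1, 4, -3, -6, 5, -8, 7, -10, 9, -12, 11, 14, -13, 16, -15]"

definition transl8 :: "int list" where
  "transl8 = [9, 10, 11, 12, 13, 14, 15, 16, -1, -2, -3, -4, -5, -6, -7, -8]"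

definition refl0214 :: "int list" where
  "refl0214 = [7, 4, 5, -2, -3, 8, -1, -6, 11, -16, -9, -14, 15, 12, -13, 10]"

definition refl0436 :: "int list" where
  "refl0436 = [4, 3, -2, -1, 6, -5, 8, -7, 10, -9, 12, -11, -16, -15, 14, 13]"

definition refl0625 :: "int list" where
  "refl0625 = [-6, 5, -7, -8, -2, 1, 3, 4, -13, -14, 16, -15, 9, 10, 12, -11]"

definition refl1257 :: "int list" where
  "refl1257 = [-2, 1, 4, -3, -8, 7, -6, 5, -10, 9, 12, -11, -16, 15, -14, 13]"

definition refl1734 :: "int list" where
  "refl1734 = [5, -6, 8, 7, -1, 2, -4, -3, 13, -14, 16, 15, -9, 10, -12, -11]"

definition refl3756 :: "int list" where
  "refl3756 = [3, 8, -1, -6, -7, 4, 5, -2, 11, 16, -9, -14, -15, 12, 13, -10]"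

definition shift1 :: "int list" where
  "shift1 = [1, -2, -3, 4, 5, -6, 7, -8, -10, -9, 12, 11, 14, 13, 16, 15]"

definition shift2 :: "int list" where
  "shift2 = [1, 2, -3, -4, -5, 6, 7, -8, -11, 12, -9, 10, 15, 16, 13, 14]"

definition shift4 :: "int list" where
  "shift4 = [-1, 2, -3, -4, 5, -6, 7, 8, 13, -14, -15, -16, 9, -10, -11, -12]"

definition diag0 :: "int list" where
  "diag0 = [1, 2, 3, 4, 5, 6, 7, 8, -9, -10, -11, -12, -13, -14, -15, -16]"

definition diag1 :: "int list" where
  "diag1 = [-1, -2, -3, -4, 5, 6, 7, 8, 9, 10, 11, 12, -13, -14, -15, -16]"

definition diag2 :: "int list" where
  "diag2 = [-1, -2, 3, 4, -5, -6, 7, 8, 9, 10, -11, -12, 13, 14, -15, -16]"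

definition diag3 :: "int list" where
  "diag3 = [-1, 2, -3, 4, -5, 6, -7, 8, 9, -10, 11, -12, 13, -14, 15, -16]"

lemma symm_transl2: "symm transl2"
proof -
  have "transl2 = map (act (gens ! 0)) (gens ! 2)"
    by code_simp
  then show ?thesis
    using symm_gens[of 0 2] by simp
qed

lemma symm_transl4: "symm transl4"
proof -
  have "transl4 = map (act (gens ! 0)) (gens ! 4)"
    by code_simp
  then show ?thesis
    using symm_gens[of 0 4] by simp
qed

lemma symm_transl6: "symm transl6"
proof -
  have "transl6 = map (act (gens ! 0)) (gens ! 6)"
    by code_simp
  then show ?thesis
    using symm_gens[of 0 6] by simp
qed

lemma symm_transl8: "symm transl8"
proof -
  have "transl8 = map (act (gens ! 0)) (gens ! 8)"
    by code_simp
  then show ?thesis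
    using symm_gens[of 0 8] by simp
qed

lemma symm_refl0214: "symm refl0214"
  by (rule symm_transpositions[of 0 2 1 4]; code_simp)

lemma symm_refl0436: "symm refl0436"
  by (rule symm_transpositions[of 0 4 3 6]; code_simp)

lemma symm_refl0625: "symm refl0625"
  by (rule symm_transpositions[of 0 6 2 5]; code_simp)

lemma symm_refl1257: "symm refl1257"
  by (rule symm_transpositions[of 1 2 5 7]; code_simp)

lemma symm_refl1734: "symm refl1734"
  by (rule symm_transpositions[of 1 7 3 4]; code_simp)

lemma symm_refl3756: "symm refl3756"
  by (rule symm_transpositions[of 3 7 5 6]; code_simp)

text \<open>Up to signs, the two reflections together act on the first block as the translation
  \<open>transl6\<close> and on the second block as the identity. Composing with
  \<open>transl6\<close> leaves a translation of the second block alone. The other two shifts arise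
  in the same way.\<close>

lemma symm_shift1: "symm shift1"
proof -
  have "shift1 = map (act transl6) (map (act refl0625) refl1734)"
    by code_simp
  then show ?thesis
    using symm_comp[OF symm_transl6 symm_comp[OF symm_refl0625 symm_refl1734]] by simp
qed

lemma symm_shift2: "symm shift2"
proof -
  have "shift2 = map (act transl4) (map (act refl0436) refl1257)"
    by code_simp
  then show ?thesis
    using symm_comp[OF symm_transl4 symm_comp[OF symm_refl0436 symm_refl1257]] by simp
qed

lemma symm_shift4: "symm shift4"
proof -
  have "shift4 = map (act transl2) (map (act refl0214) refl3756)"
    by code_simp
  then show ?thesis
    using symm_comp[OF symm_transl2 symm_comp[OF symm_refl0214 symm_refl3756]] by simp
qed

lemma symm_gens4:
  assumes "i \<le> 8" "j \<le> 8" "k \<le> 8" "l \<le> 8"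
  shows "symm (map (act (map (act (gens ! i)) (gens ! j))) (map (act (gens ! k)) (gens ! l)))"
  using assms by (intro symm_comp symm_gens)

lemma symm_diag1: "symm diag1"
proof -
  have "diag1 = map (act (map (act (gens ! 0)) (gens ! 3))) (map (act (gens ! 4)) (gens ! 6))"
    by code_simp
  then show ?thesis
    using symm_gens4[of 0 3 4 6] by simp
qed

lemma symm_diag2: "symm diag2"
proof -
  have "diag2 = map (act (map (act (gens ! 0)) (gens ! 2))) (map (act (gens ! 5)) (gens ! 6))"
    by code_simp
  then show ?thesis
    using symm_gens4[of 0 2 5 6] by simp
qed

lemma symm_diag3: "symm diag3"
proof -
  have "diag3 = map (act (map (act (gens ! 0)) (gens ! 1))) (map (act (gens ! 2)) (gens ! 4))"
    by code_simp
  then show ?thesis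
    using symm_gens4[of 0 1 2 4] by simp
qed

lemma symm_diag0: "symm diag0"
proof -
  have "diag0 = map (act (map (act (map (act (gens ! 0)) (gens ! 3))) (map (act (gens ! 4)) (gens ! 6))))
    (map (act (map (act (gens ! 1)) (gens ! 2))) (map (act (gens ! 5)) (gens ! 7)))"
    by code_simp
  then show ?thesis
    using symm_comp[OF symm_gens4[of 0 3 4 6] symm_gens4[of 1 2 5 7]] by simp
qed

section \<open>Coefficients of invariant forms\<close>

text \<open>Used for lists of length 8: the unspecified values \<open>l ! i\<close> beyond the end
  are invisible to a form of degree 8.\<close>

definition basis_coeff :: "R16 form \<Rightarrow> int list \<Rightarrow> real" where
  "basis_coeff \<alpha> l = \<alpha> (\<lambda>i. signed_basis (l ! i))"

fun inversion_sign :: "int list \<Rightarrow> int" where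
  "inversion_sign [] = 1"
| "inversion_sign (x # xs) =
     (if even (length (filter (\<lambda>y. y < x) xs)) then 1 else - 1) * inversion_sign xs"

text \<open>The sign between the coefficient of a signed index list and that of its sorted absolute
  values; an entry 0 makes it 0.\<close>

definition parity :: "int list \<Rightarrow> int" where
  "parity l = prod_list (map sgn l) * inversion_sign (map abs l)"

definition img :: "int list list \<Rightarrow> int list \<Rightarrow> int list" where
  "img ws l = fold (\<lambda>w. map (act w)) ws l"

definition sort_abs :: "int list \<Rightarrow> int list" where
  "sort_abs l = sort (map abs l)"

definition admissible :: "int list \<Rightarrow> bool" where
  "admissible l \<longleftrightarrow> (\<forall>m\<in>set l. \<bar>m\<bar> \<in> {1..16})"

lemma img_Nil [simp]: "img [] l = l" and img_Cons: "img (w # ws) l = img ws (map (act w) l)"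
  by (simp_all add: img_def)

lemma img_append: "img ws (l @ l') = img ws l @ img ws l'"
  by (induction ws arbitrary: l l') (simp_all add: img_Cons)

lemma length_img [simp]: "length (img ws l) = length l"
  by (induction ws arbitrary: l) (simp_all add: img_Cons)

section \<open>Coefficients under reordering and symmetries\<close>

lemma coeff_swap:
  assumes \<alpha>: "alternating_form 8 \<alpha>" and len: "length (xs @ a # b # ys) = 8"
  shows "basis_coeff \<alpha> (xs @ a # b # ys) = - basis_coeff \<alpha> (xs @ b # a # ys)"
proof -
  let ?n = "length xs"
  have "(\<lambda>i. signed_basis ((xs @ a # b # ys) ! i)) \<circ> Transposition.transpose ?n (Suc ?n) =
      (\<lambda>i. signed_basis ((xs @ b # a # ys) ! i))"
    by (auto simp: fun_eq_iff Transposition.transpose_def nth_append nth_Cons split: nat.splits)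
  then show ?thesis
    using alternating_form_swap[OF \<alpha>, of ?n "Suc ?n" "\<lambda>i. signed_basis ((xs @ a # b # ys) ! i)"] len
    by (simp add: basis_coeff_def)
qed

text \<open>Insertion moves \<open>x\<close> by adjacent swaps past exactly the smaller entries of
  the sorted tail. The prefix \<open>xs\<close> collects the entries already passed.\<close>

lemma coeff_insort:
  assumes \<alpha>: "alternating_form 8 \<alpha>" and "sorted ys" "length (xs @ x # ys) = 8"
  shows "basis_coeff \<alpha> (xs @ x # ys) =
    (if even (length (filter (\<lambda>y. y < x) ys)) then 1 else - 1) * basis_coeff \<alpha> (xs @ insort x ys)"
  using assms(2,3)
proof (induction ys arbitrary: xs)
  case (Cons y ys)
  show ?case
  proof (cases "x \<le> y")
    case True
    then have "filter (\<lambda>z. z < x) (y # ys) = []"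
      using Cons.prems by (auto simp: filter_empty_conv)
    then show ?thesis
      using True by (simp del: filter.simps)
  next
    case False
    have "basis_coeff \<alpha> (xs @ x # y # ys) = - basis_coeff \<alpha> ((xs @ [y]) @ x # ys)"
      using coeff_swap[OF \<alpha>, of xs x y ys] Cons.prems by simp
    then show ?thesis
      using False Cons.IH[of "xs @ [y]"] Cons.prems by simp
  qed
qed simp

lemma coeff_inversion_sign:
  assumes \<alpha>: "alternating_form 8 \<alpha>" and "length (xs @ l) = 8"
  shows "basis_coeff \<alpha> (xs @ l) = of_int (inversion_sign l) * basis_coeff \<alpha> (xs @ sort l)"
  using assms(2)
proof (induction l arbitrary: xs)
  case (Cons x l)
  \<comment> \<open>\<open>inversion_sign\<close> counts in the unsorted tail,
    \<open>coeff_insort\<close> in the sorted one.\<close>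
  have "length (filter (\<lambda>y. y < x) (sort l)) = length (filter (\<lambda>y. y < x) l)"
    by (metis mset_filter mset_sort size_mset)
  then show ?case
    using Cons.IH[of "xs @ [x]"] Cons.prems coeff_insort[OF \<alpha>, of "sort l" xs x] by simp
qed simp

lemma coeff_abs:
  assumes \<alpha>: "alternating_form 8 \<alpha>" and len: "length l = 8"
  shows "basis_coeff \<alpha> l = of_int (prod_list (map sgn l)) * basis_coeff \<alpha> (map abs l)"
proof -
  have "basis_coeff \<alpha> l = \<alpha> (\<lambda>i. of_int (sgn (l ! i)) *\<^sub>R signed_basis \<bar>l ! i\<bar>)"
    unfolding basis_coeff_def by (subst signed_basis_sgn) simp
  also have "\<dots> = (\<Prod>i<8. of_int (sgn (l ! i))) * \<alpha> (\<lambda>i. signed_basis \<bar>l ! i\<bar>)"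
    by (rule alternating_form_scaleR[OF \<alpha>])
  also have "(\<Prod>i<8. of_int (sgn (l ! i)) :: real) = of_int (\<Prod>i<8. sgn (l ! i))"
    by simp
  also have "(\<Prod>i<8. sgn (l ! i)) = prod_list (map sgn l)"
    using len by (simp add: prod.list_conv_set_nth atLeast0LessThan)
  also have "\<alpha> (\<lambda>i. signed_basis \<bar>l ! i\<bar>) = basis_coeff \<alpha> (map abs l)"
    unfolding basis_coeff_def by (rule alternating_form_cong[OF \<alpha>]) (simp add: len)
  finally show ?thesis .
qed

lemma coeff_parity:
  assumes "alternating_form 8 \<alpha>" "length l = 8"
  shows "basis_coeff \<alpha> l = of_int (parity l) * basis_coeff \<alpha> (sort_abs l)"
  using coeff_abs[OF assms] coeff_inversion_sign[OF assms(1), of "[]" "map abs l"] assms(2)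
  by (simp add: parity_def sort_abs_def)

lemma abs_inversion_sign: "\<bar>inversion_sign l\<bar> = 1"
  by (induction l) (auto simp: abs_mult)

lemma abs_parity: "0 \<notin> set l \<Longrightarrow> \<bar>parity l\<bar> = 1"
proof -
  assume "0 \<notin> set l"
  then have "\<bar>prod_list (map sgn l)\<bar> = 1"
    by (induction l) (auto simp: abs_mult)
  then show ?thesis
    by (simp add: parity_def abs_mult abs_inversion_sign)
qed

lemma abs_coeff_sort_abs:
  assumes "alternating_form 8 \<alpha>" "length l = 8" "0 \<notin> set l"
  shows "\<bar>basis_coeff \<alpha> l\<bar> = \<bar>basis_coeff \<alpha> (sort_abs l)\<bar>"
  using coeff_parity[OF assms(1,2)] abs_parity[OF assms(3)]
  by (metis abs_mult mult_1 of_int_1 of_int_abs)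

lemma coeff_eq_0_if_not_distinct:
  assumes "alternating_form 8 \<alpha>" "length l = 8" "\<not> distinct (map abs l)"
  shows "basis_coeff \<alpha> l = 0"
proof -
  obtain i j where "i < 8" "j < 8" "i \<noteq> j" "\<bar>l ! i\<bar> = \<bar>l ! j\<bar>"
    using assms(2,3) by (auto simp: distinct_conv_nth)
  then have "basis_coeff \<alpha> (map abs l) = 0"
    using assms(1,2) unfolding alternating_form_def basis_coeff_def by (metis length_map nth_map)
  then show ?thesis
    using coeff_abs[OF assms(1,2)] by simp
qed

lemma symm_admissible: "symm w \<Longrightarrow> admissible l \<Longrightarrow> admissible (map (act w) l)"
  using monomial_act(1) by (auto simp: symm_def admissible_def)

lemma coeff_symm:
  assumes \<alpha>: "alternating_form 8 \<alpha>" "spin9_invariant \<alpha>"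
    and l: "symm w" "length l = 8" "admissible l"
  shows "basis_coeff \<alpha> (map (act w) l) = basis_coeff \<alpha> l"
proof -
  obtain h where h: "h \<in> spin9" "monomial h w"
    using l(1) by (auto simp: symm_def)
  have "basis_coeff \<alpha> l = \<alpha> (\<lambda>i. h *v signed_basis (l ! i))"
    using \<alpha>(2) h(1) by (simp add: spin9_invariant_def basis_coeff_def)
  also have "\<dots> = basis_coeff \<alpha> (map (act w) l)"
    unfolding basis_coeff_def using l h
    by (intro alternating_form_cong[OF \<alpha>(1)]) (auto simp: admissible_def monomial_act)
  finally show ?thesis ..
qed

lemma coeff_img:
  assumes \<alpha>: "alternating_form 8 \<alpha>" "spin9_invariant \<alpha>"
    and "\<forall>w\<in>set ws. symm w" "length l = 8" "admissible l"
  shows "basis_coeff \<alpha> (img ws l) = basis_coeff \<alpha> l"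
  using assms(3-)
  by (induction ws arbitrary: l) (simp_all add: img_Cons coeff_symm[OF \<alpha>] symm_admissible)

lemma admissible_img: "\<forall>w\<in>set ws. symm w \<Longrightarrow> admissible l \<Longrightarrow> admissible (img ws l)"
  by (induction ws arbitrary: l) (simp_all add: img_Cons symm_admissible)

lemma admissible_nonzero: "admissible l \<Longrightarrow> 0 \<notin> set l"
  by (auto simp: admissible_def)

text \<open>Coefficients in one orbit of the signed permutations agree up to sign, so orbit
  arguments may ignore signs and order.\<close>

lemma abs_coeff_img:
  assumes \<alpha>: "alternating_form 8 \<alpha>" "spin9_invariant \<alpha>"
    and "\<forall>w\<in>set ws. symm w" "length l = 8" "admissible l"
  shows "\<bar>basis_coeff \<alpha> (sort_abs (img ws l))\<bar> = \<bar>basis_coeff \<alpha> l\<bar>"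
  using coeff_img[OF assms] abs_coeff_sort_abs[OF \<alpha>(1), of "img ws l"] assms
  by (simp add: admissible_nonzero admissible_img)

text \<open>I_0 I_8 moves one index at a time to the corresponding place in the other block. A list
  with an odd number of indices in the first block therefore yields a relation between coefficients
  of even types.\<close>

lemma coeff_derivation:
  assumes \<alpha>: "alternating_form 8 \<alpha>" "spin9_invariant \<alpha>" and l: "length l = 8" "admissible l"
  shows "(\<Sum>k<8. basis_coeff \<alpha> (l[k := act transl8 (l ! k)])) = 0"
proof -
  have transl8: "map (act (gens ! 0)) (gens ! 8) = transl8"
    by code_simp
  have mono: "monomial (clifford_gen 0 ** clifford_gen 8) transl8"
    using monomial_mult[OF monomial_clifford_gen monomial_clifford_gen, of 0 8] by (simp add: transl8)
  let ?v = "\<lambda>i. signed_basis (l ! i)"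
  have "basis_coeff \<alpha> (l[k := act transl8 (l ! k)]) =
      \<alpha> (?v(k := clifford_gen 0 *v (clifford_gen 8 *v ?v k)))" if "k < 8" for k
    unfolding basis_coeff_def using that l monomial_act(2)[OF mono, of "l ! k"]
    by (intro alternating_form_cong[OF \<alpha>(1)])
      (auto simp: matrix_vector_mul_assoc admissible_def nth_list_update)
  then show ?thesis
    using spin9_derivation[OF \<alpha>, of 0 8 ?v] by simp
qed

section \<open>Linear relations between the coefficients\<close>

definition symmetries :: "int list list" where
  "symmetries = [transl2, transl4, transl6, transl8,
     refl0214, refl0436, refl0625, refl1257, refl1734, refl3756, shift1, shift2, shift4]"

lemma symm_symmetries: "w \<in> set symmetries \<Longrightarrow> symm w"
  by (auto simp: symmetries_def symm_transl2 symm_transl4 symm_transl6 symm_transl8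
      symm_refl0214 symm_refl0436 symm_refl0625
      symm_refl1257 symm_refl1734 symm_refl3756 symm_shift1 symm_shift2 symm_shift4)

text \<open>A certificate that evaluation can check: the word \<open>ws\<close>, applied from its
  head, carries \<open>l\<close> to the index set \<open>l'\<close>.\<close>

definition reaches :: "int list \<Rightarrow> int list list \<Rightarrow> int list \<Rightarrow> bool" where
  "reaches l ws l' \<longleftrightarrow> length l = 8 \<and> (\<forall>m\<in>set l. 1 \<le> \<bar>m\<bar> \<and> \<bar>m\<bar> \<le> 16) \<and>
     (\<forall>w\<in>set ws. w \<in> set symmetries) \<and> sort_abs (img ws l) = l'"

lemma sum_lessThan_8: "(\<Sum>k<8. f k) = f 0 + f 1 + f 2 + f 3 + f 4 + f 5 + f 6 + f (7::nat)"
  for f :: "nat \<Rightarrow> real"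
  by (simp add: eval_nat_numeral)

text \<open>Seven terms equal to \<open>u\<close> up to sign add up to an odd multiple of
  \<open>u\<close>.\<close>

lemma odd_sum_eq_0:
  fixes x1 x2 x3 x4 x5 x6 x7 u :: real
  assumes "\<bar>x1\<bar> = u" "\<bar>x2\<bar> = u" "\<bar>x3\<bar> = u" "\<bar>x4\<bar> = u" "\<bar>x5\<bar> = u" "\<bar>x6\<bar> = u" "\<bar>x7\<bar> = u"
    and "x1 + x2 + x3 + x4 + x5 + x6 + x7 = 0"
  shows "u = 0"
  using assms by (auto simp: abs_if split: if_splits)

context
  fixes \<alpha> :: "R16 form"
  assumes \<alpha>: "alternating_form 8 \<alpha>" "spin9_invariant \<alpha>"
begin

lemma reaches: "reaches l ws l' \<Longrightarrow> \<bar>basis_coeff \<alpha> l\<bar> = \<bar>basis_coeff \<alpha> l'\<bar>"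
  using abs_coeff_img[OF \<alpha>, of ws l] symm_symmetries
  by (auto simp: reaches_def admissible_def)

lemma coeff_eq_parity:
  "length l = 8 \<Longrightarrow> admissible l \<Longrightarrow> \<forall>w\<in>set ws. symm w \<Longrightarrow>
   basis_coeff \<alpha> l = of_int (parity (img ws l)) * basis_coeff \<alpha> (sort_abs (img ws l))"
  using coeff_img[OF \<alpha>, of ws l] coeff_parity[OF \<alpha>(1), of "img ws l"] by simp

text \<open>The monomials of type (4, 4) over two non-parallel affine planes are fixed up to a sign
  \<open>-1\<close> by one of the three relative translations.\<close>

lemma coeff_nonparallel_planes:
  assumes "l \<in> set [[1,4,6,7,9,10,13,14],
      [1,4,6,7,9,11,14,16],
      [1,4,6,7,9,12,13,16],
      [1,4,6,7,9,10,11,12],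
      [1,4,6,7,9,11,13,15],
      [1,4,6,7,9,10,15,16]]"
  shows "basis_coeff \<alpha> l = 0"
proof -
  have "\<forall>l\<in>set [[1,4,6,7,9,10,13,14],
      [1,4,6,7,9,11,14,16],
      [1,4,6,7,9,12,13,16],
      [1,4,6,7,9,10,11,12],
      [1,4,6,7,9,11,13,15],
      [1,4,6,7,9,10,15,16]]. length l = 8 \<and> (\<forall>m\<in>set l. 1 \<le> \<bar>m\<bar> \<and> \<bar>m\<bar> \<le> 16) \<and>
      (\<exists>s\<in>set [shift1, shift2, shift4]. parity (img [s] l) = - 1 \<and> sort_abs (img [s] l) = l)"
    by code_simp
  from bspec[OF this assms] obtain s where l: "length l = 8" "admissible l"
    and s: "s \<in> set [shift1, shift2, shift4]" "parity (img [s] l) = - 1" "sort_abs (img [s] l) = l"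
    unfolding admissible_def atLeastAtMost_iff by blast
  have "symm s"
    using s(1) symm_shift1 symm_shift2 symm_shift4 by (simp only: list.set) blast
  then show ?thesis
    using coeff_eq_parity[OF l, of "[s]"] s(2,3) by simp
qed

context
  assumes top: "basis_coeff \<alpha> [1,2,3,4,5,6,7,8] = 0"
begin

text \<open>The derivation at the indices 2, ..., 8, 9 gives seven terms of type (6, 2), all equal
  up to sign to the same coefficient, and one top term, which vanishes. Since seven is odd, no
  choice of signs can cancel.\<close>

lemma coeff_6_2: "basis_coeff \<alpha> [1,2,3,6,7,8,9,16] = 0"
proof -
  have x1: "\<bar>basis_coeff \<alpha> [10, 3, 4, 5, 6, 7, 8, 9]\<bar> = \<bar>basis_coeff \<alpha> [1,2,3,6,7,8,9,16]\<bar>"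
    by (rule reaches[of _ "[refl0214, refl0436, transl2]"]) code_simp
  have x2: "\<bar>basis_coeff \<alpha> [2, 11, 4, 5, 6, 7, 8, 9]\<bar> = \<bar>basis_coeff \<alpha> [1,2,3,6,7,8,9,16]\<bar>"
    by (rule reaches[of _ "[refl0625, refl0214, transl2, shift1, shift4]"]) code_simp
  have x3: "\<bar>basis_coeff \<alpha> [2, 3, 12, 5, 6, 7, 8, 9]\<bar> = \<bar>basis_coeff \<alpha> [1,2,3,6,7,8,9,16]\<bar>"
    by (rule reaches[of _ "[refl0214, transl4]"]) code_simp
  have x4: "\<bar>basis_coeff \<alpha> [2, 3, 4, 13, 6, 7, 8, 9]\<bar> = \<bar>basis_coeff \<alpha> [1,2,3,6,7,8,9,16]\<bar>"
    by (rule reaches[of _ "[refl0436, refl0625, transl2, shift1]"]) code_simp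
  have x5: "\<bar>basis_coeff \<alpha> [2, 3, 4, 5, 14, 7, 8, 9]\<bar> = \<bar>basis_coeff \<alpha> [1,2,3,6,7,8,9,16]\<bar>"
    by (rule reaches[of _ "[refl0436, shift1]"]) code_simp
  have x6: "\<bar>basis_coeff \<alpha> [2, 3, 4, 5, 6, 15, 8, 9]\<bar> = \<bar>basis_coeff \<alpha> [1,2,3,6,7,8,9,16]\<bar>"
    by (rule reaches[of _ "[refl0625, transl6, shift1, shift4]"]) code_simp
  have x7: "\<bar>basis_coeff \<alpha> [2, 3, 4, 5, 6, 7, 16, 9]\<bar> = \<bar>basis_coeff \<alpha> [1,2,3,6,7,8,9,16]\<bar>"
    by (rule reaches[of _ "[transl2, shift1, shift2]"]) code_simp
  have x8: "\<bar>basis_coeff \<alpha> [2, 3, 4, 5, 6, 7, 8, -1]\<bar> = \<bar>basis_coeff \<alpha> [1,2,3,4,5,6,7,8]\<bar>"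
    by (rule reaches[of _ "[]"]) code_simp
  have "basis_coeff \<alpha> [10, 3, 4, 5, 6, 7, 8, 9] + basis_coeff \<alpha> [2, 11, 4, 5, 6, 7, 8, 9] + basis_coeff \<alpha> [2, 3, 12, 5, 6, 7, 8, 9] + basis_coeff \<alpha> [2, 3, 4, 13, 6, 7, 8, 9] + basis_coeff \<alpha> [2, 3, 4, 5, 14, 7, 8, 9] + basis_coeff \<alpha> [2, 3, 4, 5, 6, 15, 8, 9] + basis_coeff \<alpha> [2, 3, 4, 5, 6, 7, 16, 9] + basis_coeff \<alpha> [2, 3, 4, 5, 6, 7, 8, -1] = 0"
    using coeff_derivation[OF \<alpha>, of "[2, 3, 4, 5, 6, 7, 8, 9]"]
    by (simp add: sum_lessThan_8 act_def transl8_def admissible_def)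
  then have "\<bar>basis_coeff \<alpha> [1,2,3,6,7,8,9,16]\<bar> = 0"
    using x8 top by (intro odd_sum_eq_0[OF x1 x2 x3 x4 x5 x6 x7]) simp
  then show ?thesis by simp
qed

text \<open>Of the eight terms of the relation, four repeat an index, one belongs to non-parallel
  planes and one to type (6, 2). The remaining two are pairs of tetrahedra, and these must be shown
  to add up rather than to cancel.\<close>

lemma coeff_tetrahedra: "basis_coeff \<alpha> [1,2,3,5,9,10,11,13] = 0"
proof -
  have x1: "\<bar>basis_coeff \<alpha> [2, 11, 4, 6, 8, 10, 14, 15]\<bar> = \<bar>basis_coeff \<alpha> [1,4,6,7,9,11,13,15]\<bar>"
    by (rule reaches[of _ "[refl0625, refl0436]"]) code_simp
  have x4: "\<bar>basis_coeff \<alpha> [2, 3, 4, 6, 16, 10, 14, 15]\<bar> = \<bar>basis_coeff \<alpha> [1,2,3,5,9,10,11,13]\<bar>"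
    by (rule reaches[of _ "[refl0436, shift4]"]) code_simp
  have x7: "\<bar>basis_coeff \<alpha> [2, 3, 4, 6, 8, 10, 14, -7]\<bar> = \<bar>basis_coeff \<alpha> [1,2,3,6,7,8,9,16]\<bar>"
    by (rule reaches[of _ "[refl0436, refl0625, transl2]"]) code_simp
  have dup: "basis_coeff \<alpha> l = 0" if "length l = 8 \<and> \<not> distinct (map abs l)" for l
    using that coeff_eq_0_if_not_distinct[OF \<alpha>(1)] by blast
  have z0: "basis_coeff \<alpha> [10, 3, 4, 6, 8, 10, 14, 15] = 0"
    by (rule dup) code_simp
  have z3: "basis_coeff \<alpha> [2, 3, 4, 14, 8, 10, 14, 15] = 0"
    by (rule dup) code_simp
  have z5: "basis_coeff \<alpha> [2, 3, 4, 6, 8, -2, 14, 15] = 0"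
    by (rule dup) code_simp
  have z6: "basis_coeff \<alpha> [2, 3, 4, 6, 8, 10, -6, 15] = 0"
    by (rule dup) code_simp
  \<comment> \<open>Absolute values do not suffice here: the two surviving terms are reduced to the
    same sorted list and have the same parity.\<close>
  have "basis_coeff \<alpha> [2, 3, 12, 6, 8, 10, 14, 15] = of_int (parity (img [transl4, refl3756] [2, 3, 12, 6, 8, 10, 14, 15])) * basis_coeff \<alpha> (sort_abs (img [transl4, refl3756] [2, 3, 12, 6, 8, 10, 14, 15]))"
    using symm_transl4 symm_refl3756 by (intro coeff_eq_parity) (simp_all add: admissible_def)
  moreover have "basis_coeff \<alpha> [2, 3, 4, 6, 16, 10, 14, 15] = of_int (parity [2, 3, 4, 6, 16, 10, 14, 15]) * basis_coeff \<alpha> (sort_abs [2, 3, 4, 6, 16, 10, 14, 15])"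
    by (rule coeff_parity[OF \<alpha>(1)]) simp
  moreover have "parity (img [transl4, refl3756] [2, 3, 12, 6, 8, 10, 14, 15]) = parity [2, 3, 4, 6, 16, 10, 14, 15] \<and>
      sort_abs (img [transl4, refl3756] [2, 3, 12, 6, 8, 10, 14, 15]) = sort_abs [2, 3, 4, 6, 16, 10, 14, 15]"
    by code_simp
  ultimately have "basis_coeff \<alpha> [2, 3, 12, 6, 8, 10, 14, 15] = basis_coeff \<alpha> [2, 3, 4, 6, 16, 10, 14, 15]"
    by simp
  moreover have "basis_coeff \<alpha> [10, 3, 4, 6, 8, 10, 14, 15] + basis_coeff \<alpha> [2, 11, 4, 6, 8, 10, 14, 15] + basis_coeff \<alpha> [2, 3, 12, 6, 8, 10, 14, 15] + basis_coeff \<alpha> [2, 3, 4, 14, 8, 10, 14, 15] + basis_coeff \<alpha> [2, 3, 4, 6, 16, 10, 14, 15] + basis_coeff \<alpha> [2, 3, 4, 6, 8, -2, 14, 15] + basis_coeff \<alpha> [2, 3, 4, 6, 8, 10, -6, 15] + basis_coeff \<alpha> [2, 3, 4, 6, 8, 10, 14, -7] = 0"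
    using coeff_derivation[OF \<alpha>, of "[2, 3, 4, 6, 8, 10, 14, 15]"]
    by (simp add: sum_lessThan_8 act_def transl8_def admissible_def)
  ultimately show ?thesis
    using x1 x4 x7 z0 z3 z5 z6 coeff_6_2 coeff_nonparallel_planes[of "[1,4,6,7,9,11,13,15]"] by simp
qed

text \<open>The relation has four tetrahedral terms and three of type (6, 2), all known to vanish,
  so the single term with parallel planes vanishes too.\<close>

lemma coeff_parallel_planes: "basis_coeff \<alpha> [1,4,6,7,9,12,14,15] = 0"
proof -
  have x0: "\<bar>basis_coeff \<alpha> [10, 3, 6, 7, 8, 9, 12, 13]\<bar> = \<bar>basis_coeff \<alpha> [1,2,3,5,9,10,11,13]\<bar>"
    by (rule reaches[of _ "[refl0625, transl4, shift2, shift4]"]) code_simp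
  have x1: "\<bar>basis_coeff \<alpha> [2, 11, 6, 7, 8, 9, 12, 13]\<bar> = \<bar>basis_coeff \<alpha> [1,2,3,5,9,10,11,13]\<bar>"
    by (rule reaches[of _ "[refl0436, transl2, transl4, shift1, shift4]"]) code_simp
  have x2: "\<bar>basis_coeff \<alpha> [2, 3, 14, 7, 8, 9, 12, 13]\<bar> = \<bar>basis_coeff \<alpha> [1,2,3,5,9,10,11,13]\<bar>"
    by (rule reaches[of _ "[refl0625, refl0214, shift2, shift4]"]) code_simp
  have x3: "\<bar>basis_coeff \<alpha> [2, 3, 6, 15, 8, 9, 12, 13]\<bar> = \<bar>basis_coeff \<alpha> [1,2,3,5,9,10,11,13]\<bar>"
    by (rule reaches[of _ "[refl0214, refl0436, transl2, shift1, shift2]"]) code_simp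
  have x4: "\<bar>basis_coeff \<alpha> [2, 3, 6, 7, 16, 9, 12, 13]\<bar> = \<bar>basis_coeff \<alpha> [1,4,6,7,9,12,14,15]\<bar>"
    by (rule reaches[of _ "[refl0436, transl2]"]) code_simp
  have x5: "\<bar>basis_coeff \<alpha> [2, 3, 6, 7, 8, -1, 12, 13]\<bar> = \<bar>basis_coeff \<alpha> [1,2,3,6,7,8,9,16]\<bar>"
    by (rule reaches[of _ "[shift1, shift2]"]) code_simp
  have x6: "\<bar>basis_coeff \<alpha> [2, 3, 6, 7, 8, 9, -4, 13]\<bar> = \<bar>basis_coeff \<alpha> [1,2,3,6,7,8,9,16]\<bar>"
    by (rule reaches[of _ "[refl0436, refl0625, transl2, shift1]"]) code_simp
  have x7: "\<bar>basis_coeff \<alpha> [2, 3, 6, 7, 8, 9, 12, -5]\<bar> = \<bar>basis_coeff \<alpha> [1,2,3,6,7,8,9,16]\<bar>"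
    by (rule reaches[of _ "[refl0214, transl4]"]) code_simp
  have "basis_coeff \<alpha> [10, 3, 6, 7, 8, 9, 12, 13] + basis_coeff \<alpha> [2, 11, 6, 7, 8, 9, 12, 13] + basis_coeff \<alpha> [2, 3, 14, 7, 8, 9, 12, 13] + basis_coeff \<alpha> [2, 3, 6, 15, 8, 9, 12, 13] + basis_coeff \<alpha> [2, 3, 6, 7, 16, 9, 12, 13] + basis_coeff \<alpha> [2, 3, 6, 7, 8, -1, 12, 13] + basis_coeff \<alpha> [2, 3, 6, 7, 8, 9, -4, 13] + basis_coeff \<alpha> [2, 3, 6, 7, 8, 9, 12, -5] = 0"
    using coeff_derivation[OF \<alpha>, of "[2, 3, 6, 7, 8, 9, 12, 13]"]
    by (simp add: sum_lessThan_8 act_def transl8_def admissible_def)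
  then show ?thesis
    using x0 x1 x2 x3 x4 x5 x6 x7 coeff_tetrahedra coeff_6_2 by simp
qed

text \<open>The types with two or no indices in the first block follow from those with six or eight
  by exchanging the blocks with \<open>transl8\<close>.\<close>

lemma coeff_representatives:
  assumes "l \<in> set [[1,2,3,4,5,6,7,8],
      [1,2,3,6,7,8,9,16],
      [1,2,3,5,9,10,11,13],
      [1,4,6,7,9,12,14,15],
      [1,4,6,7,9,10,13,14],
      [1,4,6,7,9,11,14,16],
      [1,4,6,7,9,12,13,16],
      [1,4,6,7,9,10,11,12],
      [1,4,6,7,9,11,13,15],
      [1,4,6,7,9,10,15,16],
      [1,8,9,10,11,14,15,16],
      [9,10,11,12,13,14,15,16]]"
  shows "basis_coeff \<alpha> l = 0"
proof -
  have "\<bar>basis_coeff \<alpha> [1,8,9,10,11,14,15,16]\<bar> = \<bar>basis_coeff \<alpha> [1,2,3,6,7,8,9,16]\<bar>"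
    by (rule reaches[of _ "[transl8]"]) code_simp
  moreover have "\<bar>basis_coeff \<alpha> [9,10,11,12,13,14,15,16]\<bar> = \<bar>basis_coeff \<alpha> [1,2,3,4,5,6,7,8]\<bar>"
    by (rule reaches[of _ "[transl8]"]) code_simp
  ultimately show ?thesis
    using assms top coeff_6_2 coeff_tetrahedra coeff_parallel_planes coeff_nonparallel_planes
    by auto
qed

end

end

section \<open>Orbits of index sets\<close>

text \<open>Symmetries preserving both blocks; \<open>transl8\<close>, which exchanges them, is left
  out.\<close>

definition block_symmetries :: "int list list" where
  "block_symmetries = [transl2, transl4, transl6, refl0214, refl0436, refl0625, shift1, shift2, shift4]"

definition upper_words :: "int list list list" where
  "upper_words = [[], [refl0214], [refl0436], [refl0625], [refl0214, refl0436], [refl0436, refl0625], [refl0625, refl0214],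
     [refl0214, refl0625], [refl0436, refl0214], [refl0625, refl0436]]"

definition translation_words :: "int list list list" where
  "translation_words = [[], [transl2], [transl4], [transl6], [transl2, transl4], [transl2, transl6], [transl4, transl6], [transl2, transl4, transl6]]"

definition relative_words :: "int list list list" where
  "relative_words = [[], [shift1], [shift2], [shift4], [shift1, shift2], [shift1, shift4], [shift2, shift4], [shift1, shift2, shift4]]"

text \<open>All translates of the sets in \<open>upper_representatives\<close>: the empty set, 4
  pairs, 2 planes, 8 tetrahedra, 4 complements of the pairs, and the whole block.\<close>

definition translation_classes :: "int list list" where
  "translation_classes =
    [[],
     [1, 8],
     [2, 7],
     [3, 6],
     [4, 5],
     [1, 2, 3, 5],
     [1, 2, 4, 6],
     [1, 3, 4, 7],
     [1, 4, 6, 7],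
     [1, 5, 6, 7],
     [2, 3, 4, 8],
     [2, 3, 5, 8],
     [2, 5, 6, 8],
     [3, 5, 7, 8],
     [4, 6, 7, 8],
     [1, 2, 3, 6, 7, 8],
     [1, 2, 4, 5, 7, 8],
     [1, 3, 4, 5, 6, 8],
     [2, 3, 4, 5, 6, 7],
     [1, 2, 3, 4, 5, 6, 7, 8]]"

definition upper_representatives :: "int list list" where
  "upper_representatives =
    [[], [1, 8], [1, 4, 6, 7], [1, 2, 3, 5], [1, 2, 3, 6, 7, 8], [1, 2, 3, 4, 5, 6, 7, 8]]"

text \<open>For non-parallel planes the first plane is fixed and the second runs through the six
  planes containing 9 that are not parallel to it; each of the other types has one entry.\<close>

definition representatives :: "int list list" where
  "representatives =
     [[1,2,3,4,5,6,7,8],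
      [1,2,3,6,7,8,9,16],
      [1,2,3,5,9,10,11,13],
      [1,4,6,7,9,12,14,15],
      [1,4,6,7,9,10,13,14],
      [1,4,6,7,9,11,14,16],
      [1,4,6,7,9,12,13,16],
      [1,4,6,7,9,10,11,12],
      [1,4,6,7,9,11,13,15],
      [1,4,6,7,9,10,15,16],
      [1,8,9,10,11,14,15,16],
      [9,10,11,12,13,14,15,16]]"

text \<open>The part \<open>X\<close> of an index set \<open>X @ Y\<close> in the first block is normalised by linear maps of \<open>F\<^sub>2\<^sup>3\<close>
  (up to translation) and then by translations; \<open>Y\<close> is moved along. Finally \<open>Y\<close> is normalised by the
  translations of the second block alone, which do not move \<open>X\<close>.\<close>

lemma upper_cover:
  "\<forall>X\<in>set (subseqs [1..8]). odd (length X) \<or>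
     (\<exists>ws\<in>set upper_words. sort_abs (img ws X) \<in> set translation_classes)"
  by code_simp

lemma translation_cover:
  "\<forall>X\<in>set translation_classes. \<exists>ws\<in>set translation_words.
     sort_abs (img ws X) \<in> set upper_representatives"
  by code_simp

text \<open>For \<open>X\<close> of even size the three diagonal matrices act on the coefficient by
  the signs of the three bits of the sum of \<open>X\<close> plus the sum of \<open>Y\<close>. What
  survives has equal sums.\<close>

lemma lower_cover:
  "\<forall>X\<in>set upper_representatives. \<forall>Y\<in>set (filter (\<lambda>Y. length X + length Y = 8) (subseqs [9..16])).
     (\<exists>d\<in>set [diag1, diag2, diag3]. prod_list (map sgn (img [d] (X @ Y))) = - 1 \<and>
        map abs (img [d] (X @ Y)) = X @ Y) \<or>
     (\<exists>ws\<in>set relative_words. sort_abs (img ws (X @ Y)) \<in> set representatives)"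
  by code_simp

lemma sort_abs_cong: "mset (map abs l) = mset (map abs l') \<Longrightarrow> sort_abs l = sort_abs l'"
  unfolding sort_abs_def by (metis sorted_list_of_multiset_mset)

lemma abs_coeff_cong:
  assumes "alternating_form 8 \<alpha>" "length l = 8" "0 \<notin> set l" "mset (map abs l) = mset (map abs l')"
  shows "\<bar>basis_coeff \<alpha> l\<bar> = \<bar>basis_coeff \<alpha> l'\<bar>"
proof -
  have "length l' = 8"
    using assms(2,4) by (metis length_map size_mset)
  moreover have "abs ` set l = abs ` set l'"
    using assms(4) by (metis set_map set_mset_mset)
  then have "0 \<notin> set l'"
    using assms(3) by force
  ultimately show ?thesis
    using abs_coeff_sort_abs[OF assms(1)] assms(2,3) sort_abs_cong[OF assms(4)] by metis
qed

text \<open>Transfers the finite checks over \<open>subseqs\<close> to arbitrary distinct lists, up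
  to order.\<close>

lemma mset_subseqs:
  assumes "distinct xs" "distinct ys" "set xs \<subseteq> set ys"
  shows "\<exists>zs\<in>set (subseqs ys). mset zs = mset xs"
proof -
  obtain zs where "zs \<in> set (subseqs ys)" "set zs = set xs"
    using assms(3) subseqs_powset[of ys] by (metis (no_types, lifting) PowI imageE)
  then show ?thesis
    using assms subseqs_distinctD set_eq_iff_mset_eq_distinct by metis
qed

section \<open>Reduction of arbitrary indices to the representatives\<close>

lemma block_symmetries_lower:
  assumes "w \<in> set block_symmetries" "\<bar>m\<bar> \<in> {9..16}"
  shows "\<bar>act w m\<bar> \<in> {9..16}"
proof -
  have "\<forall>w\<in>set block_symmetries. \<forall>m\<in>set [9..16]. 9 \<le> \<bar>act w m\<bar> \<and> \<bar>act w m\<bar> \<le> 16"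
    by code_simp
  from bspec[OF bspec[OF this assms(1)], unfolded set_upto, OF assms(2)]
  have "\<bar>act w \<bar>m\<bar>\<bar> \<in> {9..16}"
    by (simp only: atLeastAtMost_iff)
  moreover have "\<bar>act w \<bar>m\<bar>\<bar> = \<bar>act w m\<bar>"
    by (simp add: act_def abs_mult)
  ultimately show ?thesis by simp
qed

lemma block_symmetries_img_lower:
  assumes "set ws \<subseteq> set block_symmetries" "\<forall>m\<in>set Y. \<bar>m\<bar> \<in> {9..16}"
  shows "\<forall>m\<in>set (img ws Y). \<bar>m\<bar> \<in> {9..16}"
  using assms
proof (induction ws arbitrary: Y)
  case (Cons w ws)
  have "\<forall>m\<in>set (map (act w) Y). \<bar>m\<bar> \<in> {9..16}"
    using Cons.prems block_symmetries_lower by (simp del: atLeastAtMost_iff)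
  moreover have "set ws \<subseteq> set block_symmetries"
    using Cons.prems(1) by simp
  ultimately show ?case
    unfolding img_Cons by (intro Cons.IH)
qed simp

lemma symm_block_symmetries: "w \<in> set block_symmetries \<Longrightarrow> symm w"
  by (rule symm_symmetries) (auto simp: block_symmetries_def symmetries_def)

context
  fixes \<alpha> :: "R16 form"
  assumes \<alpha>: "alternating_form 8 \<alpha>" "spin9_invariant \<alpha>"
begin

text \<open>While \<open>X\<close> is normalised, it is only recorded that the other indices stay in
  the second block. Thus the finite check for \<open>X\<close> need not run over
  \<open>Y\<close>.\<close>

lemma block_step:
  assumes ws: "set ws \<subseteq> set block_symmetries"
    and X: "set X \<subseteq> {1..8}" and Y: "set Y \<subseteq> {9..16}" and len: "length X + length Y = 8"
  shows "\<exists>Y'. set Y' \<subseteq> {9..16} \<and> length Y' = length Y \<and>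
    \<bar>basis_coeff \<alpha> (X @ Y)\<bar> = \<bar>basis_coeff \<alpha> (sort_abs (img ws X) @ Y')\<bar>"
proof (intro exI conjI)
  let ?Y' = "map abs (img ws Y)"
  have symm: "\<forall>w\<in>set ws. symm w"
    using ws symm_block_symmetries by auto
  have adm: "admissible (X @ Y)"
    using X Y by (force simp: admissible_def)
  have adm': "admissible (img ws (X @ Y))"
    by (rule admissible_img[OF symm adm])
  have "\<bar>basis_coeff \<alpha> (X @ Y)\<bar> = \<bar>basis_coeff \<alpha> (img ws (X @ Y))\<bar>"
    using coeff_img[OF \<alpha> symm, of "X @ Y"] len adm by simp
  also have "\<dots> = \<bar>basis_coeff \<alpha> (sort_abs (img ws X) @ ?Y')\<bar>"
    using len admissible_nonzero[OF adm']
    by (intro abs_coeff_cong[OF \<alpha>(1)]) (simp_all add: img_append sort_abs_def multiset.map_comp comp_def)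
  finally show "\<bar>basis_coeff \<alpha> (X @ Y)\<bar> = \<bar>basis_coeff \<alpha> (sort_abs (img ws X) @ ?Y')\<bar>" .
  have "\<forall>m\<in>set Y. \<bar>m\<bar> \<in> {9..16}"
    using Y by force
  then show "set ?Y' \<subseteq> {9..16}"
    using block_symmetries_img_lower[OF ws, of Y] by (auto simp del: atLeastAtMost_iff)
qed simp

text \<open>A diagonal symmetry with sign -1 on the index set forces the coefficient to equal its
  negative.\<close>

lemma coeff_diagonal:
  assumes "symm d" "length l = 8" "admissible l" "map abs (img [d] l) = l"
    "prod_list (map sgn (img [d] l)) = - 1"
  shows "basis_coeff \<alpha> l = 0"
  using coeff_img[OF \<alpha>, of "[d]" l] coeff_abs[OF \<alpha>(1), of "img [d] l"] assms by simp

text \<open>\<open>diag0\<close> is the identity on the first block and minus the identity on the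
  second, and here \<open>Y\<close> has odd length.\<close>

lemma coeff_odd:
  assumes X: "set X \<subseteq> {1..8}" and Y: "set Y \<subseteq> {9..16}"
    and len: "length X + length Y = 8" "odd (length X)"
  shows "basis_coeff \<alpha> (X @ Y) = 0"
proof (rule coeff_diagonal[OF symm_diag0])
  have "\<forall>m\<in>set [1..8]. act diag0 m = m" "\<forall>m\<in>set [9..16]. act diag0 m = - m"
    by code_simp+
  then have "\<forall>m\<in>{1..8}. act diag0 m = m" "\<forall>m\<in>{9..16}. act diag0 m = - m"
    unfolding set_upto by blast+
  then have "map (act diag0) X = X" "map (act diag0) Y = map uminus Y"
    using X Y by (auto intro!: map_idI simp del: atLeastAtMost_iff)
  then have img: "img [diag0] (X @ Y) = X @ map uminus Y"
    by (simp add: img_Cons)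
  show "length (X @ Y) = 8" "admissible (X @ Y)"
    using X Y len by (force simp: admissible_def)+
  have "map abs X = X" "map abs Y = Y"
    using X Y by (force intro!: map_idI)+
  then show "map abs (img [diag0] (X @ Y)) = X @ Y"
    by (simp add: img comp_def)
  have "prod_list (map sgn X) = 1"
    using X by (induction X) auto
  moreover have "prod_list (map (sgn \<circ> uminus) Y) = (- 1) ^ length Y"
    using Y by (induction Y) (auto simp: sgn_minus)
  moreover have "odd (length Y)"
    using len by presburger
  ultimately show "prod_list (map sgn (img [diag0] (X @ Y))) = - 1"
    by (simp add: img)
qed

text \<open>The normalisations are treated in reverse order: \<open>stage3\<close> starts from a
  representative \<open>X\<close>, \<open>stage2\<close> from a translate of one,
  \<open>stage1\<close> from any subset of the first block.\<close>

lemma coeff_eq_0: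
  assumes top: "basis_coeff \<alpha> [1,2,3,4,5,6,7,8] = 0"
    and len: "length l = 8" and l: "set l \<subseteq> {1..16}"
  shows "basis_coeff \<alpha> l = 0"
proof -
  have stage3: "basis_coeff \<alpha> (X @ Y) = 0"
    if X: "X \<in> set upper_representatives" and Y: "set Y \<subseteq> {9..16}" and len: "length X + length Y = 8"
    for X Y
  proof (cases "distinct Y")
    case False
    moreover have "map abs Y = Y"
      using Y by (force intro!: map_idI)
    ultimately show ?thesis
      using coeff_eq_0_if_not_distinct[OF \<alpha>(1), of "X @ Y"] len by simp
  next
    case True
    then obtain Y0 where Y0: "Y0 \<in> set (subseqs [9..16])" "mset Y0 = mset Y"
      using mset_subseqs[OF True distinct_upto, of 9 16] Y unfolding set_upto by blast
    have "\<forall>X\<in>set upper_representatives. \<forall>m\<in>set X. 1 \<le> m \<and> m \<le> 8"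
      by code_simp
    then have X': "set X \<subseteq> {1..8}"
      using X by auto
    have "set Y0 = set Y" "length Y0 = length Y"
      using Y0(2) by (metis set_mset_mset, metis size_mset)
    then have adm: "admissible (X @ Y0)" and len0: "length (X @ Y0) = 8"
      using X' Y len by (force simp: admissible_def)+
    have "basis_coeff \<alpha> (X @ Y0) = 0"
    proof -
      have "Y0 \<in> set (filter (\<lambda>Y. length X + length Y = 8) (subseqs [9..16]))"
        using Y0(1) len0 by (simp only: set_filter mem_Collect_eq length_append)
      from bspec[OF bspec[OF lower_cover X] this] show ?thesis
      proof (elim disjE bexE conjE)
        fix d assume d: "d \<in> set [diag1, diag2, diag3]" "prod_list (map sgn (img [d] (X @ Y0))) = - 1"
          "map abs (img [d] (X @ Y0)) = X @ Y0"
        have "symm d"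
          using d(1) symm_diag1 symm_diag2 symm_diag3 by (simp only: list.set) blast
        then show ?thesis
          using coeff_diagonal[OF _ len0 adm d(3,2)] by blast
      next
        fix ws assume ws: "ws \<in> set relative_words" "sort_abs (img ws (X @ Y0)) \<in> set representatives"
        have "set ws \<subseteq> set block_symmetries"
          using ws(1) by (auto simp: relative_words_def block_symmetries_def)
        then have "\<forall>w\<in>set ws. symm w"
          using symm_block_symmetries by blast
        then show ?thesis
          using abs_coeff_img[OF \<alpha> _ len0 adm, of ws] coeff_representatives[OF \<alpha> top, folded representatives_def, OF ws(2)]
          by simp
      qed
    qed
    moreover have "\<bar>basis_coeff \<alpha> (X @ Y0)\<bar> = \<bar>basis_coeff \<alpha> (X @ Y)\<bar>"
      using len0 admissible_nonzero[OF adm] Y0(2) by (intro abs_coeff_cong[OF \<alpha>(1)]) auto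
    ultimately show ?thesis by simp
  qed
  have stage2: "basis_coeff \<alpha> (X @ Y) = 0"
    if X: "X \<in> set translation_classes" and Y: "set Y \<subseteq> {9..16}" and len: "length X + length Y = 8"
    for X Y
  proof -
    obtain ws where ws: "ws \<in> set translation_words" "sort_abs (img ws X) \<in> set upper_representatives"
      using translation_cover X by blast
    have "set ws \<subseteq> set block_symmetries"
      using ws(1) by (auto simp: translation_words_def block_symmetries_def)
    moreover have "\<forall>X\<in>set translation_classes. \<forall>m\<in>set X. 1 \<le> m \<and> m \<le> 8"
      by code_simp
    then have "set X \<subseteq> {1..8}"
      using X by auto
    ultimately obtain Y' where "set Y' \<subseteq> {9..16}" "length Y' = length Y"
        "\<bar>basis_coeff \<alpha> (X @ Y)\<bar> = \<bar>basis_coeff \<alpha> (sort_abs (img ws X) @ Y')\<bar>"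
      using block_step[of ws X Y] Y len by blast
    then show ?thesis
      using stage3[OF ws(2), of Y'] len by (simp add: sort_abs_def)
  qed
  have stage1: "basis_coeff \<alpha> (X @ Y) = 0"
    if X: "X \<in> set (subseqs [1..8])" and Y: "set Y \<subseteq> {9..16}" and len: "length X + length Y = 8"
    for X Y
  proof -
    have "set X \<in> Pow (set [1..8])"
      using X subseqs_powset by (metis imageI)
    then have X': "set X \<subseteq> {1..8}"
      unfolding set_upto Pow_iff .
    show ?thesis
    proof (cases "odd (length X)")
      case True
      then show ?thesis
        using coeff_odd X' Y len by blast
    next
      case False
      then obtain ws where ws: "ws \<in> set upper_words" "sort_abs (img ws X) \<in> set translation_classes"
        using upper_cover X by blast
      have "set ws \<subseteq> set block_symmetries"
        using ws(1) by (auto simp: upper_words_def block_symmetries_def)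
      then obtain Y' where "set Y' \<subseteq> {9..16}" "length Y' = length Y"
          "\<bar>basis_coeff \<alpha> (X @ Y)\<bar> = \<bar>basis_coeff \<alpha> (sort_abs (img ws X) @ Y')\<bar>"
        using block_step[of ws X Y] X' Y len by blast
      then show ?thesis
        using stage2[OF ws(2), of Y'] len by (simp add: sort_abs_def)
    qed
  qed
  have abs_l: "map abs l = l"
    using l by (force intro!: map_idI)
  show ?thesis
  proof (cases "distinct l")
    case False
    then show ?thesis
      using coeff_eq_0_if_not_distinct[OF \<alpha>(1) len] abs_l by simp
  next
    case True
    \<comment> \<open>Only the part in the first block is put in increasing order; the stages accept
      any list in the second.\<close>
    define X where "X = filter (\<lambda>m. m \<le> 8) l"
    define Y where "Y = filter (\<lambda>m. \<not> m \<le> 8) l"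
    have "mset l = mset X + mset Y"
      by (simp add: X_def Y_def)
    moreover obtain X0 where X0: "X0 \<in> set (subseqs [1..8])" "mset X0 = mset X"
      using mset_subseqs[OF _ distinct_upto, of X 1 8, unfolded set_upto] True l
      unfolding X_def by fastforce
    ultimately have mset: "mset l = mset (X0 @ Y)"
      by simp
    then have "length (X0 @ Y) = 8"
      using len by (metis size_mset)
    moreover have "set Y \<subseteq> {9..16}"
      using l by (auto simp: Y_def)
    ultimately have "basis_coeff \<alpha> (X0 @ Y) = 0"
      using stage1[OF X0(1)] by simp
    moreover have "\<bar>basis_coeff \<alpha> l\<bar> = \<bar>basis_coeff \<alpha> (X0 @ Y)\<bar>"
      using len l mset by (intro abs_coeff_cong[OF \<alpha>(1)]) auto
    ultimately show ?thesis by simp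
  qed
qed

lemma axis_eq_signed_basis:
  "axis (a, b, c, d) 1 \<in> signed_basis ` {1..16}"
proof
  show "axis (a, b, c, d) 1 = signed_basis (1 + 8 * of_bool a + 4 * of_bool b + 2 * of_bool c + of_bool d)"
    by (cases a; cases b; cases c; cases d) (simp_all add: signed_basis_def)
qed auto

lemma span_signed_basis: "span (signed_basis ` {1..16}) = UNIV"
proof -
  have "Basis \<subseteq> signed_basis ` {1..16}"
    using axis_eq_signed_basis by (auto simp: Basis_vec_def)
  then show ?thesis
    using span_mono[of Basis "signed_basis ` {1..16}"] by (auto simp: span_Basis)
qed

theorem spin9_invariant_eq_0:
  assumes top: "\<alpha> (\<lambda>i. signed_basis (int i + 1)) = 0"
  shows "\<alpha> v = 0"
proof (rule alternating_form_eq_0_on_basis[OF \<alpha>(1) _ span_signed_basis])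
  fix v :: "nat \<Rightarrow> R16" assume "\<And>i. i < 8 \<Longrightarrow> v i \<in> signed_basis ` {1..16}"
  then obtain m where m: "\<And>i. i < 8 \<Longrightarrow> m i \<in> {1..16} \<and> v i = signed_basis (m i)"
    unfolding image_iff by metis
  have "basis_coeff \<alpha> [1,2,3,4,5,6,7,8] = \<alpha> (\<lambda>i. signed_basis (int i + 1))"
    unfolding basis_coeff_def
  proof (rule alternating_form_cong[OF \<alpha>(1)])
    fix i :: nat assume "i < 8"
    then have "i \<in> {0,1,2,3,4,5,6,7}" by auto
    then show "signed_basis ([1,2,3,4,5,6,7,8] ! i) = signed_basis (int i + 1)"
      by auto
  qed
  have "basis_coeff \<alpha> (map m [0..<8]) = 0"
  proof (rule coeff_eq_0)
    show "basis_coeff \<alpha> [1,2,3,4,5,6,7,8] = 0"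
      using \<open>basis_coeff \<alpha> [1,2,3,4,5,6,7,8] = _\<close> top by (rule trans)
    show "set (map m [0..<8]) \<subseteq> {1..16}"
      unfolding set_map set_upt using m by (auto simp del: atLeastAtMost_iff)
  qed simp_all
  also have "basis_coeff \<alpha> (map m [0..<8]) = \<alpha> v"
    unfolding basis_coeff_def using m by (intro alternating_form_cong[OF \<alpha>(1)]) simp
  finally show "\<alpha> v = 0" .
qed

end

section \<open>Independence of the Clifford basis\<close>

text \<open>\<open>omega\<close> with the inner product and the operators as parameters, for use
  both on tangent spaces and on the model space.\<close>

definition clifford_form ::
  "('v \<Rightarrow> 'v \<Rightarrow> real) \<Rightarrow> (nat \<Rightarrow> 'v \<Rightarrow> 'v) \<Rightarrow> nat \<Rightarrow> nat \<Rightarrow> 'v \<Rightarrow> 'v \<Rightarrow> real" where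
  "clifford_form h J i j x y =
     (if i < j then h x (J i (J j y)) else if j < i then - h x (J j (J i y)) else 0)"

definition quartic :: "(nat \<Rightarrow> nat \<Rightarrow> 'v \<Rightarrow> 'v \<Rightarrow> real) \<Rightarrow> 'v form" where
  "quartic w v = (\<Sum>i\<le>8. \<Sum>j\<le>8. \<Sum>i'\<le>8. \<Sum>j'\<le>8.
     w i j (v 0) (v 1) * w i j' (v 2) (v 3) * w i' j (v 4) (v 5) * w i' j' (v 6) (v 7))"

lemma omega_sum_eq:
  "omega_sum g I p v = alternation 8 (quartic (clifford_form (g p) (\<lambda>i. (*v) (I i p)))) v / 16"
proof -
  have "omega g I p i j = (\<lambda>v. clifford_form (g p) (\<lambda>i. (*v) (I i p)) i j (v 0) (v 1))" for i j
    by (simp add: omega_def clifford_form_def fun_eq_iff)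
  then show ?thesis
    unfolding omega_sum_def wedge_2_2_2_2 quartic_def
    by (simp add: alternation_sum sum_divide_distrib numeral_2_eq_2 numeral_3_eq_3)
qed

text \<open>The correction removes the diagonal term coming from I_i^2 = 1. In this form the
  behaviour under a linear change of the operators is visible, the Kronecker delta being preserved
  by orthogonal matrices.\<close>

lemma clifford_form_eq:
  assumes J: "clifford_system h J" and h: "\<And>x. linear (h x)" and ij: "i \<le> 8" "j \<le> 8"
  shows "clifford_form h (\<lambda>i. (*v) (J i)) i j x y = h x (J i *v (J j *v y)) - (if i = j then h x y else 0)"
proof (cases "i = j")
  case True
  then show ?thesis
    using J ij by (simp add: clifford_form_def clifford_system_def matrix_vector_mul_assoc)
next
  case False
  then have "J i ** J j + J j ** J i = 0"
    using J ij by (auto simp: clifford_system_def)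
  then have "(J i ** J j + J j ** J i) *v y = 0"
    by simp
  then have "J i *v (J j *v y) = - (J j *v (J i *v y))"
    by (simp add: matrix_vector_mult_add_rdistrib matrix_vector_mul_assoc eq_neg_iff_add_eq_0)
  then show ?thesis
    using False by (auto simp: clifford_form_def linear_neg[OF h])
qed

lemma clifford_form_intertwine:
  assumes "\<And>x y. h (U x) (U y) = h' x y" "\<And>k x. k \<le> 8 \<Longrightarrow> I k (U x) = U (J k x)" "i \<le> 8" "j \<le> 8"
  shows "clifford_form h I i j (U x) (U y) = clifford_form h' J i j x y"
  using assms by (simp add: clifford_form_def)

lemma quartic_cong:
  assumes "\<And>i j x y. i \<le> 8 \<Longrightarrow> j \<le> 8 \<Longrightarrow> w i j (U x) (U y) = w' i j x y"
  shows "quartic w (\<lambda>i. U (v i)) = quartic w' v"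
  unfolding quartic_def by (intro sum.cong refl) (simp add: assms)

lemma sum_orthogonal:
  fixes a :: "nat \<Rightarrow> nat \<Rightarrow> real"
  assumes "\<And>k l. k \<le> 8 \<Longrightarrow> l \<le> 8 \<Longrightarrow> (\<Sum>i\<le>8. a i k * a i l) = (if k = l then 1 else 0)"
  shows "(\<Sum>i\<le>8. (\<Sum>k\<le>8. a i k * X k) * (\<Sum>k\<le>8. a i k * Y k)) = (\<Sum>k\<le>8. X k * Y k)"
proof -
  have "(\<Sum>i\<le>8. (\<Sum>k\<le>8. a i k * X k) * (\<Sum>k\<le>8. a i k * Y k)) =
      (\<Sum>i\<le>8. \<Sum>k\<le>8. \<Sum>l\<le>8. (a i k * a i l) * (X k * Y l))"
    by (simp add: sum_product mult_ac)
  also have "\<dots> = (\<Sum>k\<le>8. \<Sum>i\<le>8. \<Sum>l\<le>8. (a i k * a i l) * (X k * Y l))"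
    by (rule sum.swap)
  also have "\<dots> = (\<Sum>k\<le>8. \<Sum>l\<le>8. \<Sum>i\<le>8. (a i k * a i l) * (X k * Y l))"
    by (intro sum.cong refl sum.swap)
  also have "\<dots> = (\<Sum>k\<le>8. \<Sum>l\<le>8. if k = l then X k * Y l else 0)"
    by (intro sum.cong refl) (simp add: assms flip: sum_distrib_right)
  also have "\<dots> = (\<Sum>k\<le>8. X k * Y k)"
    by simp
  finally show ?thesis .
qed

text \<open>Each of the four indices occurs in exactly two factors. \<open>Q\<close> isolates the
  contraction over a first index; the orthogonality of the columns of \<open>a\<close> then removes
  \<open>a\<close> from one contraction after the other.\<close>

lemma quartic_orthogonal:
  fixes a :: "nat \<Rightarrow> nat \<Rightarrow> real"
  assumes a: "\<And>k l. k \<le> 8 \<Longrightarrow> l \<le> 8 \<Longrightarrow> (\<Sum>i\<le>8. a i k * a i l) = (if k = l then 1 else 0)"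
    and w': "\<And>i j x y. i \<le> 8 \<Longrightarrow> j \<le> 8 \<Longrightarrow>
      w' i j x y = (\<Sum>k\<le>8. a i k * (\<Sum>l\<le>8. a j l * w k l x y))"
  shows "quartic w' v = quartic w v"
proof -
  define Q where "Q w x y x' y' j j' = (\<Sum>i\<le>8. w i j x y * w i j' x' y')"
    for w :: "nat \<Rightarrow> nat \<Rightarrow> 'a \<Rightarrow> 'a \<Rightarrow> real" and x y x' y' j j'
  have quartic: "quartic w v = (\<Sum>j'\<le>8. \<Sum>j\<le>8. Q w (v 0) (v 1) (v 2) (v 3) j j' * Q w (v 4) (v 5) (v 6) (v 7) j j')"
    for w
  proof -
    have "quartic w v = (\<Sum>i\<le>8. \<Sum>j\<le>8. \<Sum>j'\<le>8. \<Sum>i'\<le>8.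
       w i j (v 0) (v 1) * w i j' (v 2) (v 3) * (w i' j (v 4) (v 5) * w i' j' (v 6) (v 7)))"
      unfolding quartic_def mult.assoc by (intro sum.cong refl sum.swap)
    also have "\<dots> = (\<Sum>j\<le>8. \<Sum>j'\<le>8. \<Sum>i\<le>8. \<Sum>i'\<le>8.
       w i j (v 0) (v 1) * w i j' (v 2) (v 3) * (w i' j (v 4) (v 5) * w i' j' (v 6) (v 7)))"
      by (subst sum.swap, intro sum.cong refl sum.swap)
    finally show ?thesis
      unfolding Q_def sum_product by (subst sum.swap) 
  qed
  have Q': "Q w' x y x' y' j j' = (\<Sum>l\<le>8. a j l * (\<Sum>n\<le>8. a j' n * Q w x y x' y' l n))"
    if "j \<le> 8" "j' \<le> 8" for x y x' y' j j'
  proof -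
    have "Q w' x y x' y' j j' = (\<Sum>i\<le>8. (\<Sum>k\<le>8. a i k * (\<Sum>l\<le>8. a j l * w k l x y)) *
        (\<Sum>k\<le>8. a i k * (\<Sum>l\<le>8. a j' l * w k l x' y')))"
      unfolding Q_def using that by (intro sum.cong refl) (simp add: w')
    also have "\<dots> = (\<Sum>k\<le>8. (\<Sum>l\<le>8. a j l * w k l x y) * (\<Sum>n\<le>8. a j' n * w k n x' y'))"
      by (rule sum_orthogonal[OF a])
    also have "\<dots> = (\<Sum>k\<le>8. \<Sum>l\<le>8. \<Sum>n\<le>8. a j l * (a j' n * (w k l x y * w k n x' y')))"
      unfolding sum_product by (intro sum.cong refl) (simp add: mult_ac)
    also have "\<dots> = (\<Sum>l\<le>8. \<Sum>n\<le>8. \<Sum>k\<le>8. a j l * (a j' n * (w k l x y * w k n x' y')))"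
      by (subst sum.swap, intro sum.cong refl sum.swap)
    finally show ?thesis
      by (simp add: Q_def sum_distrib_left)
  qed
  have "(\<Sum>j\<le>8. Q w' x y x' y' j j' * Q w' p q p' q' j j') =
      (\<Sum>l\<le>8. (\<Sum>n\<le>8. a j' n * Q w x y x' y' l n) * (\<Sum>n\<le>8. a j' n * Q w p q p' q' l n))"
    if "j' \<le> 8" for x y x' y' p q p' q' j'
    using that by (simp add: Q' sum_orthogonal[OF a])
  then have "quartic w' v = (\<Sum>j'\<le>8. \<Sum>l\<le>8. (\<Sum>n\<le>8. a j' n * Q w (v 0) (v 1) (v 2) (v 3) l n) *
      (\<Sum>n\<le>8. a j' n * Q w (v 4) (v 5) (v 6) (v 7) l n))"
    by (simp add: quartic)
  also have "\<dots> = (\<Sum>l\<le>8. \<Sum>n\<le>8. Q w (v 0) (v 1) (v 2) (v 3) l n * Q w (v 4) (v 5) (v 6) (v 7) l n)"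
    by (subst sum.swap) (simp add: sum_orthogonal[OF a])
  also have "\<dots> = quartic w v"
    unfolding quartic by (rule sum.swap)
  finally show ?thesis .
qed

lemma in_span_image_atMost:
  fixes J :: "nat \<Rightarrow> End16"
  assumes "A \<in> span (J ` {..8})"
  shows "\<exists>a. A = (\<Sum>k\<le>8. a k *\<^sub>R J k)"
  using assms
proof (induction rule: span_induct_alt)
  case base
  show ?case by (intro exI[of _ "\<lambda>_. 0"]) simp
next
  case (step c x y)
  then obtain k a where "k \<le> 8" "x = J k" "y = (\<Sum>k\<le>8. a k *\<^sub>R J k)"
    by auto
  moreover have "c *\<^sub>R J k = (\<Sum>n\<le>8. (if n = k then c else 0) *\<^sub>R J n)"
    using \<open>k \<le> 8\<close> by (simp add: if_distrib[of "\<lambda>c. c *\<^sub>R _"] cong: if_cong)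
  ultimately have "c *\<^sub>R x + y = (\<Sum>n\<le>8. ((if n = k then c else 0) + a n) *\<^sub>R J n)"
    by (simp add: scaleR_add_left sum.distrib)
  then show ?case by (intro exI[of _ "\<lambda>n. (if n = k then c else 0) + a n"])
qed

lemma linear_matrix_mult_left: "linear (\<lambda>X. X ** A)" for A :: "real ^ 'n::finite ^ 'm::finite"
  by (rule linearI) (simp_all add: matrix_matrix_mult_def vec_eq_iff
      sum_distrib_left algebra_simps sum.distrib)

lemma linear_matrix_mult_right: "linear (\<lambda>X. A ** X)" for A :: "real ^ 'n::finite ^ 'm::finite"
  by (rule linearI) (simp_all add: matrix_matrix_mult_def vec_eq_iff
      sum_distrib_left algebra_simps sum.distrib)

lemmas sum_matrix_mult = linear_sum[OF linear_matrix_mult_left]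
  and matrix_mult_sum = linear_sum[OF linear_matrix_mult_right]
  and scaleR_matrix_mult = linear_scale[OF linear_matrix_mult_left]
  and matrix_mult_scaleR = linear_scale[OF linear_matrix_mult_right]
  and add_matrix_mult = linear_add[OF linear_matrix_mult_left]

lemma clifford_anticommutator:
  assumes "clifford_system h J" "i \<le> 8" "j \<le> 8"
  shows "J i ** J j + J j ** J i = (if i = j then 2 else 0) *\<^sub>R mat 1"
  using assms by (auto simp: clifford_system_def simp flip: scaleR_2)

text \<open>The anticommutator with a basis element reads off a coefficient.\<close>

lemma clifford_anticommutator_sum:
  assumes "clifford_system h J" "l \<le> 8"
  shows "(\<Sum>k\<le>8. a k *\<^sub>R J k) ** J l + J l ** (\<Sum>k\<le>8. a k *\<^sub>R J k) = (2 * a l) *\<^sub>R mat 1"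
proof -
  have "(\<Sum>k\<le>8. a k *\<^sub>R J k) ** J l + J l ** (\<Sum>k\<le>8. a k *\<^sub>R J k) =
      (\<Sum>k\<le>8. a k *\<^sub>R (J k ** J l + J l ** J k))"
    by (simp add: sum_matrix_mult matrix_mult_sum scaleR_add_right sum.distrib
        scaleR_matrix_mult matrix_mult_scaleR)
  also have "\<dots> = (\<Sum>k\<le>8. if k = l then (2 * a l) *\<^sub>R mat 1 else 0)"
    using assms by (intro sum.cong refl) (simp add: clifford_anticommutator)
  finally show ?thesis
    using assms by simp
qed

lemma scaleR_mat_1_eq_iff: "c *\<^sub>R (mat 1 :: End16) = d *\<^sub>R mat 1 \<longleftrightarrow> c = d"
proof -
  have "(mat 1 :: End16) \<noteq> 0"
    by (auto simp: mat_def vec_eq_iff)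
  then show ?thesis by simp
qed

text \<open>Expanding the Clifford relations of one system in the other gives orthonormal rows.
  Columns are obtained by exchanging the roles of the systems.\<close>

lemma clifford_systems_orthogonal:
  assumes J: "clifford_system h J" and K: "clifford_system h' K"
    and span: "span (J ` {..8}) = span (K ` {..8})"
  shows "\<exists>a. (\<forall>i\<le>8. K i = (\<Sum>k\<le>8. a i k *\<^sub>R J k)) \<and>
    (\<forall>i\<le>8. \<forall>j\<le>8. (\<Sum>k\<le>8. a i k * a j k) = (if i = j then 1 else 0)) \<and>
    (\<forall>k\<le>8. \<forall>l\<le>8. (\<Sum>i\<le>8. a i k * a i l) = (if k = l then 1 else 0))"
proof -
  have rows: "(\<Sum>k\<le>8. a i k * a j k) = (if i = j then 1 else 0)"
    if J: "clifford_system h J" and K: "clifford_system h' K"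
      and a: "\<forall>i\<le>8. K i = (\<Sum>k\<le>8. a i k *\<^sub>R J k)" and ij: "i \<le> 8" "j \<le> 8" for h h' J K a i j
  proof -
    have Kj: "K j = (\<Sum>k\<le>8. a j k *\<^sub>R J k)"
      using a ij by simp
    have "(if i = j then 2 else 0) *\<^sub>R mat 1 = K i ** K j + K j ** K i"
      using clifford_anticommutator[OF K ij] by simp
    also have "\<dots> = (\<Sum>k\<le>8. a j k *\<^sub>R (K i ** J k + J k ** K i))"
      by (subst (1 2) Kj) (simp add: sum_matrix_mult matrix_mult_sum scaleR_add_right sum.distrib
          scaleR_matrix_mult matrix_mult_scaleR)
    also have "\<dots> = (\<Sum>k\<le>8. a j k *\<^sub>R ((2 * a i k) *\<^sub>R mat 1))"
      using a ij clifford_anticommutator_sum[OF J] by (intro sum.cong refl) simp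
    also have "\<dots> = (2 * (\<Sum>k\<le>8. a i k * a j k)) *\<^sub>R mat 1"
      by (simp add: sum_distrib_left mult_ac scaleR_left.sum)
    finally show ?thesis
      unfolding scaleR_mat_1_eq_iff by (simp split: if_splits)
  qed
  have "\<exists>c. K i = (\<Sum>k\<le>8. c k *\<^sub>R J k)" if "i \<in> {..8}" for i
  proof (rule in_span_image_atMost)
    show "K i \<in> span (J ` {..8})"
      unfolding span using that by (intro span_base) simp
  qed
  then have "\<forall>i\<in>{..8}. \<exists>c. K i = (\<Sum>k\<le>8. c k *\<^sub>R J k)" ..
  from bchoice[OF this] obtain a where a: "\<forall>i\<le>8. K i = (\<Sum>k\<le>8. a i k *\<^sub>R J k)"
    unfolding Ball_def atMost_iff ..
  have "\<exists>c. J i = (\<Sum>k\<le>8. c k *\<^sub>R K k)" if "i \<in> {..8}" for i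
  proof (rule in_span_image_atMost)
    show "J i \<in> span (K ` {..8})"
      unfolding span[symmetric] using that by (intro span_base) simp
  qed
  then have "\<forall>i\<in>{..8}. \<exists>c. J i = (\<Sum>k\<le>8. c k *\<^sub>R K k)" ..
  from bchoice[OF this] obtain b where b: "\<forall>i\<le>8. J i = (\<Sum>k\<le>8. b i k *\<^sub>R K k)"
    unfolding Ball_def atMost_iff ..
  \<comment> \<open>The anticommutator of \<open>K i\<close> and \<open>J k\<close> computes both
    coefficients, so \<open>b\<close> is the transpose of \<open>a\<close>, and its rows are the
    columns of \<open>a\<close>.\<close>
  have ba: "b k i = a i k" if "i \<le> 8" "k \<le> 8" for i k
  proof -
    have "(2 * a i k) *\<^sub>R mat 1 = K i ** J k + J k ** K i"
      using clifford_anticommutator_sum[OF J that(2)] a that by simp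
    also have "\<dots> = (2 * b k i) *\<^sub>R mat 1"
      using clifford_anticommutator_sum[OF K that(1), of "b k"] b that by (simp add: add.commute)
    finally show ?thesis
      unfolding scaleR_mat_1_eq_iff by simp
  qed
  have "(\<Sum>i\<le>8. a i k * a i l) = (if k = l then 1 else 0)" if "k \<le> 8" "l \<le> 8" for k l
    using rows[OF K J b that] that ba by simp
  then show ?thesis
    using a rows[OF J K a] by blast
qed

lemma quartic_clifford_systems:
  assumes J: "clifford_system (\<bullet>) J" and K: "clifford_system (\<bullet>) K"
    and span: "span (J ` {..8}) = span (K ` {..8})"
  shows "quartic (clifford_form (\<bullet>) (\<lambda>i. (*v) (K i))) v = quartic (clifford_form (\<bullet>) (\<lambda>i. (*v) (J i))) v"
proof -
  obtain a where a: "\<And>i. i \<le> 8 \<Longrightarrow> K i = (\<Sum>k\<le>8. a i k *\<^sub>R J k)"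
    and rows: "\<And>i j. i \<le> 8 \<Longrightarrow> j \<le> 8 \<Longrightarrow> (\<Sum>k\<le>8. a i k * a j k) = (if i = j then 1 else 0)"
    and cols: "\<And>k l. k \<le> 8 \<Longrightarrow> l \<le> 8 \<Longrightarrow> (\<Sum>i\<le>8. a i k * a i l) = (if k = l then 1 else 0)"
    using clifford_systems_orthogonal[OF assms] by blast
  have lin: "linear ((\<bullet>) x)" for x :: R16
    by (simp add: inner_add_right linearI)
  have K_vec: "K i *v y = (\<Sum>k\<le>8. a i k *\<^sub>R (J k *v y))" if "i \<le> 8" for i y
  proof -
    have "linear (\<lambda>A :: End16. A *v y)"
      by (intro linearI) (simp_all add: matrix_vector_mult_add_rdistrib scaleR_matrix_vector_assoc)
    from linear_sum[OF this] show ?thesis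
      by (simp add: a[OF that] scaleR_matrix_vector_assoc)
  qed
  have "clifford_form (\<bullet>) (\<lambda>i. (*v) (K i)) i j x y =
      (\<Sum>k\<le>8. a i k * (\<Sum>l\<le>8. a j l * clifford_form (\<bullet>) (\<lambda>i. (*v) (J i)) k l x y))"
    if ij: "i \<le> 8" "j \<le> 8" for i j x y
  proof -
    have "(\<Sum>k\<le>8. a i k * (\<Sum>l\<le>8. a j l * clifford_form (\<bullet>) (\<lambda>i. (*v) (J i)) k l x y)) =
        (\<Sum>k\<le>8. \<Sum>l\<le>8. a i k * a j l * (x \<bullet> (J k *v (J l *v y))) - (if k = l then a i k * a j l * (x \<bullet> y) else 0))"
      unfolding sum_distrib_left
      by (intro sum.cong refl) (simp add: clifford_form_eq[OF J lin] algebra_simps)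
    also have "\<dots> = (\<Sum>k\<le>8. \<Sum>l\<le>8. a i k * a j l * (x \<bullet> (J k *v (J l *v y)))) -
        (\<Sum>k\<le>8. a i k * a j k) * (x \<bullet> y)"
      by (simp add: sum_subtractf sum_distrib_right)
    also have "(\<Sum>k\<le>8. \<Sum>l\<le>8. a i k * a j l * (x \<bullet> (J k *v (J l *v y)))) = x \<bullet> (K i *v (K j *v y))"
      using ij by (subst sum.swap) (simp add: K_vec linear_sum[OF matrix_vector_mul_linear] inner_sum_right
          sum_distrib_left matrix_vector_mult_scaleR mult_ac)
    finally show ?thesis
      using ij by (simp add: clifford_form_eq[OF K lin] rows)
  qed
  then show ?thesis
    by (intro quartic_orthogonal[of a] cols)
qed

section \<open>The invariant form on the spin representation\<close>

text \<open>Clifford systems are pulled back along the isometry \<open>U\<close> with inverse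
  \<open>V\<close>; this serves for frames and for unit vectors acting by Clifford
  multiplication.\<close>

lemma clifford_system_conj:
  assumes I: "clifford_system h I" and UV: "U ** V = mat 1" "V ** U = mat 1"
    and h: "\<And>x y. h (U *v x) (U *v y) = h' x y"
  shows "clifford_system h' (\<lambda>k. V ** I k ** U)"
  unfolding clifford_system_def
proof (intro conjI allI impI)
  have mult: "(V ** A ** U) ** (V ** B ** U) = V ** (A ** B) ** U" for A B :: End16
  proof -
    have "(V ** A ** U) ** (V ** B ** U) = V ** A ** (U ** V) ** B ** U"
      by (simp only: matrix_mul_assoc)
    then show ?thesis
      by (simp add: UV matrix_mul_assoc)
  qed
  fix i j :: nat assume "i \<le> 8" "j \<le> 8" "i \<noteq> j"
  then have "V ** (I i ** I j + I j ** I i) ** U = 0"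
    using I by (auto simp: clifford_system_def linear_0[OF linear_matrix_mult_left]
        linear_0[OF linear_matrix_mult_right])
  then show "V ** I i ** U ** (V ** I j ** U) + V ** I j ** U ** (V ** I i ** U) = 0"
    by (simp add: mult matrix_add_ldistrib add_matrix_mult)
next
  fix i :: nat assume i: "i \<le> 8"
  have "V ** I i ** U ** (V ** I i ** U) = V ** I i ** (U ** V) ** I i ** U"
    by (simp only: matrix_mul_assoc)
  also have "\<dots> = V ** (I i ** I i) ** U"
    by (simp add: UV matrix_mul_assoc)
  finally show "V ** I i ** U ** (V ** I i ** U) = mat 1"
    using I i UV by (simp add: clifford_system_def)
  have "trace (V ** I i ** U) = trace (U ** V ** I i)"
    by (metis matrix_mul_assoc trace_mul_sym)
  then show "trace (V ** I i ** U) = 0"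
    using I i UV by (simp add: clifford_system_def)
  fix v w
  have "U *v (V ** I i ** U *v v) = I i *v (U *v v)" for v
    by (simp add: matrix_vector_mul_assoc matrix_mul_assoc UV)
  then show "h' (V ** I i ** U *v v) w = h' v (V ** I i ** U *v w)"
    using I i by (simp add: clifford_system_def flip: h)
qed

lemma clifford_gen_anticommutator_mult:
  assumes "k \<le> 8"
  shows "clifford_mult x ** clifford_gen k + clifford_gen k ** clifford_mult x = (2 * x k) *\<^sub>R mat 1"
  unfolding clifford_mult_def by (rule clifford_anticommutator_sum[OF clifford_system_gen assms])

lemma clifford_mult_square:
  assumes "(\<Sum>i\<le>8. (x i)\<^sup>2) = 1"
  shows "clifford_mult x ** clifford_mult x = mat 1"
proof -
  have x: "clifford_mult x = (\<Sum>i\<le>8. x i *\<^sub>R clifford_gen i)"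
    by (simp add: clifford_mult_def)
  have "clifford_mult x ** clifford_mult x = (\<Sum>k\<le>8. x k *\<^sub>R (clifford_mult x ** clifford_gen k))"
    by (subst (2) x) (simp add: matrix_mult_sum matrix_mult_scaleR)
  moreover have "clifford_mult x ** clifford_mult x = (\<Sum>k\<le>8. x k *\<^sub>R (clifford_gen k ** clifford_mult x))"
    by (subst (1) x) (simp add: sum_matrix_mult scaleR_matrix_mult)
  \<comment> \<open>Adding the expansions of the right and the left factor produces
    anticommutators.\<close>
  ultimately have "2 *\<^sub>R (clifford_mult x ** clifford_mult x) =
      (\<Sum>k\<le>8. x k *\<^sub>R (clifford_mult x ** clifford_gen k + clifford_gen k ** clifford_mult x))"
    by (simp add: scaleR_2 scaleR_add_right sum.distrib)
  also have "\<dots> = (\<Sum>k\<le>8. (2 * (x k)\<^sup>2) *\<^sub>R mat 1)"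
    by (intro sum.cong refl) (simp add: clifford_gen_anticommutator_mult power2_eq_square)
  also have "\<dots> = 2 *\<^sub>R mat 1"
    by (simp flip: scaleR_left.sum sum_distrib_left add: assms)
  finally show ?thesis by simp
qed

lemma clifford_mult_symmetric: "(clifford_mult x *v v) \<bullet> w = v \<bullet> (clifford_mult x *v w)"
  using clifford_system_gen
  by (simp add: clifford_mult_vec inner_sum_left inner_sum_right clifford_system_def)

text \<open>Up to sign, conjugation by a unit vector \<open>x\<close> is the reflection in the
  hyperplane orthogonal to \<open>x\<close>.\<close>

lemma clifford_mult_reflection:
  assumes x: "(\<Sum>i\<le>8. (x i)\<^sup>2) = 1" and k: "k \<le> 8"
  shows "clifford_mult x ** clifford_gen k ** clifford_mult x = (2 * x k) *\<^sub>R clifford_mult x - clifford_gen k"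
proof -
  have "clifford_mult x ** clifford_gen k = (2 * x k) *\<^sub>R mat 1 - clifford_gen k ** clifford_mult x"
    using clifford_gen_anticommutator_mult[OF k, of x] by (simp add: eq_diff_eq)
  then have "clifford_mult x ** clifford_gen k ** clifford_mult x =
      ((2 * x k) *\<^sub>R mat 1) ** clifford_mult x - clifford_gen k ** clifford_mult x ** clifford_mult x"
    by (simp add: linear_diff[OF linear_matrix_mult_left])
  also have "\<dots> = (2 * x k) *\<^sub>R clifford_mult x - clifford_gen k"
    by (simp add: scaleR_matrix_mult clifford_mult_square[OF x] flip: matrix_mul_assoc)
  finally show ?thesis .
qed

abbreviation gen_form :: "nat \<Rightarrow> nat \<Rightarrow> R16 \<Rightarrow> R16 \<Rightarrow> real" where
  "gen_form \<equiv> clifford_form (\<bullet>) (\<lambda>i. (*v) (clifford_gen i))"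

definition standard_form :: "R16 form" where
  "standard_form v = alternation 8 (quartic gen_form) v / 16"

text \<open>Conjugating the generators by a unit vector yields another Clifford system with the same
  span, so independence of the basis gives invariance, already under a single unit vector.\<close>

lemma quartic_clifford_mult:
  assumes x: "(\<Sum>i\<le>8. (x i)\<^sup>2) = 1"
  shows "quartic gen_form (\<lambda>i. clifford_mult x *v v i) = quartic gen_form v"
proof -
  let ?X = "clifford_mult x" and ?K = "\<lambda>k. clifford_mult x ** clifford_gen k ** clifford_mult x"
  have X: "?X ** ?X = mat 1"
    by (rule clifford_mult_square[OF x])
  have iso: "(?X *v v) \<bullet> (?X *v w) = v \<bullet> w" for v w
    by (simp add: clifford_mult_symmetric matrix_vector_mul_assoc X)
  have K: "clifford_system (\<bullet>) ?K"
    by (rule clifford_system_conj[OF clifford_system_gen X X iso])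
  have mult_in: "?X \<in> span (clifford_gen ` {..8})"
    unfolding clifford_mult_def by (intro span_sum span_scale span_base) auto
  have K_in: "?K k \<in> span (clifford_gen ` {..8})" if "k \<le> 8" for k
    unfolding clifford_mult_reflection[OF x that]
    using that by (intro span_diff span_scale mult_in) (auto intro: span_base)
  have gen_K: "clifford_gen k = ?X ** ?K k ** ?X" for k
  proof -
    have "?X ** ?K k ** ?X = (?X ** ?X) ** clifford_gen k ** (?X ** ?X)"
      by (simp only: matrix_mul_assoc)
    then show ?thesis by (simp add: X)
  qed
  have X_in: "?X \<in> span (?K ` {..8})"
  proof -
    \<comment> \<open>Expanding the middle factor shows that \<open>?X\<close> has the same
      coordinates in the conjugated basis.\<close>
    have "?X = ?X ** ?X ** ?X"
      by (simp add: X)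
    also have "\<dots> = (\<Sum>k\<le>8. x k *\<^sub>R ?K k)"
      by (subst (2) clifford_mult_def)
        (simp add: sum_matrix_mult matrix_mult_sum scaleR_matrix_mult matrix_mult_scaleR)
    finally show ?thesis
      by (metis (no_types, lifting) atMost_iff image_eqI span_base span_scale span_sum)
  qed
  have "span (clifford_gen ` {..8}) = span (?K ` {..8})"
  proof (intro subset_antisym span_minimal subspace_span image_subsetI)
    fix k assume k: "k \<in> {..8::nat}"
    have eq: "clifford_gen k = (2 * x k) *\<^sub>R ?X - ?K k"
      using k by (simp add: clifford_mult_reflection[OF x])
    show "clifford_gen k \<in> span (?K ` {..8})"
      by (subst eq) (intro span_diff span_scale X_in span_base imageI k)
  qed (use K_in in simp)
  then have "quartic gen_form v = quartic (clifford_form (\<bullet>) (\<lambda>i. (*v) (?K i))) v"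
    by (rule quartic_clifford_systems[OF clifford_system_gen K, symmetric])
  also have "\<dots> = quartic gen_form (\<lambda>i. ?X *v v i)"
  proof (rule quartic_cong[symmetric], rule clifford_form_intertwine)
    show "clifford_gen k *v (?X *v y) = ?X *v (?K k *v y)" for k y
      by (simp add: matrix_vector_mul_assoc matrix_mul_assoc X)
  qed (simp_all add: iso)
  finally show ?thesis ..
qed

lemma standard_form_clifford_mult:
  assumes "(\<Sum>i\<le>8. (x i)\<^sup>2) = 1"
  shows "standard_form (\<lambda>i. clifford_mult x *v v i) = standard_form v"
  using quartic_clifford_mult[OF assms, of "v \<circ> _"]
  by (simp add: standard_form_def alternation_def comp_def)

lemma spin9_invariant_standard_form: "spin9_invariant standard_form"
  unfolding spin9_invariant_def
proof (intro ballI allI)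
  fix h v assume "h \<in> spin9"
  then show "standard_form (\<lambda>i. h *v v i) = standard_form v"
  proof (induction rule: spin9.induct)
    case (mult h x y)
    have "standard_form (\<lambda>i. clifford_mult x ** clifford_mult y ** h *v v i) =
        standard_form (\<lambda>i. clifford_mult x *v (clifford_mult y *v (h *v v i)))"
      by (simp add: matrix_vector_mul_assoc matrix_mul_assoc)
    then show ?case
      using mult by (simp add: standard_form_clifford_mult)
  qed simp
qed

lemma linear_gen_form: "linear (gen_form i j x)" "linear (\<lambda>x. gen_form i j x y)"
  by (auto intro!: linearI simp: clifford_form_def inner_add_left inner_add_right
      matrix_vector_right_distrib matrix_vector_mult_scaleR algebra_simps)

lemma alternating_standard_form: "alternating_form 8 standard_form"
proof -
  have "alternating_form 8 (alternation 8 (\<lambda>v. quartic gen_form v / 16))"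
  proof (rule alternating_form_alternation)
    fix v w :: "nat \<Rightarrow> R16" assume "\<And>i. i < 8 \<Longrightarrow> v i = w i"
    then show "quartic gen_form v / 16 = quartic gen_form w / 16"
      by (simp add: quartic_def)
  next
    have mult: "linear (\<lambda>x. f x * c)" if "linear f" for f :: "R16 \<Rightarrow> real" and c
      using linear_cmult[OF that, of c] by (simp add: mult.commute)
    have divide: "linear (\<lambda>x. f x / c)" if "linear f" for f :: "R16 \<Rightarrow> real" and c
      using mult[OF that, of "inverse c"] by (simp add: divide_inverse)
    fix v :: "nat \<Rightarrow> R16" and i :: nat assume "i < 8"
    then have "i \<in> {0,1,2,3,4,5,6,7}" by auto
    then show "linear (\<lambda>x. quartic gen_form (v(i := x)) / 16)"
      unfolding quartic_def
      apply (elim insertE emptyE)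
      apply simp_all
      apply ((rule divide | (rule linear_compose_sum, rule ballI) | rule linear_cmult | rule mult | rule linear_gen_form)+)
      done
  qed
  moreover have "alternation 8 (\<lambda>v. quartic gen_form v / 16) = standard_form"
    using alternation_cmult[of 8 "1 / 16" "quartic gen_form"] by (auto simp: standard_form_def)
  ultimately show ?thesis by simp
qed

section \<open>Non-vanishing and uniqueness\<close>

text \<open>A computable stand-in for the inner product of two signed basis vectors.\<close>

definition delta :: "int \<Rightarrow> int \<Rightarrow> int" where
  "delta a b = (if a = b then 1 else if a = - b then - 1 else 0)"

lemma delta_minus: "b \<noteq> 0 \<Longrightarrow> delta a (- b) = - delta a b"
  by (auto simp: delta_def)

lemma signed_basis_index_inj:
  assumes "x \<in> {1..16}" "y \<in> {1..16}" "odd ((x - 1) div 8) = odd ((y - 1) div 8)"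
    "odd ((x - 1) div 4) = odd ((y - 1) div 4)" "odd ((x - 1) div 2) = odd ((y - 1) div 2)"
    "odd (x - 1) = odd (y - 1)"
  shows "x = (y :: int)"
proof -
  have "\<forall>x\<in>set [1..16]. \<forall>y\<in>set [1..16]. odd ((x - 1) div 8) = odd ((y - 1) div 8) \<and>
      odd ((x - 1) div 4) = odd ((y - 1) div 4) \<and> odd ((x - 1) div 2) = odd ((y - 1) div 2) \<and>
      odd (x - 1) = odd (y - 1) \<longrightarrow> x = (y :: int)"
    by code_simp
  from bspec[OF bspec[OF this[unfolded set_upto] assms(1)] assms(2)] show ?thesis
    using assms(3-) by (elim mp) (intro conjI)
qed

lemma inner_signed_basis:
  assumes "\<bar>a\<bar> \<in> {1..16}" "\<bar>b\<bar> \<in> {1..16}"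
  shows "signed_basis a \<bullet> signed_basis b = of_int (delta a b)"
proof -
  have "signed_basis a \<bullet> signed_basis b = of_int (sgn a * sgn b) * (if \<bar>a\<bar> = \<bar>b\<bar> then 1 else 0)"
    using signed_basis_index_inj[OF assms]
    by (simp add: signed_basis_def inner_axis_axis del: even_diff)
  also have "\<dots> = of_int (delta a b)"
    using assms by (auto simp: delta_def sgn_if abs_if split: if_splits)
  finally show ?thesis .
qed

text \<open>By symmetry of I_i, the form is the inner product of I_i x and I_j y; the diagonal
  correction vanishes because the two basis vectors are orthogonal.\<close>

lemma gen_form_signed_basis:
  assumes "i \<le> 8" "j \<le> 8" "x \<in> {1..8}" "y \<in> {1..8}" "x \<noteq> y"
  shows "gen_form i j (signed_basis x) (signed_basis y) = of_int (delta (act (gens ! i) x) (act (gens ! j) y))"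
proof -
  have lin: "linear ((\<bullet>) v)" for v :: R16
    by (simp add: inner_add_right linearI)
  have x: "\<bar>x\<bar> \<in> {1..16}" and y: "\<bar>y\<bar> \<in> {1..16}"
    using assms by auto
  have "gen_form i j (signed_basis x) (signed_basis y) =
      (clifford_gen i *v signed_basis x) \<bullet> (clifford_gen j *v signed_basis y) -
      (if i = j then signed_basis x \<bullet> signed_basis y else 0)"
    using clifford_system_gen assms(1)
    by (simp add: clifford_form_eq[OF clifford_system_gen lin assms(1,2)] clifford_system_def)
  moreover have "signed_basis x \<bullet> signed_basis y = 0"
    using inner_signed_basis[OF x y] assms by (auto simp: delta_def)
  ultimately show ?thesis
    using monomial_act[OF monomial_clifford_gen[OF assms(1)] x]
      monomial_act[OF monomial_clifford_gen[OF assms(2)] y] by (simp add: inner_signed_basis)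
qed

section \<open>Antisymmetry of the contraction on the first block\<close>

lemma gen_form_skew:
  assumes "i \<le> 8" "j \<le> 8"
  shows "gen_form i j x y = - gen_form i j y x"
proof -
  have "x \<bullet> (clifford_gen a *v (clifford_gen b *v y)) = (clifford_gen b *v (clifford_gen a *v x)) \<bullet> y"
    if "a \<le> 8" "b \<le> 8" for a b
    using clifford_system_gen that by (simp add: clifford_system_def)
  moreover have "clifford_gen j *v (clifford_gen i *v x) = - (clifford_gen i *v (clifford_gen j *v x))"
    if "i \<noteq> j" for x
  proof -
    have "(clifford_gen i ** clifford_gen j + clifford_gen j ** clifford_gen i) *v x = 0"
      using clifford_system_gen assms that by (simp add: clifford_system_def)
    then show ?thesis
      by (simp add: matrix_vector_mult_add_rdistrib matrix_vector_mul_assoc eq_neg_iff_add_eq_0 add.commute)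
  qed
  ultimately show ?thesis
    using assms by (auto simp: clifford_form_def inner_commute[of _ y])
qed

lemma clifford_form_swap_indices: "clifford_form h J j i x y = - clifford_form h J i j x y"
  by (auto simp: clifford_form_def)

text \<open>The entry at (p, q) of R_x R_z^T in the notation of the overview, for \<open>p\<close>
  and \<open>q\<close> in the second block.\<close>

definition delta_sum :: "int \<Rightarrow> int \<Rightarrow> int \<Rightarrow> int \<Rightarrow> int" where
  "delta_sum x z p q = (\<Sum>g\<leftarrow>gens. delta (act g x) p * delta (act g z) q)"

text \<open>For \<open>x, y\<close> in the first block, \<open>x \<perp> y\<close>, the maps \<open>i \<mapsto> I\<^sub>i x\<close> are orthogonal and
  \<open>R\<^sub>x R\<^sub>y\<^sup>T + R\<^sub>y R\<^sub>x\<^sup>T = 0\<close>; this is the same relation on the basis vectors.\<close>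

lemma delta_sum_table:
  "\<forall>x\<in>set [1..8]. \<forall>z\<in>set [1..8]. x \<noteq> z \<longrightarrow> (\<forall>p\<in>set [9..16]. \<forall>q\<in>set [9..16].
     delta_sum x z p q = - delta_sum z x p q)"
  by code_simp

lemma gen_form_exchange:
  assumes inj: "distinct [x, z, y, w]" "{x, z, y, w} \<subseteq> {1..8}" and jj': "j \<le> 8" "j' \<le> 8"
  shows "(\<Sum>i\<le>8. gen_form i j (signed_basis x) (signed_basis y) * gen_form i j' (signed_basis z) (signed_basis w)) =
    - (\<Sum>i\<le>8. gen_form i j (signed_basis z) (signed_basis y) * gen_form i j' (signed_basis x) (signed_basis w))"
proof -
  define p where "p = act (gens ! j) y"
  define q where "q = act (gens ! j') w"
  have sum: "(\<Sum>i\<le>8. gen_form i j (signed_basis a) (signed_basis y) * gen_form i j' (signed_basis b) (signed_basis w)) =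
      of_int (delta_sum a b p q)" if "a \<in> {1..8}" "b \<in> {1..8}" "a \<noteq> y" "b \<noteq> w" for a b
  proof -
    have "(\<Sum>i\<le>8. gen_form i j (signed_basis a) (signed_basis y) * gen_form i j' (signed_basis b) (signed_basis w)) =
        of_int (\<Sum>i\<le>8. delta (act (gens ! i) a) p * delta (act (gens ! i) b) q)"
      using that inj jj' by (simp add: gen_form_signed_basis p_def q_def)
    also have "(\<Sum>i\<le>8. delta (act (gens ! i) a) p * delta (act (gens ! i) b) q) = delta_sum a b p q"
    proof -
      have "length gens = 9"
        by (simp add: gens_def)
      then show ?thesis
        unfolding delta_sum_def sum_list_sum_nth by (intro sum.cong) auto
    qed
    finally show ?thesis .
  qed
  have "delta_sum x z p q = - delta_sum z x p q"
  \<comment> \<open>I_8 fixes the first block, and the other generators map it to the second. If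
    \<open>j\<close> or \<open>j'\<close> is 8, every product vanishes by orthogonality; otherwise
    \<open>p\<close> and \<open>q\<close> lie in the range of the table up to sign.\<close>
  proof (cases "j = 8 \<or> j' = 8")
    case True
    have "\<forall>a\<in>set [1..8]. \<forall>b\<in>set [1..8]. a \<noteq> b \<longrightarrow> (\<forall>g\<in>set gens. delta (act g a) (act (gens ! 8) b) = 0)"
      by code_simp
    then have zero: "delta (act g a) (act (gens ! 8) b) = 0"
      if "g \<in> set gens" "a \<in> {1..8}" "b \<in> {1..8}" "a \<noteq> b" for g a b
      using that unfolding set_upto by blast
    have "delta_sum a b p q = 0" if "a \<in> {x, z}" "b \<in> {x, z}" for a b
    proof -
      have "delta (act g a) p * delta (act g b) q = 0" if "g \<in> set gens" for g
        using True zero[OF that, of a y] zero[OF that, of b w] inj \<open>a \<in> _\<close> \<open>b \<in> _\<close>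
        by (auto simp: p_def q_def)
      then have eq: "map (\<lambda>g. delta (act g a) p * delta (act g b) q) gens = map (\<lambda>_. 0) gens"
        by (intro map_cong refl)
      then show ?thesis
        unfolding delta_sum_def eq by simp
    qed
    then show ?thesis by simp
  next
    case False
    have table: "\<forall>k\<in>set [0..<8]. \<forall>b\<in>set [1..8]. 9 \<le> \<bar>act (gens ! k) b\<bar> \<and> \<bar>act (gens ! k) b\<bar> \<le> 16"
      by code_simp
    have "\<bar>act (gens ! k) b\<bar> \<in> {9..16}" if "k < 8" "b \<in> {1..8}" for k b
      using bspec[OF bspec[OF table[unfolded set_upto set_upt]], of k b] that by simp
    then have pq: "\<bar>p\<bar> \<in> {9..16}" "\<bar>q\<bar> \<in> {9..16}"
      using False jj' inj by (simp_all add: p_def q_def)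
    \<comment> \<open>The table lists positive indices only; the signs of \<open>p\<close> and
      \<open>q\<close> factor out.\<close>
    have sgn: "\<exists>s. \<forall>c. delta c r = s * delta c \<bar>r\<bar>" if "r \<noteq> 0" for r
    proof (cases "r < 0")
      case True
      then show ?thesis
        using delta_minus[of "- r"] by (intro exI[of _ "- 1"]) simp
    qed (intro exI[of _ 1], simp)
    have "p \<noteq> 0" "q \<noteq> 0"
      using pq by auto
    then obtain s t where st: "\<And>c. delta c p = s * delta c \<bar>p\<bar>" "\<And>c. delta c q = t * delta c \<bar>q\<bar>"
      using sgn by meson
    have "delta_sum a b p q = s * t * delta_sum a b \<bar>p\<bar> \<bar>q\<bar>" for a b
    proof -
      have "delta_sum a b p q = (\<Sum>g\<leftarrow>gens. (s * t) * (delta (act g a) \<bar>p\<bar> * delta (act g b) \<bar>q\<bar>))"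
        unfolding delta_sum_def st by (simp only: mult_ac)
      then show ?thesis
        by (simp only: sum_list_const_mult delta_sum_def)
    qed
    moreover have "delta_sum x z \<bar>p\<bar> \<bar>q\<bar> = - delta_sum z x \<bar>p\<bar> \<bar>q\<bar>"
    proof -
      have xz: "x \<in> {1..8}" "z \<in> {1..8}" "x \<noteq> z"
        using inj by auto
      note mp[OF bspec[OF bspec[OF delta_sum_table[unfolded set_upto] xz(1)] xz(2)] xz(3)]
      from bspec[OF bspec[OF this pq(1)] pq(2)] show ?thesis .
    qed
    ultimately show ?thesis by simp
  qed
  then show ?thesis
    using sum[of x z] sum[of z x] inj by simp
qed

text \<open>Exchanging the names of \<open>i\<close> and \<open>i'\<close> exchanges the first four
  slots with the last four.\<close>

lemma quartic_swap_upper: "quartic w v = quartic w (\<lambda>k. v ([4, 5, 6, 7, 0, 1, 2, 3] ! k))"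
proof -
  have "quartic w v = (\<Sum>i\<le>8. \<Sum>i'\<le>8. \<Sum>j\<le>8. \<Sum>j'\<le>8.
      w i j (v 0) (v 1) * w i j' (v 2) (v 3) * w i' j (v 4) (v 5) * w i' j' (v 6) (v 7))"
    unfolding quartic_def by (intro sum.cong refl sum.swap)
  also have "\<dots> = (\<Sum>i'\<le>8. \<Sum>i\<le>8. \<Sum>j\<le>8. \<Sum>j'\<le>8.
      w i j (v 0) (v 1) * w i j' (v 2) (v 3) * w i' j (v 4) (v 5) * w i' j' (v 6) (v 7))"
    by (rule sum.swap)
  also have "\<dots> = (\<Sum>i'\<le>8. \<Sum>j\<le>8. \<Sum>i\<le>8. \<Sum>j'\<le>8.
      w i' j (v 4) (v 5) * w i' j' (v 6) (v 7) * w i j (v 0) (v 1) * w i j' (v 2) (v 3))"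
    by (rule sum.cong[OF refl], subst sum.swap) (simp add: mult_ac)
  finally show ?thesis
    by (simp add: quartic_def)
qed

text \<open>Four sign changes cancel, and the roles of the first and second indices are
  interchanged.\<close>

lemma quartic_transpose_indices:
  assumes w: "\<And>i j x y. w j i x y = - w i j x y"
  shows "quartic w v = quartic w (\<lambda>k. v ([0, 1, 4, 5, 2, 3, 6, 7] ! k))"
proof -
  have "w i j a b * w i j' c d * w i' j e f * w i' j' g h =
      w j i a b * w j' i c d * w j i' e f * w j' i' g h" for i j i' j' a b c d e f g h
    by (simp add: w[of i j] w[of i j'] w[of i' j] w[of i' j'])
  then have "quartic w v = (\<Sum>i\<le>8. \<Sum>j\<le>8. \<Sum>i'\<le>8. \<Sum>j'\<le>8.
      w j i (v 0) (v 1) * w j' i (v 2) (v 3) * w j i' (v 4) (v 5) * w j' i' (v 6) (v 7))"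
    unfolding quartic_def
    by (intro sum.cong refl)
  also have "\<dots> = (\<Sum>j\<le>8. \<Sum>i\<le>8. \<Sum>i'\<le>8. \<Sum>j'\<le>8.
      w j i (v 0) (v 1) * w j' i (v 2) (v 3) * w j i' (v 4) (v 5) * w j' i' (v 6) (v 7))"
    by (rule sum.swap)
  also have "\<dots> = (\<Sum>j\<le>8. \<Sum>i\<le>8. \<Sum>j'\<le>8. \<Sum>i'\<le>8.
      w j i (v 0) (v 1) * w j i' (v 4) (v 5) * w j' i (v 2) (v 3) * w j' i' (v 6) (v 7))"
    by (rule sum.cong[OF refl], rule sum.cong[OF refl], subst sum.swap) (simp add: mult_ac)
  finally show ?thesis
    by (simp add: quartic_def)
qed

lemma quartic_eq_inner:
  "quartic w v = (\<Sum>j\<le>8. \<Sum>i'\<le>8. \<Sum>j'\<le>8.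
     (\<Sum>i\<le>8. w i j (v 0) (v 1) * w i j' (v 2) (v 3)) * (w i' j (v 4) (v 5) * w i' j' (v 6) (v 7)))"
proof -
  have "quartic w v = (\<Sum>j\<le>8. \<Sum>i\<le>8. \<Sum>i'\<le>8. \<Sum>j'\<le>8.
      w i j (v 0) (v 1) * w i j' (v 2) (v 3) * (w i' j (v 4) (v 5) * w i' j' (v 6) (v 7)))"
    unfolding quartic_def mult.assoc by (rule sum.swap)
  also have "\<dots> = (\<Sum>j\<le>8. \<Sum>i'\<le>8. \<Sum>j'\<le>8. \<Sum>i\<le>8.
      w i j (v 0) (v 1) * w i j' (v 2) (v 3) * (w i' j (v 4) (v 5) * w i' j' (v 6) (v 7)))"
    by (rule sum.cong[OF refl], subst sum.swap, rule sum.cong[OF refl], rule sum.swap)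
  finally show ?thesis
    by (simp add: sum_distrib_right)
qed

text \<open>Index tuples of orthonormal vectors of the first block, on which \<open>quartic gen_form\<close> is already
  alternating.\<close>

definition block_tuple :: "(nat \<Rightarrow> int) \<Rightarrow> bool" where
  "block_tuple m \<longleftrightarrow> inj_on m {..<8} \<and> m ` {..<8} \<subseteq> {1..8}"

definition block_quartic :: "(nat \<Rightarrow> int) \<Rightarrow> real" where
  "block_quartic m = quartic gen_form (\<lambda>k. signed_basis (m k))"

definition odd_swap :: "nat \<Rightarrow> nat \<Rightarrow> bool" where
  "odd_swap a b \<longleftrightarrow> a < 8 \<and> b < 8 \<and> a \<noteq> b \<and>
     (\<forall>m. block_tuple m \<longrightarrow> block_quartic (m \<circ> Transposition.transpose a b) = - block_quartic m)"

lemma block_tuple_permute: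
  assumes "block_tuple m" "\<sigma> permutes {..<8}"
  shows "block_tuple (m \<circ> \<sigma>)"
  using assms permutes_inj_on[OF assms(2)] permutes_image[OF assms(2)]
  by (auto simp: block_tuple_def comp_inj_on image_comp[symmetric])

lemma block_quartic_cong: "(\<And>k. k < 8 \<Longrightarrow> m k = m' k) \<Longrightarrow> block_quartic m = block_quartic m'"
  by (simp add: block_quartic_def quartic_def)

lemma odd_swap_sym: "odd_swap a b \<Longrightarrow> odd_swap b a"
  by (auto simp: odd_swap_def transpose_commute)

text \<open>(a c) = (a b)(b c)(a b) has three odd factors. It is therefore enough that the odd
  transpositions connect all slots.\<close>

lemma odd_swap_trans:
  assumes ab: "odd_swap a b" and bc: "odd_swap b c" and ac: "a \<noteq> c"
  shows "odd_swap a c"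
  unfolding odd_swap_def
proof (intro conjI allI impI)
  let ?t = "Transposition.transpose :: nat \<Rightarrow> nat \<Rightarrow> nat \<Rightarrow> nat"
  have lt: "a < 8" "b < 8" "c < 8" "b \<noteq> c"
    using ab bc by (auto simp: odd_swap_def)
  then show "a < 8" "c < 8" "a \<noteq> c"
    using ac by auto
  fix m assume m: "block_tuple m"
  have perm: "?t a b permutes {..<8}" "?t b c permutes {..<8}"
    using lt by (simp_all add: permutes_swap_id)
  have "?t a c = ?t a b \<circ> ?t b c \<circ> ?t a b"
    using ac lt by (intro transpose_comp_triple[symmetric]) auto
  then have "block_quartic (m \<circ> ?t a c) = block_quartic (((m \<circ> ?t a b) \<circ> ?t b c) \<circ> ?t a b)"
    by (simp add: comp_assoc)
  also have "\<dots> = - block_quartic m"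
    using ab bc m block_tuple_permute perm by (simp add: odd_swap_def)
  finally show "block_quartic (m \<circ> ?t a c) = - block_quartic m" .
qed

lemma odd_swap_within_pair: "odd_swap 0 1" "odd_swap 2 3" "odd_swap 4 5" "odd_swap 6 7"
proof -
  have eq: "quartic gen_form v = - quartic gen_form u"
    if "\<And>i j i' j'. i \<le> 8 \<Longrightarrow> j \<le> 8 \<Longrightarrow> i' \<le> 8 \<Longrightarrow> j' \<le> 8 \<Longrightarrow>
      gen_form i j (v 0) (v 1) * gen_form i j' (v 2) (v 3) * gen_form i' j (v 4) (v 5) * gen_form i' j' (v 6) (v 7) =
      - (gen_form i j (u 0) (u 1) * gen_form i j' (u 2) (u 3) * gen_form i' j (u 4) (u 5) * gen_form i' j' (u 6) (u 7))"
    for v u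
    unfolding quartic_def sum_negf[symmetric] using that by (intro sum.cong refl) simp
  show "odd_swap 0 1" "odd_swap 2 3" "odd_swap 4 5" "odd_swap 6 7"
    unfolding odd_swap_def block_quartic_def
    using gen_form_skew[of _ _ "signed_basis (m 1)" "signed_basis (m 0)" for m :: "nat \<Rightarrow> int"]
      gen_form_skew[of _ _ "signed_basis (m 3)" "signed_basis (m 2)" for m :: "nat \<Rightarrow> int"]
      gen_form_skew[of _ _ "signed_basis (m 5)" "signed_basis (m 4)" for m :: "nat \<Rightarrow> int"]
      gen_form_skew[of _ _ "signed_basis (m 7)" "signed_basis (m 6)" for m :: "nat \<Rightarrow> int"]
    by (auto intro!: eq simp: Transposition.transpose_def)
qed

lemma odd_swap_0_2: "odd_swap 0 2"
  unfolding odd_swap_def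
proof (intro conjI allI impI)
  fix m assume m: "block_tuple m"
  then have inj: "inj_on m {..<8}" and "{m 0, m 2, m 1, m 3} \<subseteq> {1..8}"
    by (auto simp: block_tuple_def image_subset_iff)
  moreover have "distinct [m 0, m 2, m 1, m 3]"
    by (simp add: inj_on_eq_iff[OF inj])
  ultimately have neg: "(\<Sum>i\<le>8. gen_form i j (signed_basis (m 2)) (signed_basis (m 1)) *
        gen_form i j' (signed_basis (m 0)) (signed_basis (m 3))) =
      - (\<Sum>i\<le>8. gen_form i j (signed_basis (m 0)) (signed_basis (m 1)) *
        gen_form i j' (signed_basis (m 2)) (signed_basis (m 3)))" if "j \<le> 8" "j' \<le> 8" for j j'
    using gen_form_exchange[of "m 0" "m 2" "m 1" "m 3" j j'] that by simp
  show "block_quartic (m \<circ> Transposition.transpose 0 2) = - block_quartic m"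
    unfolding block_quartic_def quartic_eq_inner sum_negf[symmetric]
    by (intro sum.cong refl) (simp add: Transposition.transpose_def neg[simplified])
qed auto

text \<open>A slot permutation preserving \<open>block_quartic\<close> conjugates odd transpositions
  to odd transpositions.\<close>

lemma odd_swap_transport:
  assumes \<rho>: "\<And>m. block_quartic m = block_quartic (\<lambda>k. m (\<rho> ! k))"
    and len: "length \<rho> = 8" "distinct \<rho>" "set \<rho> \<subseteq> {..<8}" and ab: "odd_swap a b"
  shows "odd_swap (\<rho> ! a) (\<rho> ! b)"
  unfolding odd_swap_def
proof (intro conjI allI impI)
  have lt: "a < 8" "b < 8" "a \<noteq> b"
    using ab by (auto simp: odd_swap_def)
  then show "\<rho> ! a < 8" "\<rho> ! b < 8" "\<rho> ! a \<noteq> \<rho> ! b"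
    using len nth_mem[of _ \<rho>] by (force, force, simp add: nth_eq_iff_index_eq)
  fix m assume m: "block_tuple m"
  have "block_tuple (\<lambda>k. m (\<rho> ! k))"
    using m len nth_mem[of _ \<rho>] unfolding block_tuple_def inj_on_def image_subset_iff
    by (metis lessThan_iff nth_eq_iff_index_eq subsetD)
  moreover have "block_quartic (m \<circ> Transposition.transpose (\<rho> ! a) (\<rho> ! b)) =
      block_quartic ((\<lambda>k. m (\<rho> ! k)) \<circ> Transposition.transpose a b)"
    unfolding \<rho>[of "m \<circ> _"] using lt len
    by (intro block_quartic_cong) (auto simp: Transposition.transpose_def nth_eq_iff_index_eq)
  ultimately show "block_quartic (m \<circ> Transposition.transpose (\<rho> ! a) (\<rho> ! b)) = - block_quartic m"
    using ab \<rho>[of m] by (simp add: odd_swap_def)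
qed

text \<open>The edges 01, 23, 45, 67 come from skewness, 02 from the exchange relation, 46 and 04
  from transporting 02. They connect all eight slots.\<close>

lemma odd_swap:
  assumes "a < 8" "b < 8" "a \<noteq> b"
  shows "odd_swap a b"
proof -
  have "block_quartic m = block_quartic (\<lambda>k. m ([4, 5, 6, 7, 0, 1, 2, 3] ! k))" for m
    unfolding block_quartic_def by (rule quartic_swap_upper)
  from odd_swap_transport[OF this _ _ _ odd_swap_0_2] have 46: "odd_swap 4 6"
    by simp
  have "block_quartic m = block_quartic (\<lambda>k. m ([0, 1, 4, 5, 2, 3, 6, 7] ! k))" for m
    unfolding block_quartic_def by (rule quartic_transpose_indices) (rule clifford_form_swap_indices)
  from odd_swap_transport[OF this _ _ _ odd_swap_0_2] have 04: "odd_swap 0 4"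
    by simp
  note pairs = odd_swap_within_pair
  have 05: "odd_swap 0 5" and 06: "odd_swap 0 6" and 03: "odd_swap 0 3"
    using odd_swap_trans[OF 04 pairs(3)] odd_swap_trans[OF 04 46] odd_swap_trans[OF odd_swap_0_2 pairs(2)]
    by simp_all
  have 07: "odd_swap 0 7"
    using odd_swap_trans[OF 06 pairs(4)] by simp
  have zero: "odd_swap 0 c" if "c < 8" "c \<noteq> 0" for c
  proof -
    have "c \<in> {1,2,3,4,5,6,7}"
      using that by auto
    then show ?thesis
      using pairs(1) odd_swap_0_2 03 04 05 06 07 by auto
  qed
  show ?thesis
    using assms zero odd_swap_sym odd_swap_trans by (metis)
qed

lemma block_quartic_permute:
  assumes "\<sigma> permutes {..<8}" "block_tuple m"
  shows "block_quartic (m \<circ> \<sigma>) = of_int (sign \<sigma>) * block_quartic m"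
proof -
  have "\<forall>m. block_tuple m \<longrightarrow> block_quartic (m \<circ> \<sigma>) = of_int (sign \<sigma>) * block_quartic m"
    using assms(1) finite_lessThan
  proof (induction rule: permutes_induct)
    case (swap a b p)
    show ?case
    proof (intro allI impI)
      fix m :: "nat \<Rightarrow> int" assume m: "block_tuple m"
      have t: "Transposition.transpose a b permutes {..<8}"
        using swap.hyps by (simp add: permutes_swap_id)
      have "sign (Transposition.transpose a b \<circ> p) = - sign p"
        using swap.hyps t permutation_permutes[of p] permutation_permutes[of "Transposition.transpose a b"]
        by (subst sign_compose) (auto simp: sign_swap_id)
      moreover have "block_quartic (m \<circ> (Transposition.transpose a b \<circ> p)) =
          of_int (sign p) * block_quartic (m \<circ> Transposition.transpose a b)"
        using swap.IH block_tuple_permute[OF m t] by (simp only: comp_assoc[symmetric])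
      moreover have "block_quartic (m \<circ> Transposition.transpose a b) = - block_quartic m"
        using odd_swap[of a b] swap.hyps m by (simp add: odd_swap_def)
      ultimately show "block_quartic (m \<circ> (Transposition.transpose a b \<circ> p)) =
          of_int (sign (Transposition.transpose a b \<circ> p)) * block_quartic m"
        by simp
    qed
  qed simp
  then show ?thesis
    using assms(2) by blast
qed

lemma block_quartic_nonzero: "block_quartic (\<lambda>k. int k + 1) \<noteq> 0"
proof -
  let ?d = "\<lambda>i j x y. delta (act (gens ! i) x) (act (gens ! j) y)"
  let ?f = "\<lambda>i j i' j'. ?d i j 1 2 * ?d i j' 3 4 * ?d i' j 5 6 * ?d i' j' 7 8"
  have 1: "block_quartic (\<lambda>k. int k + 1) = of_int (\<Sum>i\<le>8. \<Sum>j\<le>8. \<Sum>i'\<le>8. \<Sum>j'\<le>8. ?f i j i' j')"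
    by (simp add: block_quartic_def quartic_def gen_form_signed_basis)
  have "(\<Sum>i\<leftarrow>[0..<9]. f i) = (\<Sum>i\<le>8. f i)" for f :: "nat \<Rightarrow> int"
    by (simp add: interv_sum_list_conv_sum_set_nat atLeast0LessThan lessThan_Suc_atMost[symmetric])
  \<comment> \<open>The guards discard vanishing products early, which keeps the evaluation
    small.\<close>
  then have 2: "(\<Sum>i\<le>8. \<Sum>j\<le>8. \<Sum>i'\<le>8. \<Sum>j'\<le>8. ?f i j i' j') =
      (\<Sum>i\<leftarrow>[0..<9]. \<Sum>j\<leftarrow>[0..<9]. if ?d i j 1 2 = 0 then 0 else
        \<Sum>i'\<leftarrow>[0..<9]. if ?d i' j 5 6 = 0 then 0 else \<Sum>j'\<leftarrow>[0..<9]. ?f i j i' j')"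
    by (simp only:) (rule sum.cong[OF refl], rule sum.cong[OF refl], auto intro!: sum.cong)
  have 3: "(\<Sum>i\<leftarrow>[0..<9]. \<Sum>j\<leftarrow>[0..<9]. if ?d i j 1 2 = 0 then 0 else
        \<Sum>i'\<leftarrow>[0..<9]. if ?d i' j 5 6 = 0 then 0 else \<Sum>j'\<leftarrow>[0..<9]. ?f i j i' j') \<noteq> 0"
    by code_simp
  show ?thesis
    unfolding 1 2 of_int_eq_0_iff by (rule 3)
qed

text \<open>On the first block the contraction is already alternating, so all 8! terms agree and
  none cancel.\<close>

lemma standard_form_nonzero: "standard_form (\<lambda>i. signed_basis (int i + 1)) \<noteq> 0"
proof -
  have m: "block_tuple (\<lambda>k. int k + 1)"
    by (auto simp: block_tuple_def inj_on_def)
  have "alternation 8 (quartic gen_form) (\<lambda>i. signed_basis (int i + 1)) =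
      (\<Sum>\<sigma> | \<sigma> permutes {..<8}. of_int (sign \<sigma>) * block_quartic ((\<lambda>k. int k + 1) \<circ> \<sigma>))"
    by (simp add: alternation_def block_quartic_def comp_def)
  also have "\<dots> = (\<Sum>\<sigma> | \<sigma> permutes {..<8::nat}. block_quartic (\<lambda>k. int k + 1))"
    by (intro sum.cong refl)
      (simp add: block_quartic_permute[OF _ m] sign_idempotent flip: mult.assoc of_int_mult)
  also have "\<dots> = fact 8 * block_quartic (\<lambda>k. int k + 1)"
    by (simp add: card_permutations)
  finally show ?thesis
    using block_quartic_nonzero by (simp add: standard_form_def)
qed

text \<open>\<open>c\<close> is chosen so that the difference \<open>\<beta>\<close> vanishes on the
  basis of the first block, which forces it to be zero.\<close>

theorem spin9_invariant_unique:
  assumes "alternating_form 8 \<alpha>" "spin9_invariant \<alpha>"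
  shows "\<exists>c. \<alpha> = (\<lambda>v. c * standard_form v)"
proof -
  let ?e = "\<lambda>i. signed_basis (int i + 1)"
  define c where "c = \<alpha> ?e / standard_form ?e"
  define \<beta> where "\<beta> v = \<alpha> v - c * standard_form v" for v
  have "alternating_form 8 \<beta>"
    unfolding alternating_form_def
  proof (intro conjI allI impI)
    fix v :: "nat \<Rightarrow> R16" and i :: nat assume "i < 8"
    then show "linear (\<lambda>x. \<beta> (v(i := x)))"
      unfolding \<beta>_def using assms(1) alternating_standard_form
      by (intro linear_compose_sub linear_cmult alternating_form_linear)
  next
    fix v w :: "nat \<Rightarrow> R16" assume "\<forall>i<8. v i = w i"
    then show "\<beta> v = \<beta> w"
      unfolding \<beta>_def using assms(1) alternating_standard_form by (metis alternating_form_cong)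
  next
    fix v :: "nat \<Rightarrow> R16" and i j :: nat assume "i < 8" "j < 8" "i \<noteq> j \<and> v i = v j"
    then have "\<alpha> v = 0" "standard_form v = 0"
      using assms(1) alternating_standard_form unfolding alternating_form_def by blast+
    then show "\<beta> v = 0"
      by (simp add: \<beta>_def)
  qed
  moreover have "spin9_invariant \<beta>"
    using assms(2) spin9_invariant_standard_form by (simp add: spin9_invariant_def \<beta>_def)
  moreover have "\<beta> ?e = 0"
    using standard_form_nonzero by (simp add: \<beta>_def c_def)
  ultimately have "\<beta> v = 0" for v
    by (rule spin9_invariant_eq_0)
  then show ?thesis
    by (auto simp: \<beta>_def)
qed

section \<open>Smooth maps\<close>

text \<open>On an open set, equality of the functions passes to their derivatives, to which the
  induction applies.\<close>

lemma Ck_on_cong: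
  assumes S: "open S" and eq: "\<And>x. x \<in> S \<Longrightarrow> f x = g x" and f: "Ck_on k S f"
  shows "Ck_on k S g"
  using eq f
proof (induction k arbitrary: f g)
  case 0
  then show ?case
    using continuous_on_cong[of S S f g] by simp
next
  case (Suc k)
  have diff: "g differentiable (at x) \<and> frechet_derivative f (at x) = frechet_derivative g (at x)" if "x \<in> S" for x
  proof
    have "f differentiable (at x)"
      using Suc.prems that by simp
    moreover from this show "g differentiable (at x)"
      using S that Suc.prems(1)
      unfolding differentiable_def by (meson has_derivative_transform_within_open)
    ultimately show "frechet_derivative f (at x) = frechet_derivative g (at x)"
      using frechet_derivative_transform_within_open[of f x S g] S that Suc.prems(1) by blast
  qed
  have "Ck_on k S (\<lambda>x. frechet_derivative g (at x) v)" for v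
  proof (rule Suc.IH)
    show "Ck_on k S (\<lambda>x. frechet_derivative f (at x) v)"
      using Suc.prems(2) by simp
  qed (simp add: diff)
  then show ?case
    using diff by simp
qed

lemma Ck_on_has_derivative:
  "Ck_on (Suc k) S f \<Longrightarrow> x \<in> S \<Longrightarrow> (f has_derivative frechet_derivative f (at x)) (at x)"
  using frechet_derivative_works by auto

lemma Ck_on_SucD: "Ck_on (Suc k) S f \<Longrightarrow> Ck_on k S f"
proof (induction k arbitrary: f)
  case 0
  then show ?case
    by (auto intro!: continuous_at_imp_continuous_on differentiable_imp_continuous_within)
next
  case (Suc k)
  then show ?case
    by (subst Ck_on.simps(2)) (simp del: Ck_on.simps(2) add: Ck_on.simps(2)[of "Suc k"])
qed

lemma Ck_on_subset: "Ck_on k S f \<Longrightarrow> T \<subseteq> S \<Longrightarrow> Ck_on k T f"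
  by (induction k arbitrary: f) (auto intro: continuous_on_subset)

lemma Ck_on_local:
  assumes "\<And>x. x \<in> S \<Longrightarrow> \<exists>T. open T \<and> x \<in> T \<and> Ck_on k T f"
  shows "Ck_on k S f"
  using assms
proof (induction k arbitrary: f)
  case 0
  have "continuous (at x) f" if "x \<in> S" for x
    using 0[OF that] continuous_on_eq_continuous_at by auto
  then show ?case
    by (auto intro: continuous_at_imp_continuous_on)
next
  case (Suc k)
  then show ?case
    by (fastforce intro!: Suc.IH)
qed

lemma Ck_on_const: "Ck_on k S (\<lambda>x. c)"
  by (induction k arbitrary: c) simp_all

lemma Ck_on_bounded_linear:
  assumes S: "open S" and h: "bounded_linear h" and f: "Ck_on k S f"
  shows "Ck_on k S (\<lambda>x. h (f x))"
  using f
proof (induction k arbitrary: f)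
  case 0
  then show ?case
    using bounded_linear.continuous_on[OF h] by simp
next
  case (Suc k)
  have der: "((\<lambda>x. h (f x)) has_derivative (\<lambda>v. h (frechet_derivative f (at x) v))) (at x)" if "x \<in> S" for x
    by (rule bounded_linear.has_derivative[OF h Ck_on_has_derivative[OF Suc.prems that]])
  have "Ck_on k S (\<lambda>x. frechet_derivative (\<lambda>x. h (f x)) (at x) v)" for v
  proof (rule Ck_on_cong[OF S])
    show "Ck_on k S (\<lambda>x. h (frechet_derivative f (at x) v))"
      using Suc by simp
  qed (simp add: frechet_derivative_at[OF der, symmetric])
  then show ?case
    using der by (auto simp: differentiable_def)
qed

lemma Ck_on_add:
  assumes S: "open S" and f: "Ck_on k S f" and g: "Ck_on k S g"
  shows "Ck_on k S (\<lambda>x. f x + g x)"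
  using f g
proof (induction k arbitrary: f g)
  case 0
  then show ?case
    by (simp add: continuous_on_add)
next
  case (Suc k)
  have der: "((\<lambda>x. f x + g x) has_derivative
      (\<lambda>v. frechet_derivative f (at x) v + frechet_derivative g (at x) v)) (at x)" if "x \<in> S" for x
    by (rule has_derivative_add[OF Suc.prems[THEN Ck_on_has_derivative, OF that]])
  have "Ck_on k S (\<lambda>x. frechet_derivative (\<lambda>x. f x + g x) (at x) v)" for v
  proof (rule Ck_on_cong[OF S])
    show "Ck_on k S (\<lambda>x. frechet_derivative f (at x) v + frechet_derivative g (at x) v)"
      using Suc by simp
  qed (simp add: frechet_derivative_at[OF der, symmetric])
  then show ?case
    using der by (auto simp: differentiable_def)
qed

text \<open>The product rule gives two terms of the same shape and one order less, so the induction
  is over \<open>f\<close> and \<open>g\<close> simultaneously.\<close>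

lemma Ck_on_bounded_bilinear:
  assumes S: "open S" and h: "bounded_bilinear h" and f: "Ck_on k S f" and g: "Ck_on k S g"
  shows "Ck_on k S (\<lambda>x. h (f x) (g x))"
  using f g
proof (induction k arbitrary: f g)
  case 0
  then show ?case
    using bounded_bilinear.continuous_on[OF h] by simp
next
  case (Suc k)
  have der: "((\<lambda>x. h (f x) (g x)) has_derivative
      (\<lambda>v. h (f x) (frechet_derivative g (at x) v) + h (frechet_derivative f (at x) v) (g x))) (at x)"
    if "x \<in> S" for x
    by (rule bounded_bilinear.FDERIV[OF h Suc.prems[THEN Ck_on_has_derivative, OF that]])
  have "Ck_on k S (\<lambda>x. frechet_derivative (\<lambda>x. h (f x) (g x)) (at x) v)" for v
  proof (rule Ck_on_cong[OF S])
    have "Ck_on k S f" "Ck_on k S g"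
      using Suc.prems Ck_on_SucD by blast+
    then show "Ck_on k S (\<lambda>x. h (f x) (frechet_derivative g (at x) v) + h (frechet_derivative f (at x) v) (g x))"
      using Suc.prems by (intro Ck_on_add[OF S] Suc.IH) auto
  qed (simp add: frechet_derivative_at[OF der, symmetric])
  then show ?case
    using der by (auto simp: differentiable_def)
qed

lemma smooth_on_cong: "open S \<Longrightarrow> (\<And>x. x \<in> S \<Longrightarrow> f x = g x) \<Longrightarrow> smooth_on S f \<Longrightarrow> smooth_on S g"
  unfolding smooth_on_def using Ck_on_cong by blast

lemma smooth_on_subset: "smooth_on S f \<Longrightarrow> T \<subseteq> S \<Longrightarrow> smooth_on T f"
  unfolding smooth_on_def using Ck_on_subset by blast

lemma smooth_on_local: "(\<And>x. x \<in> S \<Longrightarrow> \<exists>T. open T \<and> x \<in> T \<and> smooth_on T f) \<Longrightarrow> smooth_on S f"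
  unfolding smooth_on_def by (meson Ck_on_local)

lemma smooth_on_const: "smooth_on S (\<lambda>x. c)"
  by (simp add: smooth_on_def Ck_on_const)

lemma smooth_on_bounded_linear:
  "open S \<Longrightarrow> bounded_linear h \<Longrightarrow> smooth_on S f \<Longrightarrow> smooth_on S (\<lambda>x. h (f x))"
  by (simp add: smooth_on_def Ck_on_bounded_linear)

lemma smooth_on_add:
  "open S \<Longrightarrow> smooth_on S f \<Longrightarrow> smooth_on S g \<Longrightarrow> smooth_on S (\<lambda>x. f x + g x)"
  by (simp add: smooth_on_def Ck_on_add)

lemma smooth_on_bounded_bilinear:
  "open S \<Longrightarrow> bounded_bilinear h \<Longrightarrow> smooth_on S f \<Longrightarrow> smooth_on S g \<Longrightarrow> smooth_on S (\<lambda>x. h (f x) (g x))"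
  by (simp add: smooth_on_def Ck_on_bounded_bilinear)

lemma smooth_on_sum:
  "open S \<Longrightarrow> (\<And>i. i \<in> I \<Longrightarrow> smooth_on S (f i)) \<Longrightarrow> smooth_on S (\<lambda>x. \<Sum>i\<in>I. f i x)"
  by (induction I rule: infinite_finite_induct) (simp_all add: smooth_on_const smooth_on_add)

lemmas smooth_on_mult = smooth_on_bounded_bilinear[OF _ bounded_bilinear_mult]

lemma smooth_on_vec_nth: "open S \<Longrightarrow> smooth_on S f \<Longrightarrow> smooth_on S (\<lambda>x. f x $ i)"
  by (rule smooth_on_bounded_linear[OF _ bounded_linear_vec_nth])

lemma smooth_on_vec_lambda:
  fixes f :: "'a::euclidean_space \<Rightarrow> 'b::euclidean_space ^ 'n"
  assumes S: "open S" and f: "\<And>i. smooth_on S (\<lambda>x. f x $ i)"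
  shows "smooth_on S f"
proof -
  have "bounded_linear (\<lambda>y :: 'b. axis i y :: 'b ^ 'n)" for i
    by (intro linear_conv_bounded_linear[THEN iffD1] linearI)
      (auto simp: vec_eq_iff axis_def)
  then have "smooth_on S (\<lambda>x. \<Sum>i\<in>UNIV. axis i (f x $ i) :: 'b ^ 'n)"
    using S f by (intro smooth_on_sum smooth_on_bounded_linear[of S "axis _"]) auto
  moreover have "(\<Sum>i\<in>UNIV. axis i (y $ i)) = y" for y :: "'b ^ 'n"
    by (simp add: vec_eq_iff axis_def if_distrib cong: if_cong)
  ultimately show ?thesis by simp
qed

lemma bounded_linear_matrix_vector_right: "bounded_linear (\<lambda>v. A *v v)"
  for A :: "real ^ 'n ^ 'm"
  by (intro linear_conv_bounded_linear[THEN iffD1]) simp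

lemma bounded_bilinear_matrix_mult:
  "bounded_bilinear ((**) :: real ^ 'n ^ 'm \<Rightarrow> real ^ 'k ^ 'n \<Rightarrow> _)"
  unfolding bilinear_conv_bounded_bilinear[symmetric] bilinear_def
  by (simp add: linear_matrix_mult_left linear_matrix_mult_right)

section \<open>Charts and frames\<close>

lemma smooth_on_gen_form:
  assumes S: "open S" and f: "smooth_on S f" and f': "smooth_on S f'"
  shows "smooth_on S (\<lambda>x. gen_form i j (f x) (f' x))"
proof -
  have inner: "smooth_on S (\<lambda>x. f x \<bullet> (clifford_gen a *v (clifford_gen b *v f' x)))" for a b
    by (intro smooth_on_bounded_bilinear[OF S bounded_bilinear_inner] f
        smooth_on_bounded_linear[OF S bounded_linear_matrix_vector_right] f')
  then have "smooth_on S (\<lambda>x. - (f x \<bullet> (clifford_gen a *v (clifford_gen b *v f' x))))" for a b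
    using smooth_on_bounded_linear[OF S bounded_linear_minus[OF bounded_linear_ident]] by blast
  then show ?thesis
    using inner smooth_on_const unfolding clifford_form_def
    by (cases "i < j"; cases "j < i") simp_all
qed

lemma smooth_on_standard_form:
  assumes S: "open S" and f: "\<And>i. smooth_on S (f i)"
  shows "smooth_on S (\<lambda>x. standard_form (\<lambda>i. f i x))"
proof -
  have "smooth_on S (\<lambda>x. quartic gen_form (\<lambda>i. f (\<sigma> i) x))" for \<sigma>
    unfolding quartic_def by (intro smooth_on_sum smooth_on_mult smooth_on_gen_form S f)
  then have "smooth_on S (\<lambda>x. of_int (sign \<sigma>) * quartic gen_form (\<lambda>i. f (\<sigma> i) x))" for \<sigma>
    by (intro smooth_on_mult[OF S smooth_on_const])
  then show ?thesis
    unfolding standard_form_def alternation_def comp_def divide_inverse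
    by (intro smooth_on_mult[OF S _ smooth_on_const] smooth_on_sum[OF S])
qed

section \<open>Changes of charts and local tests of smoothness\<close>

context
  fixes A :: "('m::topological_space, 'n::finite) chart set"
  assumes atlas: "oriented_smooth_atlas A"
begin

lemma chart_at: "chart_at A p \<in> A" "p \<in> fst (chart_at A p)"
proof -
  have "\<exists>c. c \<in> A \<and> p \<in> fst c"
    using atlas unfolding oriented_smooth_atlas_def by blast
  from someI_ex[OF this] show "chart_at A p \<in> A" "p \<in> fst (chart_at A p)"
    by (simp_all add: chart_at_def)
qed

lemma chart_inv_chart: "c \<in> A \<Longrightarrow> q \<in> fst c \<Longrightarrow> chart_inv c (snd c q) = q"
  using atlas unfolding oriented_smooth_atlas_def by (meson homeomorphism_apply1)

lemma open_chart_image: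
  assumes c: "c \<in> A" and U: "open U"
  shows "open (snd c ` (fst c \<inter> U))"
proof -
  have c': "open (fst c)" "open (snd c ` fst c)" "homeomorphism (fst c) (snd c ` fst c) (snd c) (chart_inv c)"
    using atlas c unfolding oriented_smooth_atlas_def by blast+
  then have "openin (top_of_set (snd c ` fst c)) (snd c ` (fst c \<inter> U))"
    using U by (intro homeomorphism_imp_open_map[OF c'(3)]) auto
  then show ?thesis
    using c'(2) openin_open_trans openin_open_eq by blast
qed

text \<open>Chain rule for the two transitions, whose composite is the identity near the
  point.\<close>

lemma jacobian_transition_inverse:
  assumes c: "c \<in> A" "c' \<in> A" and p: "p \<in> fst c" "p \<in> fst c'"
  shows "jacobian (transition c c') (at (snd c p)) ** jacobian (transition c' c) (at (snd c' p)) = mat 1"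
proof -
  let ?f = "transition c' c" and ?g = "transition c c'" and ?y = "snd c' p"
  have diff: "transition a b differentiable (at (snd a p))"
    if "a \<in> A" "b \<in> A" "p \<in> fst a" "p \<in> fst b" for a b
  proof -
    have "Ck_on (Suc 0) (snd a ` (fst a \<inter> fst b)) (transition a b)"
      using atlas that unfolding oriented_smooth_atlas_def smooth_on_def by blast
    then show ?thesis
      using that by auto
  qed
  have f_y: "?f ?y = snd c p"
    using chart_inv_chart[OF c(2) p(2)] by (simp add: transition_def)
  have "(?f has_derivative (\<lambda>h. jacobian ?f (at ?y) *v h)) (at ?y)"
    using diff[OF c(2,1) p(2,1)] by (simp add: jacobian_works)
  moreover have "(?g has_derivative (\<lambda>h. jacobian ?g (at (snd c p)) *v h)) (at (?f ?y))"
    using diff[OF c p] by (simp add: jacobian_works f_y)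
  ultimately have comp: "((\<lambda>x. ?g (?f x)) has_derivative
      (\<lambda>h. jacobian ?g (at (snd c p)) *v (jacobian ?f (at ?y) *v h))) (at ?y)"
    by (rule has_derivative_compose)
  have "((\<lambda>x. x) has_derivative (\<lambda>h. jacobian ?g (at (snd c p)) *v (jacobian ?f (at ?y) *v h))) (at ?y)"
  proof (rule has_derivative_transform_within_open[OF comp])
    have "open (fst c)"
      using atlas c unfolding oriented_smooth_atlas_def by blast
    then show "open (snd c' ` (fst c' \<inter> fst c))"
      by (rule open_chart_image[OF c(2)])
    show "?y \<in> snd c' ` (fst c' \<inter> fst c)"
      using p by blast
  qed (use c chart_inv_chart in \<open>auto simp: transition_def\<close>)
  from has_derivative_unique[OF this has_derivative_ident] show ?thesis
    by (simp add: matrix_eq matrix_vector_mul_assoc[symmetric] fun_eq_iff)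
qed

lemma to_coords_of_coords:
  assumes "c \<in> A" "p \<in> fst c"
  shows "to_coords A c p ** of_coords A c p = mat 1" "of_coords A c p ** to_coords A c p = mat 1"
  unfolding to_coords_def of_coords_def
  using jacobian_transition_inverse[OF chart_at(1) assms(1) chart_at(2) assms(2)]
    jacobian_transition_inverse[OF assms(1) chart_at(1) assms(2) chart_at(2)] by simp_all

lemma smooth_in_charts_cong:
  assumes "open U" "\<And>c p. c \<in> A \<Longrightarrow> p \<in> fst c \<Longrightarrow> p \<in> U \<Longrightarrow> T c p = T' c p" "smooth_in_charts A U T"
  shows "smooth_in_charts A U T'"
  unfolding smooth_in_charts_def
proof
  fix c assume c: "c \<in> A"
  show "smooth_on (snd c ` (fst c \<inter> U)) (\<lambda>x. T' c (chart_inv c x))"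
  proof (rule smooth_on_cong[OF open_chart_image[OF c assms(1)]])
    show "smooth_on (snd c ` (fst c \<inter> U)) (\<lambda>x. T c (chart_inv c x))"
      using assms(3) c by (simp add: smooth_in_charts_def)
  qed (use assms(2)[OF c] chart_inv_chart[OF c] in auto)
qed

lemma smooth_in_charts_subset: "smooth_in_charts A U T \<Longrightarrow> V \<subseteq> U \<Longrightarrow> smooth_in_charts A V T"
  unfolding smooth_in_charts_def by (meson smooth_on_subset image_mono Int_mono subset_refl)

lemma smooth_in_charts_local:
  assumes "\<And>p. \<exists>U. open U \<and> p \<in> U \<and> smooth_in_charts A U T"
  shows "smooth_in_charts A UNIV T"
  unfolding smooth_in_charts_def
proof
  fix c assume c: "c \<in> A"
  show "smooth_on (snd c ` (fst c \<inter> UNIV)) (\<lambda>x. T c (chart_inv c x))"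
  proof (rule smooth_on_local)
    fix x assume "x \<in> snd c ` (fst c \<inter> UNIV)"
    then obtain p where p: "p \<in> fst c" "x = snd c p"
      by auto
    obtain U where U: "open U" "p \<in> U" "smooth_in_charts A U T"
      using assms by blast
    show "\<exists>V. open V \<and> x \<in> V \<and> smooth_on V (\<lambda>x. T c (chart_inv c x))"
      using p U c open_chart_image[OF c U(1)] by (intro exI[of _ "snd c ` (fst c \<inter> U)"]) (auto simp: smooth_in_charts_def)
  qed
qed

end

lemma inverse_matrix_unique:
  fixes A :: "real ^ 'n ^ 'n"
  assumes "A ** B = mat 1" "C ** A = mat 1"
  shows "B = C"
  by (metis assms matrix_mul_assoc matrix_mul_lid matrix_mul_rid)

section \<open>Conjugation of Clifford multiplications by Spin(9)\<close>

lemma span_clifford_gen: "span (clifford_gen ` {..8}) = range clifford_mult"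
proof
  show "span (clifford_gen ` {..8}) \<subseteq> range clifford_mult"
    using in_span_image_atMost[of _ clifford_gen] by (auto simp: clifford_mult_def image_iff)
  show "range clifford_mult \<subseteq> span (clifford_gen ` {..8})"
    unfolding clifford_mult_def by (auto intro!: span_sum span_scale intro: span_base)
qed

lemma clifford_mult_conj:
  assumes x: "(\<Sum>i\<le>8. (x i)\<^sup>2) = 1" and B: "B \<in> span (clifford_gen ` {..8})"
  shows "clifford_mult x ** B ** clifford_mult x \<in> span (clifford_gen ` {..8})"
proof -
  let ?f = "\<lambda>B. clifford_mult x ** B ** clifford_mult x"
  have lin: "linear ?f"
    using linear_compose[OF linear_matrix_mult_right linear_matrix_mult_left] by (simp add: comp_def)
  have "clifford_mult x \<in> span (clifford_gen ` {..8})"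
    by (simp add: span_clifford_gen)
  then have "?f (clifford_gen k) \<in> span (clifford_gen ` {..8})" if "k \<le> 8" for k
    unfolding clifford_mult_reflection[OF x that]
    using that by (intro span_diff span_scale) (auto intro: span_base)
  then have "?f ` (clifford_gen ` {..8}) \<subseteq> span (clifford_gen ` {..8})"
    by auto
  then have "span (?f ` (clifford_gen ` {..8})) \<subseteq> span (clifford_gen ` {..8})"
    by (intro span_minimal subspace_span)
  then show ?thesis
    using B by (auto simp: linear_span_image[OF lin])
qed

text \<open>The inverse is built along the generation of \<open>spin9\<close>. Preservation of the
  span makes the fibre of \<open>spin9_bundle\<close> independent of the frame.\<close>

lemma spin9_conj:
  assumes "h \<in> spin9"
  shows "\<exists>h'. h ** h' = mat 1 \<and> h' ** h = mat 1 \<and>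
    (\<forall>B \<in> span (clifford_gen ` {..8}). h ** B ** h' \<in> span (clifford_gen ` {..8}))"
  using assms
proof (induction rule: spin9.induct)
  case one
  show ?case by (intro exI[of _ "mat 1"]) simp
next
  case (mult h x y)
  then obtain h' where h': "h ** h' = mat 1" "h' ** h = mat 1"
    and B: "\<And>B. B \<in> span (clifford_gen ` {..8}) \<Longrightarrow> h ** B ** h' \<in> span (clifford_gen ` {..8})"
    by blast
  let ?X = "clifford_mult x" and ?Y = "clifford_mult y"
  have X: "?X ** ?X = mat 1" and Y: "?Y ** ?Y = mat 1"
    using mult by (simp_all add: clifford_mult_square)
  have "?X ** ?Y ** h ** (h' ** ?Y ** ?X) = ?X ** ?Y ** (h ** h') ** ?Y ** ?X"
    "(h' ** ?Y ** ?X) ** (?X ** ?Y ** h) = h' ** ?Y ** (?X ** ?X) ** ?Y ** h"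
    by (simp_all only: matrix_mul_assoc)
  moreover have "?X ** ?Y ** ?Y ** ?X = ?X ** (?Y ** ?Y) ** ?X" "h' ** ?Y ** ?Y ** h = h' ** (?Y ** ?Y) ** h"
    by (simp_all only: matrix_mul_assoc)
  moreover have "?X ** ?Y ** h ** B ** (h' ** ?Y ** ?X) = ?X ** (?Y ** (h ** B ** h') ** ?Y) ** ?X" for B
    by (simp only: matrix_mul_assoc)
  ultimately show ?case
    using h' X Y B mult clifford_mult_conj by (intro exI[of _ "h' ** ?Y ** ?X"]) simp
qed

section \<open>The canonical 8-form\<close>

text \<open>The frame is an arbitrary choice at each point; \<open>canonical_form_eq\<close> shows
  that every frame in \<open>P p\<close> gives the same value.\<close>

definition canonical_form :: "('m \<Rightarrow> End16 set) \<Rightarrow> 'm \<Rightarrow> R16 form" where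
  "canonical_form P p v = standard_form (\<lambda>i. matrix_inv (SOME u. u \<in> P p) *v v i)"

context
  fixes A :: "('m::topological_space, idx16) chart set"
    and g :: "'m \<Rightarrow> R16 \<Rightarrow> R16 \<Rightarrow> real"
    and P :: "'m \<Rightarrow> End16 set"
  assumes atlas: "oriented_smooth_atlas A"
    and metric: "riemannian_metric A g"
    and spin: "spin9_structure A g P"
begin

section \<open>Independence of the frame and of the local basis\<close>

lemma local_section:
  "\<exists>U s. open U \<and> p \<in> U \<and> (\<forall>q\<in>U. s q \<in> P q) \<and> smooth_frame_field A U s"
  using spin by (auto simp: spin9_structure_def)

lemma some_frame: "(SOME u. u \<in> P p) \<in> P p"
  using local_section[of p] by (meson someI)

lemma frame_isometry:
  assumes "u \<in> P p"
  shows "g p (u *v v) (u *v w) = v \<bullet> w"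
  using spin assms unfolding spin9_structure_def oriented_orthonormal_frame_def by blast

lemma frame_inverse:
  assumes "u \<in> P p"
  shows "u ** matrix_inv u = mat 1" "matrix_inv u ** u = mat 1"
proof -
  have "det u > 0"
    using spin assms unfolding spin9_structure_def oriented_orthonormal_frame_def by blast
  then have "\<exists>B. u ** B = mat 1 \<and> B ** u = mat 1"
    using invertible_det_nz[of u] by (simp add: invertible_def)
  from someI_ex[OF this] show "u ** matrix_inv u = mat 1" "matrix_inv u ** u = mat 1"
    by (simp_all add: matrix_inv_def)
qed

lemma frame_inverse_vec: "u \<in> P p \<Longrightarrow> u *v (matrix_inv u *v v) = v" "u \<in> P p \<Longrightarrow> matrix_inv u *v (u *v v) = v"
  by (simp_all add: matrix_vector_mul_assoc frame_inverse)

lemma frame_change: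
  assumes "u \<in> P p" "u' \<in> P p"
  shows "\<exists>h\<in>spin9. u' = u ** h"
proof -
  have "P p = {u ** h |h. h \<in> spin9}"
    using spin assms(1) unfolding spin9_structure_def by blast
  then show ?thesis
    using assms(2) by blast
qed

lemma standard_form_frame_change:
  assumes u: "u \<in> P p" "u' \<in> P p"
  shows "standard_form (\<lambda>i. matrix_inv u *v v i) = standard_form (\<lambda>i. matrix_inv u' *v v i)"
proof -
  obtain h where h: "h \<in> spin9" "u' = u ** h"
    using frame_change[OF u] by blast
  have "matrix_inv u *v w = h *v (matrix_inv u' *v w)" for w
  proof -
    have "w = u *v (h *v (matrix_inv u' *v w))"
      using frame_inverse_vec(1)[OF u(2), of w] by (simp add: h(2) flip: matrix_vector_mul_assoc)
    then show ?thesis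
      using frame_inverse_vec(2)[OF u(1)] by metis
  qed
  then show ?thesis
    using spin9_invariant_standard_form h(1) by (simp add: spin9_invariant_def)
qed

lemma canonical_form_eq: "u \<in> P p \<Longrightarrow> canonical_form P p v = standard_form (\<lambda>i. matrix_inv u *v v i)"
  unfolding canonical_form_def by (rule standard_form_frame_change[OF some_frame])

lemma spin9_bundle_eq:
  assumes u: "u \<in> P p"
  shows "spin9_bundle P p = (\<lambda>B. u ** B ** matrix_inv u) ` span (clifford_gen ` {..8})"
proof (intro subset_antisym subsetI)
  fix B assume "B \<in> spin9_bundle P p"
  then obtain u' x where u': "u' \<in> P p" and B: "B = u' ** clifford_mult x ** matrix_inv u'"
    by (auto simp: spin9_bundle_def)
  obtain h where h: "h \<in> spin9" "u' = u ** h"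
    using frame_change[OF u u'] by blast
  obtain h' where h': "h ** h' = mat 1" "h' ** h = mat 1"
    "h ** clifford_mult x ** h' \<in> span (clifford_gen ` {..8})"
    using spin9_conj[OF h(1)] by (auto simp: span_clifford_gen)
  have "u' ** (h' ** matrix_inv u) = u ** (h ** h') ** matrix_inv u"
    by (simp only: h(2) matrix_mul_assoc)
  then have "u' ** (h' ** matrix_inv u) = mat 1"
    using frame_inverse[OF u] h' by simp
  then have inv: "matrix_inv u' = h' ** matrix_inv u"
    using inverse_matrix_unique frame_inverse(2)[OF u'] by metis
  have "B = u' ** clifford_mult x ** (h' ** matrix_inv u)"
    by (simp only: B inv)
  also have "\<dots> = u ** (h ** clifford_mult x ** h') ** matrix_inv u"
    by (simp only: h(2) matrix_mul_assoc)
  finally show "B \<in> (\<lambda>B. u ** B ** matrix_inv u) ` span (clifford_gen ` {..8})"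
    using h'(3) by blast
next
  fix B assume "B \<in> (\<lambda>B. u ** B ** matrix_inv u) ` span (clifford_gen ` {..8})"
  then show "B \<in> spin9_bundle P p"
    using u by (auto simp: span_clifford_gen spin9_bundle_def)
qed

lemma linear_conj: "linear (\<lambda>B. U ** B ** V)" for U V :: End16
  using linear_compose[OF linear_matrix_mult_right linear_matrix_mult_left] by (simp add: comp_def)

text \<open>A frame carries the local basis to a Clifford system \<open>J\<close> on the model space
  with the same span as the generators. Independence of the basis then identifies the contractions
  before antisymmetrisation.\<close>

lemma omega_sum_eq_canonical_form:
  assumes I: "local_basis A g (spin9_bundle P) U I" and p: "p \<in> U"
  shows "omega_sum g I p = canonical_form P p"
proof
  fix v
  define u where "u = (SOME u. u \<in> P p)"
  define V where "V = matrix_inv u"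
  have u: "u \<in> P p"
    unfolding u_def by (rule some_frame)
  have UV: "u ** V = mat 1" "V ** u = mat 1"
    using frame_inverse[OF u] by (simp_all add: V_def)
  have I': "span ((\<lambda>i. I i p) ` {..8}) = spin9_bundle P p" "clifford_system (g p) (\<lambda>i. I i p)"
    using I p by (auto simp: local_basis_def)
  define J where "J k = V ** I k p ** u" for k
  have J: "clifford_system (\<bullet>) J"
    unfolding J_def by (rule clifford_system_conj[OF I'(2) UV frame_isometry[OF u]])
  have "span (J ` {..8}) = (\<lambda>B. V ** B ** u) ` spin9_bundle P p"
    unfolding I'(1)[symmetric] linear_span_image[OF linear_conj, symmetric]
    by (simp add: J_def image_image)
  also have "\<dots> = (\<lambda>B. V ** (u ** B ** V) ** u) ` span (clifford_gen ` {..8})"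
    by (simp add: spin9_bundle_eq[OF u] image_image V_def)
  also have "(\<lambda>B. V ** (u ** B ** V) ** u) = (\<lambda>B. B)"
  proof
    fix B
    have "V ** (u ** B ** V) ** u = (V ** u) ** B ** (V ** u)"
      by (simp only: matrix_mul_assoc)
    then show "V ** (u ** B ** V) ** u = B"
      by (simp add: UV)
  qed
  finally have span: "span (clifford_gen ` {..8}) = span (J ` {..8})"
    by simp
  have "quartic (clifford_form (g p) (\<lambda>i. (*v) (I i p))) v = quartic gen_form (\<lambda>i. V *v v i)" for v
  proof -
    have "quartic (clifford_form (g p) (\<lambda>i. (*v) (I i p))) (\<lambda>i. u *v (V *v v i)) =
        quartic (clifford_form (\<bullet>) (\<lambda>i. (*v) (J i))) (\<lambda>i. V *v v i)"
    proof (rule quartic_cong, rule clifford_form_intertwine)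
      show "I k p *v (u *v x) = u *v (J k *v x)" for k x
        by (simp add: J_def matrix_vector_mul_assoc matrix_mul_assoc UV)
    qed (simp_all add: frame_isometry[OF u])
    then show ?thesis
      using quartic_clifford_systems[OF clifford_system_gen J span]
      by (simp add: matrix_vector_mul_assoc UV)
  qed
  then show "omega_sum g I p v = canonical_form P p v"
    unfolding omega_sum_eq canonical_form_eq[OF u] standard_form_def alternation_def V_def[symmetric]
    by (simp add: comp_def)
qed

section \<open>Smoothness of inverse frames, local bases and the 8-form\<close>

lemma matrix_axis_eq_sum: "M *v axis k 1 = (\<Sum>m\<in>UNIV. M $ m $ k *\<^sub>R axis m 1)"
  for M :: "real ^ 'k ^ 'l"
proof -
  have "M *v axis k 1 = (\<chi> m. M $ m $ k)"
    by (simp add: matrix_vector_mult_basis column_def)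
  also have "\<dots> = (\<Sum>m\<in>UNIV. M $ m $ k *\<^sub>R axis m 1)"
    by (simp add: vec_eq_iff axis_def if_distrib cong: if_cong)
  finally show ?thesis .
qed

text \<open>As the frame is an isometry, components in it are inner products with its columns. This
  expresses the inverse frame polynomially in the metric and the frame, so its smoothness needs no
  differentiation of matrix inversion.\<close>

lemma of_coords_frame_inverse_nth:
  assumes c: "c \<in> A" "p \<in> fst c" and u: "u \<in> P p"
  shows "(matrix_inv u ** of_coords A c p) $ k $ l =
    (\<Sum>m\<in>UNIV. g p (of_coords A c p *v axis l 1) (of_coords A c p *v axis m 1) * (to_coords A c p ** u) $ m $ k)"
proof -
  let ?T = "to_coords A c p" and ?O = "of_coords A c p"
  have lin: "linear (g p x)" for x
    using metric by (auto simp: riemannian_metric_def bilinear_def)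
  have "u *v axis k 1 = ?O *v ((?T ** u) *v axis k 1)"
    by (simp add: matrix_vector_mul_assoc matrix_mul_assoc to_coords_of_coords[OF atlas c])
  also have "(?T ** u) *v axis k 1 = (\<Sum>m\<in>UNIV. (?T ** u) $ m $ k *\<^sub>R axis m 1)"
    by (rule matrix_axis_eq_sum)
  finally have u_k: "u *v axis k 1 = (\<Sum>m\<in>UNIV. (?T ** u) $ m $ k *\<^sub>R (?O *v axis m 1))"
    by (simp add: linear_sum[OF matrix_vector_mul_linear] matrix_vector_mult_scaleR)
  have "(matrix_inv u ** ?O) $ k $ l = ((matrix_inv u ** ?O) *v axis l 1) \<bullet> axis k 1"
    by (simp add: matrix_vector_mult_basis column_def inner_axis)
  also have "\<dots> = g p (u *v (matrix_inv u *v (?O *v axis l 1))) (u *v axis k 1)"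
    by (simp only: frame_isometry[OF u] matrix_vector_mul_assoc[symmetric])
  also have "\<dots> = g p (?O *v axis l 1) (\<Sum>m\<in>UNIV. (?T ** u) $ m $ k *\<^sub>R (?O *v axis m 1))"
    by (simp only: u_k frame_inverse_vec[OF u])
  also have "\<dots> = (\<Sum>m\<in>UNIV. g p (?O *v axis l 1) (?O *v axis m 1) * (?T ** u) $ m $ k)"
    by (simp add: linear_sum[OF lin] linear_scale[OF lin] mult.commute)
  finally show ?thesis .
qed

lemma smooth_frame_inverse:
  assumes U: "open U" and s: "\<forall>q\<in>U. s q \<in> P q" "smooth_frame_field A U s"
  shows "smooth_in_charts A U (\<lambda>c p. matrix_inv (s p) ** of_coords A c p)"
proof (rule smooth_in_charts_cong[OF atlas U])
  let ?G = "\<lambda>c p l m. g p (of_coords A c p *v axis l 1) (of_coords A c p *v axis m 1)"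
  let ?T = "\<lambda>c p. \<chi> k l. \<Sum>m\<in>UNIV. ?G c p l m * (to_coords A c p ** s p) $ m $ k"
  show "?T c p = matrix_inv (s p) ** of_coords A c p" if "c \<in> A" "p \<in> fst c" "p \<in> U" for c p
    using of_coords_frame_inverse_nth[OF that(1,2)] s(1) that(3) by (simp add: vec_eq_iff)
  show "smooth_in_charts A U ?T"
    unfolding smooth_in_charts_def
  proof
    fix c assume c: "c \<in> A"
    let ?S = "snd c ` (fst c \<inter> U)"
    have S: "open ?S"
      by (rule open_chart_image[OF atlas c U])
    have "smooth_in_charts A UNIV (\<lambda>c p. ?G c p l m)" for l m
      using metric by (simp add: riemannian_metric_def)
    from smooth_in_charts_subset[OF atlas this subset_UNIV] have G: "smooth_on ?S (\<lambda>x. ?G c (chart_inv c x) l m)" for l m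
      using c by (simp add: smooth_in_charts_def)
    have "smooth_on ?S (\<lambda>x. to_coords A c (chart_inv c x) ** s (chart_inv c x))"
      using s(2) c by (simp add: smooth_frame_field_def smooth_in_charts_def)
    then show "smooth_on ?S (\<lambda>x. ?T c (chart_inv c x))"
      using G by (intro smooth_on_vec_lambda[OF S]) (auto intro!: smooth_on_sum smooth_on_mult smooth_on_vec_nth S)
  qed
qed

text \<open>A smooth local frame transports the standard generators to a local basis.\<close>

lemma local_basis_exists: "\<exists>U I. p \<in> U \<and> local_basis A g (spin9_bundle P) U I"
proof -
  obtain U s where U: "open U" "p \<in> U" and s: "\<forall>q\<in>U. s q \<in> P q" "smooth_frame_field A U s"
    using local_section by blast
  define I where "I k q = s q ** clifford_gen k ** matrix_inv (s q)" for k q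
  have "smooth_endomorphism_field A U (I k)" for k
    unfolding smooth_endomorphism_field_def
  proof (rule smooth_in_charts_cong[OF atlas U(1)])
    show "(to_coords A c p ** s p) ** clifford_gen k ** (matrix_inv (s p) ** of_coords A c p) =
        to_coords A c p ** I k p ** of_coords A c p" for c p
      by (simp only: I_def matrix_mul_assoc)
    show "smooth_in_charts A U (\<lambda>c p. (to_coords A c p ** s p) ** clifford_gen k ** (matrix_inv (s p) ** of_coords A c p))"
      unfolding smooth_in_charts_def
    proof
      fix c assume c: "c \<in> A"
      let ?S = "snd c ` (fst c \<inter> U)"
      have S: "open ?S"
        by (rule open_chart_image[OF atlas c U(1)])
      have s_smooth: "smooth_on ?S (\<lambda>x. to_coords A c (chart_inv c x) ** s (chart_inv c x))"
        using s(2) c by (simp add: smooth_frame_field_def smooth_in_charts_def)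
      have inv_smooth: "smooth_on ?S (\<lambda>x. matrix_inv (s (chart_inv c x)) ** of_coords A c (chart_inv c x))"
        using smooth_frame_inverse[OF U(1) s] c by (simp add: smooth_in_charts_def)
      show "smooth_on ?S (\<lambda>x. (to_coords A c (chart_inv c x) ** s (chart_inv c x)) **
          clifford_gen k ** (matrix_inv (s (chart_inv c x)) ** of_coords A c (chart_inv c x)))"
        by (rule smooth_on_bounded_bilinear[OF S bounded_bilinear_matrix_mult
              smooth_on_bounded_bilinear[OF S bounded_bilinear_matrix_mult s_smooth smooth_on_const] inv_smooth])
    qed
  qed
  moreover have "span ((\<lambda>k. I k q) ` {..8}) = spin9_bundle P q \<and> clifford_system (g q) (\<lambda>k. I k q)"
    if "q \<in> U" for q
  proof
    have sq: "s q \<in> P q"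
      using s that by blast
    show "span ((\<lambda>k. I k q) ` {..8}) = spin9_bundle P q"
      unfolding spin9_bundle_eq[OF sq] linear_span_image[OF linear_conj, symmetric]
      by (simp add: I_def image_image)
    show "clifford_system (g q) (\<lambda>k. I k q)"
      unfolding I_def
    proof (rule clifford_system_conj[OF clifford_system_gen frame_inverse(2,1)[OF sq]])
      show "(matrix_inv (s q) *v x) \<bullet> (matrix_inv (s q) *v y) = g q x y" for x y
        using frame_isometry[OF sq, of "matrix_inv (s q) *v x" "matrix_inv (s q) *v y"]
        by (simp add: frame_inverse_vec[OF sq])
    qed
  qed
  ultimately have "local_basis A g (spin9_bundle P) U I"
    using U(1) unfolding local_basis_def by blast
  then show ?thesis
    using U(2) by blast
qed

lemma alternating_form_compose:
  fixes f :: "'b::real_vector \<Rightarrow> 'a::real_vector"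
  assumes \<alpha>: "alternating_form k \<alpha>" and f: "linear f"
  shows "alternating_form k (\<lambda>v. \<alpha> (\<lambda>i. f (v i)))"
  unfolding alternating_form_def
proof (intro conjI allI impI)
  fix v w :: "nat \<Rightarrow> 'b" assume "\<forall>i<k. v i = w i"
  then show "\<alpha> (\<lambda>i. f (v i)) = \<alpha> (\<lambda>i. f (w i))"
    by (intro alternating_form_cong[OF \<alpha>]) simp
next
  fix v :: "nat \<Rightarrow> 'b" and i assume i: "i < k"
  have "(\<lambda>j. f ((v(i := x)) j)) = (\<lambda>j. f (v j))(i := f x)" for x
    by auto
  then show "linear (\<lambda>x. \<alpha> (\<lambda>j. f ((v(i := x)) j)))"
    using linear_compose[OF f alternating_form_linear[OF \<alpha> i, of "\<lambda>j. f (v j)"]] by (simp add: comp_def)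
next
  fix v :: "nat \<Rightarrow> 'b" and i j assume "i < k" "j < k" "i \<noteq> j \<and> v i = v j"
  then show "\<alpha> (\<lambda>i. f (v i)) = 0"
    using \<alpha> by (auto simp: alternating_form_def)
qed

lemma alternating_form_cmult:
  assumes "alternating_form k \<alpha>"
  shows "alternating_form k (\<lambda>v. c * \<alpha> v)"
  using assms by (auto simp: alternating_form_def intro!: linear_cmult)

text \<open>Near each point the pointwise chosen frames are replaced by a smooth local section,
  which does not change the form.\<close>

lemma differential_form_canonical_form: "differential_form A 8 (\<lambda>p v. c * canonical_form P p v)"
  unfolding differential_form_def
proof (intro conjI allI)
  show "alternating_form 8 (\<lambda>v. c * canonical_form P p v)" for p
    unfolding canonical_form_def
    by (rule alternating_form_cmult, rule alternating_form_compose, rule alternating_standard_form) simp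
  fix v :: "nat \<Rightarrow> R16"
  show "smooth_in_charts A UNIV (\<lambda>ch p. c * canonical_form P p (\<lambda>i. of_coords A ch p *v v i))"
  proof (rule smooth_in_charts_local[OF atlas])
    fix p
    obtain U s where U: "open U" "p \<in> U" and s: "\<forall>q\<in>U. s q \<in> P q" "smooth_frame_field A U s"
      using local_section by blast
    have "smooth_in_charts A U (\<lambda>ch p. c * canonical_form P p (\<lambda>i. of_coords A ch p *v v i))"
    proof (rule smooth_in_charts_cong[OF atlas U(1)])
      let ?F = "\<lambda>ch q. c * standard_form (\<lambda>i. (matrix_inv (s q) ** of_coords A ch q) *v v i)"
      show "?F ch q = c * canonical_form P q (\<lambda>i. of_coords A ch q *v v i)" if "q \<in> U" for ch q
        using canonical_form_eq[of "s q" q] s(1) that by (simp add: matrix_vector_mul_assoc)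
      show "smooth_in_charts A U ?F"
        unfolding smooth_in_charts_def
      proof
        fix ch assume ch: "ch \<in> A"
        let ?S = "snd ch ` (fst ch \<inter> U)"
        have S: "open ?S"
          by (rule open_chart_image[OF atlas ch U(1)])
        have "bounded_linear (\<lambda>B. B *v w)" for w :: R16
          by (intro linear_conv_bounded_linear[THEN iffD1] linearI)
            (simp_all add: matrix_vector_mult_add_rdistrib scaleR_matrix_vector_assoc)
        moreover have "smooth_on ?S (\<lambda>x. matrix_inv (s (chart_inv ch x)) ** of_coords A ch (chart_inv ch x))"
          using smooth_frame_inverse[OF U(1) s] ch by (simp add: smooth_in_charts_def)
        ultimately have "smooth_on ?S (\<lambda>x. (matrix_inv (s (chart_inv ch x)) ** of_coords A ch (chart_inv ch x)) *v v i)" for i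
          by (rule smooth_on_bounded_linear[OF S])
        then show "smooth_on ?S (\<lambda>x. ?F ch (chart_inv ch x))"
          by (intro smooth_on_mult[OF S smooth_on_const] smooth_on_standard_form[OF S])
      qed
    qed
    with U show "\<exists>U. open U \<and> p \<in> U \<and>
        smooth_in_charts A U (\<lambda>ch p. c * canonical_form P p (\<lambda>i. of_coords A ch p *v v i))"
      by blast
  qed
qed

text \<open>Uniqueness on the model space makes \<open>\<Omega>\<^sub>0\<close> a multiple of
  \<open>standard_form\<close>, and any frame transfers this to the manifold. The converse uses that
  \<open>standard_form\<close> is invariant and non-zero.\<close>

lemma canonical_8form_iff:
  "canonical_8form A P \<Omega> \<longleftrightarrow> (\<exists>c. c \<noteq> 0 \<and> \<Omega> = (\<lambda>p v. c * canonical_form P p v))"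
proof
  assume "canonical_8form A P \<Omega>"
  then obtain \<Omega>\<^sub>0 where \<Omega>\<^sub>0: "alternating_form 8 \<Omega>\<^sub>0" "spin9_invariant \<Omega>\<^sub>0" "\<Omega>\<^sub>0 \<noteq> (\<lambda>_. 0)"
    and \<Omega>: "\<And>p u v. u \<in> P p \<Longrightarrow> \<Omega> p (\<lambda>i. u *v v i) = \<Omega>\<^sub>0 v"
    unfolding canonical_8form_def by blast
  obtain c where c: "\<Omega>\<^sub>0 = (\<lambda>v. c * standard_form v)"
    using spin9_invariant_unique[OF \<Omega>\<^sub>0(1,2)] by blast
  have "\<Omega> p v = c * canonical_form P p v" for p v
  proof -
    define u where "u = (SOME u. u \<in> P p)"
    have u: "u \<in> P p"
      unfolding u_def by (rule some_frame)
    have "\<Omega> p v = \<Omega> p (\<lambda>i. u *v (matrix_inv u *v v i))"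
      by (simp add: frame_inverse_vec[OF u])
    also have "\<dots> = c * canonical_form P p v"
      by (simp add: \<Omega>[OF u] c canonical_form_eq[OF u])
    finally show ?thesis .
  qed
  moreover have "c \<noteq> 0"
    using \<Omega>\<^sub>0(3) c by auto
  ultimately show "\<exists>c. c \<noteq> 0 \<and> \<Omega> = (\<lambda>p v. c * canonical_form P p v)"
    by blast
next
  assume "\<exists>c. c \<noteq> 0 \<and> \<Omega> = (\<lambda>p v. c * canonical_form P p v)"
  then obtain c where c: "c \<noteq> 0" and \<Omega>: "\<Omega> = (\<lambda>p v. c * canonical_form P p v)"
    by blast
  have "alternating_form 8 (\<lambda>v. c * standard_form v)"
    by (intro alternating_form_cmult alternating_standard_form)
  moreover have "spin9_invariant (\<lambda>v. c * standard_form v)"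
    using spin9_invariant_standard_form by (simp add: spin9_invariant_def)
  moreover have "(\<lambda>v. c * standard_form v) \<noteq> (\<lambda>_. 0)"
    using c standard_form_nonzero by (auto dest: fun_cong)
  moreover have "\<Omega> p (\<lambda>i. u *v v i) = c * standard_form v" if "u \<in> P p" for p u v
    by (simp add: \<Omega> canonical_form_eq[OF that] frame_inverse_vec[OF that])
  ultimately show "canonical_8form A P \<Omega>"
    unfolding canonical_8form_def using differential_form_canonical_form[of c] \<Omega> by blast
qed

end

theorem theorem1p1:
  fixes A :: "('m::{t2_space, second_countable_topology}, idx16) chart set"
    and g :: "'m \<Rightarrow> R16 \<Rightarrow> R16 \<Rightarrow> real"
    and P :: "'m \<Rightarrow> End16 set"
    and \<nu> :: "'m \<Rightarrow> End16 set"
  assumes "connected (UNIV :: 'm set)"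
    and "oriented_smooth_atlas A"
    and "riemannian_metric A g"
    and "spin9_structure A g P"
    and "\<nu> = spin9_bundle P"
  shows "(\<forall>p. \<exists>U I. p \<in> U \<and> local_basis A g \<nu> U I) \<and>
    (\<exists>\<Phi>. (\<forall>U I. local_basis A g \<nu> U I \<longrightarrow> (\<forall>p\<in>U. \<Phi> p = omega_sum g I p)) \<and>
         (\<forall>\<Omega>. canonical_8form A P \<Omega> \<longleftrightarrow> (\<exists>c. c \<noteq> 0 \<and> \<Omega> = (\<lambda>p v. c * \<Phi> p v))))"
proof (intro conjI allI exI[of _ "canonical_form P"] impI ballI)
  show "\<exists>U I. p \<in> U \<and> local_basis A g \<nu> U I" for p
    unfolding assms(5) by (rule local_basis_exists[OF assms(2-4)])
  show "canonical_form P p = omega_sum g I p" if "local_basis A g \<nu> U I" "p \<in> U" for U I p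
    using omega_sum_eq_canonical_form[OF assms(2-4)] that unfolding assms(5) by simp
  show "canonical_8form A P \<Omega> \<longleftrightarrow> (\<exists>c. c \<noteq> 0 \<and> \<Omega> = (\<lambda>p v. c * canonical_form P p v))" for \<Omega>
    by (rule canonical_8form_iff[OF assms(2-4)])
qed

end
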